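(* Let $L>0$ and set $T_1:=2\pi e^{A_L}$. For $T^\sharp>0$ put $$\beta^*:=\log\frac{T^\sharp}{2\pi}-\frac1{T^\sharp}-A_L .$$ The condition $\beta^*>0$ holds exactly for the $T^\sharp$ above a unique threshold, which exceeds $T_1$ by a relative amount $O(T_1^{-1})$; in particular $T^\sharp>T_1$ is necessary for $\beta^*>0$. Fix any $T^\sharp$ with $\beta^*>0$. (1) For every real even $f\in L^2(\mathbb R)$ with $\operatorname{supp} f\subseteq[-L,L]$, writing $F=\hat f$, $$Q(f)\;\ge\;R(f):=2F(i/2)^2+\frac1\pi\int_0^{T^\sharp}\bigl(\Psi_L(t)-\beta^*\bigr)|F(t)|^2\,dt+\beta^*\|f\|_2^2 .$$ (2) In the basis $(T_n)_{n\ \mathrm{even}}$ of normalized Legendre functions the quadratic form $R$ is represented by the matrix $M_R=\beta^* I+2pp^{\mathsf T}+C$, where $p_n=\int_{-L}^L T_n(x)\cosh(x/2)\,dx$ and $$C_{nm}=\frac1\pi\int_0^{T^\sharp}(\Psi_L(t)-\beta^* )\,\widehat T_n(t)\,\widehat T_m(t)\,dt ,$$ and the entries of $C$ are super-exponentially small once an index exceeds order $eLT^\sharp/2$: there is an explicit constant $K=K(L,T^\sharp)$ such that, with $k=\max(n,m)$, $|C_{nm}|\le K\sqrt{(n+\frac12)(m+\frac12)}\,\frac{(T^\sharp L)^k}{(2k+1)!!}$. (3) Let the basis be cut after $N$ even modes $0,2,\dots,2N-2$, with first discarded order $2N\ge eLT^\sharp/2$, and write $M_R=\begin{pmatrix}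 A & B \\ {B}^{\mathsf T} & D \end{pmatrix}$ with $A$ the leading $N\times N$ block. Let $\varepsilon_D:=\max(0,\beta^*-\inf\operatorname{spec}D)$ and $\varepsilon_B:=\|B\|$ (spectral norm). If $\lambda_{\min}(A)\ge\lambda_0>0$, then $$Q(f)\;\ge\;\bigl(\min(\lambda_0,\ \beta^*-\varepsilon_D)-\varepsilon_B\bigr)\,\|f\|_2^2$$ for all real even $f\in L^2(\mathbb R)$ with $\operatorname{supp} f\subseteq[-L,L]$. Moreover $\varepsilon_D$ and $\varepsilon_B$ are super-exponentially small in $N$ (with explicit bounds): for every $a>0$ they are $O_{L,T^\sharp,a}(e^{-aN})$ as $N\to\infty$; and for $L=0.8$, $T^\sharp=200$, $N=200$ both are below $10^{-100}$.
   Context: $\Lambda$ is the von Mangoldt function and $\psi=\Gamma'/\Gamma$. For $L>0$ the mass of the prime comb is $A_L=\sum_{n\ge2,\ \log n<2L}\frac{2\Lambda(n)}{\sqrt n}$ and the Weil symbol is $$\Psi_L(t)=\operatorname{Re}\psi\Bigl(\tfrac14+\tfrac{it}2\Bigr)-\log\pi-\sum_{n\ge2,\ \log n<2L}\frac{2\Lambda(n)}{\sqrt n}\cos(t\log n).$$ For $f\in L^2(\mathbb R)$ supported in $[-L,L]$, $\hat f(z)=\int_{\mathbb R}f(u)e^{izu}\,du$, an entire function. For such $f$ real and even, with $F=\hat f$, the Weil quadratic form is $$Q(f)=2F(i/2)^2+\frac1{2\pi}\int_{\mathbb R}|F(t)|^2\,\Psi_L(t)\,dt\in(-\infty,+\infty].$$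 For even $n\ge0$, $T_n(x)=\bar P_n(x/L)/\sqrt L$ on $[-L,L]$ (zero outside), where $\bar P_n$ is the Legendre polynomial normalized by $\int_{-1}^1\bar P_n^2=1$; these form an orthonormal basis of the even functions in $L^2[-L,L]$, and $\widehat T_n(t)=(-1)^{n/2}\,2\sqrt{L(n+\frac12)}\,j_n(tL)$ with $j_n$ the spherical Bessel function. $\lambda_{\min}$ denotes the least eigenvalue. *)

theory Defs
  imports
    "HOL-Analysis.Analysis"
    "HOL-Library.Landau_Symbols"
    "HOL-Number_Theory.Prime_Powers"
    "Jordan_Normal_Form.Char_Poly"
begin

section \<open>The Weil symbol\<close>

definition comb_mass :: "real \<Rightarrow> real" where
  "comb_mass L = (\<Sum>n | 2 \<le> n \<and> ln (real n) < 2 * L. 2 * mangoldt n / sqrt (real n))"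

definition weil_symbol :: "real \<Rightarrow> real \<Rightarrow> real" where
  "weil_symbol L t =
     Re (Digamma (1/4 + \<i> * complex_of_real t / 2)) - ln pi
     - (\<Sum>n | 2 \<le> n \<and> ln (real n) < 2 * L.
          2 * mangoldt n / sqrt (real n) * cos (t * ln (real n)))"

definition T1 :: "real \<Rightarrow> real" where
  "T1 L = 2 * pi * exp (comb_mass L)"

definition beta_star :: "real \<Rightarrow> real \<Rightarrow> real" where
  "beta_star L T = ln (T / (2 * pi)) - 1 / T - comb_mass L"

definition is_threshold :: "real \<Rightarrow> real \<Rightarrow> bool" where
  "is_threshold L T0 \<longleftrightarrow> (\<forall>T>0. 0 < beta_star L T \<longleftrightarrow> T0 < T)"


section \<open>The quadratic forms\<close>

text \<open>Real functions in $L^2$ of the line, given by Borel representatives; evenness and the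
  support condition are properties of the class and hence only required almost everywhere.\<close>

definition even_L2 :: "real \<Rightarrow> (real \<Rightarrow> real) set" where
  "even_L2 L = {f. f \<in> borel_measurable lborel
                 \<and> integrable lborel (\<lambda>u. (f u)\<^sup>2)
                 \<and> (AE u in lborel. f (- u) = f u)
                 \<and> (AE u in lborel. u \<notin> {-L..L} \<longrightarrow> f u = 0)}"

definition L2_inner :: "(real \<Rightarrow> real) \<Rightarrow> (real \<Rightarrow> real) \<Rightarrow> real" where
  "L2_inner f g = (LBINT u. f u * g u)"

definition L2_normsq :: "(real \<Rightarrow> real) \<Rightarrow> real" where
  "L2_normsq f = (LBINT u. (f u)\<^sup>2)"

definition fhat :: "(real \<Rightarrow> real) \<Rightarrow> complex \<Rightarrow> complex" where
  "fhat f z = (LBINT u. complex_of_real (f u) * exp (\<i> * complex_of_real u * z))"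

text \<open>Lebesgue integral with values in the extended reals.  A function whose negative part has
  infinite integral gets the value $-\infty$, even if its positive part also has infinite integral
  (the \<^typ>\<open>ereal\<close> difference would be $+\infty$ there).  So a real lower bound on this integral
  includes the finiteness of the integral of the negative part.\<close>

definition ext_integral :: "'a measure \<Rightarrow> ('a \<Rightarrow> real) \<Rightarrow> ereal" where
  "ext_integral M g =
     (if (\<integral>\<^sup>+ x. ennreal (- g x) \<partial>M) = \<infinity> then -\<infinity>
      else enn2ereal (\<integral>\<^sup>+ x. ennreal (g x) \<partial>M) - enn2ereal (\<integral>\<^sup>+ x. ennreal (- g x) \<partial>M))"

text \<open>For real \<open>f\<close> the value of \<open>fhat f\<close> at \<open>\<i>/2\<close> is real; \<^const>\<open>Re\<close> only
  changes the type.\<close>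

definition weil_Q :: "real \<Rightarrow> (real \<Rightarrow> real) \<Rightarrow> ereal" where
  "weil_Q L f =
     ereal (2 * (Re (fhat f (\<i>/2)))\<^sup>2)
     + ereal (1 / (2 * pi)) *
         ext_integral lborel (\<lambda>t. (cmod (fhat f (complex_of_real t)))\<^sup>2 * weil_symbol L t)"

definition form_R :: "real \<Rightarrow> real \<Rightarrow> (real \<Rightarrow> real) \<Rightarrow> real" where
  "form_R L T f =
     2 * (Re (fhat f (\<i>/2)))\<^sup>2
     + 1 / pi * (LBINT t:{0..T}. (weil_symbol L t - beta_star L T)
                                   * (cmod (fhat f (complex_of_real t)))\<^sup>2)
     + beta_star L T * L2_normsq f"


section \<open>Legendre functions and the matrix of the form R\<close>

text \<open>Rodrigues' formula.\<close>

definition legendre_poly :: "nat \<Rightarrow> real poly" where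
  "legendre_poly n = Polynomial.smult (1 / (2 ^ n * fact n)) ((pderiv ^^ n) ([:-1, 0, 1:] ^ n))"

definition legendre_normalized :: "nat \<Rightarrow> real \<Rightarrow> real" where
  "legendre_normalized n x =
     poly (legendre_poly n) x / sqrt (LBINT y:{-1..1}. (poly (legendre_poly n) y)\<^sup>2)"

definition legendre_fun :: "real \<Rightarrow> nat \<Rightarrow> real \<Rightarrow> real" where
  "legendre_fun L n x = (if x \<in> {-L..L} then legendre_normalized n (x / L) / sqrt L else 0)"

definition p_vec :: "real \<Rightarrow> nat \<Rightarrow> real" where
  "p_vec L n = (LBINT x:{-L..L}. legendre_fun L n x * cosh (x / 2))"

text \<open>The transforms of the even functions \<open>legendre_fun L n\<close>, \<open>n\<close> even, are real on the
  real axis.\<close>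

definition C_mat :: "real \<Rightarrow> real \<Rightarrow> nat \<Rightarrow> nat \<Rightarrow> real" where
  "C_mat L T n m =
     1 / pi * (LBINT t:{0..T}. (weil_symbol L t - beta_star L T)
                                 * Re (fhat (legendre_fun L n) (complex_of_real t))
                                 * Re (fhat (legendre_fun L m) (complex_of_real t)))"

text \<open>Row \<open>i\<close> and column \<open>j\<close> of the matrix belong to the even Legendre orders \<open>2 * i\<close>
  and \<open>2 * j\<close>.\<close>

definition M_R :: "real \<Rightarrow> real \<Rightarrow> nat \<Rightarrow> nat \<Rightarrow> real" where
  "M_R L T i j = (if i = j then beta_star L T else 0)
                 + 2 * p_vec L (2 * i) * p_vec L (2 * j) + C_mat L T (2 * i) (2 * j)"

text \<open>\<open>odd_dfact k\<close> is the double factorial of \<open>2 * k + 1\<close>.\<close>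

definition odd_dfact :: "nat \<Rightarrow> real" where
  "odd_dfact k = (\<Prod>i\<le>k. 2 * real i + 1)"

text \<open>The constant comes from
  $\widehat T_n(t) = (-1)^{n/2}\,2\sqrt{L(n+1/2)}\,j_n(tL)$ with $|j_n(x)| \le 1$ and
  $|j_n(x)| \le x^n/(2n+1)!!$ for $x \ge 0$.\<close>

definition K_const :: "real \<Rightarrow> real \<Rightarrow> real" where
  "K_const L T = 4 * L / pi * (LBINT t:{0..T}. \<bar>weil_symbol L t - beta_star L T\<bar>)"


section \<open>Blocks of infinite matrices\<close>

text \<open>For an index set \<open>I\<close>, \<open>ell2 I\<close> is the real Hilbert space of square-summable families
  over \<open>I\<close>, realised as functions that vanish outside \<open>I\<close>.\<close>

definition ell2 :: "nat set \<Rightarrow> (nat \<Rightarrow> real) set" where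
  "ell2 I = {x. (\<forall>i. i \<notin> I \<longrightarrow> x i = 0) \<and> (\<lambda>i. (x i)\<^sup>2) summable_on UNIV}"

definition ell2_norm :: "(nat \<Rightarrow> real) \<Rightarrow> real" where
  "ell2_norm x = sqrt (\<Sum>\<^sub>\<infinity>i. (x i)\<^sup>2)"

definition block_op ::
  "(nat \<Rightarrow> nat \<Rightarrow> real) \<Rightarrow> nat set \<Rightarrow> nat set \<Rightarrow> (nat \<Rightarrow> real) \<Rightarrow> nat \<Rightarrow> real" where
  "block_op M I J x = (\<lambda>i. if i \<in> I then (\<Sum>\<^sub>\<infinity>j\<in>J. M i j * x j) else 0)"

definition block_norm :: "(nat \<Rightarrow> nat \<Rightarrow> real) \<Rightarrow> nat set \<Rightarrow> nat set \<Rightarrow> real" where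
  "block_norm M I J = (SUP x\<in>{x \<in> ell2 J. ell2_norm x \<le> 1}. ell2_norm (block_op M I J x))"

text \<open>The spectrum of the block over \<open>I \<times> I\<close> as an operator on \<open>ell2 I\<close>: the \<open>\<mu>\<close> for
  which the block minus \<open>\<mu>\<close> has no bounded two-sided inverse (such an inverse is automatically
  linear).  It is only used for symmetric real matrices, whose spectrum is real, so real \<open>\<mu>\<close>
  and the real space suffice.\<close>

definition block_spec :: "(nat \<Rightarrow> nat \<Rightarrow> real) \<Rightarrow> nat set \<Rightarrow> real set" where
  "block_spec M I =
     {\<mu>. \<not> (\<exists>S. (\<forall>y\<in>ell2 I. S y \<in> ell2 I)
               \<and> (\<exists>c. \<forall>y\<in>ell2 I. ell2_norm (S y) \<le> c * ell2_norm y)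
               \<and> (\<forall>x\<in>ell2 I. S (\<lambda>i. block_op M I I x i - \<mu> * x i) = x)
               \<and> (\<forall>y\<in>ell2 I. (\<lambda>i. block_op M I I (S y) i - \<mu> * S y i) = y))}"

definition least_eigenvalue :: "real mat \<Rightarrow> real" where
  "least_eigenvalue A = Min {k. eigenvalue A k}"

definition A_block :: "real \<Rightarrow> real \<Rightarrow> nat \<Rightarrow> real mat" where
  "A_block L T N = Matrix.mat N N (\<lambda>(i, j). M_R L T i j)"

definition eps_D :: "real \<Rightarrow> real \<Rightarrow> nat \<Rightarrow> real" where
  "eps_D L T N = max 0 (beta_star L T - Inf (block_spec (M_R L T) {N..}))"

definition eps_B :: "real \<Rightarrow> real \<Rightarrow> nat \<Rightarrow> real" where
  "eps_B L T N = block_norm (M_R L T) {..<N} {N..}"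

text \<open>Explicit bounds for \<open>eps_D\<close> and \<open>eps_B\<close>.  The first bounds the Hilbert-Schmidt norm of
  the part of \<open>C_mat\<close> in which some order is at least \<open>2 * N\<close>, by the entrywise estimate with
  \<open>K_const\<close> and comparison with a geometric series.  The second adds twice the norm of
  \<open>p_vec\<close> (at most $\sqrt{L + \sinh L}$) times the norm of its tail, which is controlled by
  $|p_n| \le 2\sqrt{L(n+1/2)}\cosh(L/2)\,(L/2)^n/(2n+1)!!$.\<close>

definition eps_D_bound :: "real \<Rightarrow> real \<Rightarrow> nat \<Rightarrow> real" where
  "eps_D_bound L T N =
     2 * K_const L T * (2 * real N + 1) powr (3/2) * (T * L) ^ (2 * N) / odd_dfact (2 * N)"

definition eps_B_bound :: "real \<Rightarrow> real \<Rightarrow> nat \<Rightarrow> real" where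
  "eps_B_bound L T N =
     eps_D_bound L T N
     + 8 * cosh (L / 2) * sqrt (L * (L + sinh L) * (2 * real N + 1))
         * (L / 2) ^ (2 * N) / odd_dfact (2 * N)"

end

theory Submission
  imports Defs "HOL-Probability.Characteristic_Functions" "HOL-Real_Asymp.Real_Asymp"
begin

text \<open>
  The threshold.  The function $\beta^*$ increases in $T$ and is $-1/T_1$ at $T_1$.  At
  $T_1(1+\delta)$ it is $\ln(1+\delta) - 1/(T_1(1+\delta))$, and $(1+\delta)\ln(1+\delta) \ge \delta$
  puts its zero at some $\delta \le 1/T_1$.

  The inequality $Q \ge R$.  When $Q(f)$ is finite, the difference $Q(f) - R(f)$ is
  $\frac1{2\pi}\int_{|t|>T}(\Psi_L - \beta^*)|F|^2 +
  \beta^*(\frac1{2\pi}\int|F|^2 - \|f\|^2)$.  The first term is nonnegative because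
  $\Psi_L(t) \ge \beta^*$ for $|t| \ge T$ (\<open>weil_symbol_ge_beta_star\<close>), which rests on
  $\mathrm{Re}\,\psi(x+iy) \ge \frac12\ln(x^2-x+y^2)$, a telescoping bound for the partial sums that
  define $\psi$ (\<open>Re_Digamma_ge\<close>).  The second term is nonnegative by Plancherel
  (\<open>plancherel_ge\<close>): the Gaussian means of $|F|^2$ are Gaussian means of the autocorrelation of \<open>f\<close>
  around 0, and the autocorrelation is continuous at 0 with value $\|f\|^2$.

  The matrix.  Polynomials are dense in $L^2[-L,L]$, so the even Legendre functions satisfy Parseval's
  identity (\<open>legendre_parseval\<close>).  Applied to \<open>f\<close> against $\cosh(\cdot/2)$ and $\cos(t\,\cdot)$ on
  $[-L,L]$ it expands $F(i/2)$ and $F(t)$, and dominated convergence gives the matrix of \<open>R\<close>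
  (\<open>form_R_has_sum\<close>).  Rodrigues' formula and \<open>n\<close> integrations by parts bound the transform of the
  Legendre function of order \<open>n\<close> by a multiple of $(tL)^n/(2n+1)!!$ (\<open>legendre_transform_bound\<close>),
  whence the decay of the entries.

  The blocks.  The matrix is $\beta^*$ times the identity plus a symmetric Hilbert-Schmidt matrix.  For a
  bounded symmetric operator the infimum of the numerical range lies in the spectrum, and no point
  below it does (\<open>not_invertible_at_lower_bound\<close>, \<open>invertible_below\<close>).  So the infimum of the
  spectrum is the best lower bound for the form: this turns $\lambda_{\min}(A)$ and
  $\inf\mathrm{spec}\,D$ into inequalities for quadratic forms, and a two-by-two estimate combines them with
  the norm of \<open>B\<close> (\<open>block_form_ge\<close>).

  The size of the errors.  Since $2pp^T \ge 0$, the spectrum of \<open>D\<close> starts at most the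
  Hilbert-Schmidt norm of the tail of \<open>C\<close> below $\beta^*$; the norm of \<open>B\<close> is at most that of its
  two parts.  Both are tails of series whose terms shrink at least geometrically once
  $2N \ge eLT/2$ (\<open>hs_le_C_tail\<close>, \<open>p_vec_tail_le\<close>), with ratio tending to 0.
\<close>

section \<open>The threshold\<close>

lemma beta_star_strict_mono:
  assumes "0 < s" "s < t"
  shows "beta_star L s < beta_star L t"
proof -
  have "ln (s / (2 * pi)) < ln (t / (2 * pi))"
    using assms by (simp add: divide_strict_right_mono)
  moreover have "1 / t < 1 / s" using assms by (simp add: frac_less2)
  ultimately show ?thesis by (simp add: beta_star_def)
qed

lemma comb_mass_nonneg: "0 \<le> comb_mass L"
  unfolding comb_mass_def by (intro sum_nonneg) (auto simp: mangoldt_nonneg)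

lemma T1_ge_two_pi: "2 * pi \<le> T1 L"
  using comb_mass_nonneg[of L] by (simp add: T1_def)

lemma beta_star_T1_multiple:
  assumes "0 < d"
  shows "beta_star L (T1 L * d) = ln d - 1 / (T1 L * d)"
proof -
  have "T1 L * d / (2 * pi) = exp (comb_mass L) * d" by (simp add: T1_def)
  then show ?thesis
    using assms by (simp add: beta_star_def ln_mult)
qed

text \<open>At $T_1$ the logarithm cancels the comb mass, and $-1/T_1$ remains.\<close>

lemma T1_less_if_beta_star_pos:
  assumes "0 < T" "0 < beta_star L T"
  shows "T1 L < T"
proof (rule ccontr)
  assume "\<not> T1 L < T"
  then have "beta_star L T \<le> beta_star L (T1 L)"
    using beta_star_strict_mono[of T "T1 L" L] assms by (cases "T = T1 L") auto
  moreover have "beta_star L (T1 L) < 0"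
    using beta_star_T1_multiple[of 1 L] T1_ge_two_pi[of L] pi_gt_zero
    by (simp add: divide_pos_pos less_le_trans[OF _ T1_ge_two_pi])
  ultimately show False using assms by simp
qed

text \<open>With $T = T_1(1+\delta)$ the equation $\beta^* = 0$ reads
  $(1+\delta)\ln(1+\delta) = 1/T_1$.  Since $(1+\delta)\ln(1+\delta) \ge \delta$, the sign has
  changed at $\delta = 1/T_1$.\<close>

lemma beta_star_nonneg_at_T1_plus_1:
  "0 \<le> beta_star L (T1 L + 1)"
proof -
  define d where "d = 1 / T1 L"
  have T: "0 < T1 L" using T1_ge_two_pi[of L] pi_gt_zero by linarith
  have d: "0 < d" using T by (simp add: d_def)
  have "1 - 1 / (1 + d) \<le> ln (1 + d)"
    using ln_le_minus_one[of "1 / (1 + d)"] d by (simp add: ln_div)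
  moreover have "1 - 1 / (1 + d) = 1 / (T1 L * (1 + d))"
  proof -
    have "T1 L * (1 + d) = T1 L + 1" using T by (simp add: d_def field_simps)
    moreover have "1 - 1 / (1 + d) = 1 / (T1 L + 1)"
      using T by (simp add: d_def field_simps add_pos_pos)
    ultimately show ?thesis by simp
  qed
  ultimately have "0 \<le> beta_star L (T1 L * (1 + d))"
    using beta_star_T1_multiple[of "1 + d" L] d by simp
  moreover have "T1 L * (1 + d) = T1 L + 1" using T by (simp add: d_def field_simps)
  ultimately show ?thesis by simp
qed

lemma threshold_unique_and_close:
  shows "\<exists>!T0. is_threshold L T0"
    and "is_threshold L T0 \<Longrightarrow> T1 L < T0 \<and> (T0 - T1 L) / T1 L \<le> 1 * inverse (T1 L)"
proof -
  have T: "0 < T1 L" using T1_ge_two_pi[of L] pi_gt_zero by linarith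
  have neg: "beta_star L (T1 L) < 0"
    using T beta_star_T1_multiple[of 1 L] by simp
  have "\<exists>x\<ge>T1 L. x \<le> T1 L + 1 \<and> beta_star L x = 0"
  proof (rule IVT')
    show "continuous_on {T1 L..T1 L + 1} (beta_star L)"
      unfolding beta_star_def using T by (intro continuous_intros) auto
  qed (use neg beta_star_nonneg_at_T1_plus_1[of L] in auto)
  then obtain Z where Z: "T1 L \<le> Z" "Z \<le> T1 L + 1" "beta_star L Z = 0" by blast
  have Z': "T1 L < Z" using Z neg by (cases "Z = T1 L") auto
  have thr: "is_threshold L Z"
    unfolding is_threshold_def
  proof (intro allI impI)
    fix U :: real assume "0 < U"
    then show "0 < beta_star L U \<longleftrightarrow> Z < U"
      using beta_star_strict_mono[of U Z L] beta_star_strict_mono[of Z U L] Z T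
      by (cases U Z rule: linorder_cases) auto
  qed
  have uniq: "Y = Z" if "is_threshold L Y" for Y
  proof (rule ccontr)
    assume "Y \<noteq> Z"
    have *: "Y < U \<longleftrightarrow> Z < U" if "0 < U" for U
      using that thr \<open>is_threshold L Y\<close> by (auto simp: is_threshold_def)
    show False
    proof (cases "Y < Z")
      case True
      then show False using *[of Z] T Z by auto
    next
      case False
      then show False using *[of Y] \<open>Y \<noteq> Z\<close> T Z by auto
    qed
  qed
  show "\<exists>!T0. is_threshold L T0" using thr uniq by blast
  show "T1 L < T0 \<and> (T0 - T1 L) / T1 L \<le> 1 * inverse (T1 L)" if "is_threshold L T0"
  proof -
    have "(Z - T1 L) / T1 L \<le> 1 / T1 L" using Z T by (intro divide_right_mono) auto
    then show ?thesis using uniq[OF that] Z' by (simp add: inverse_eq_divide)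
  qed
qed

section \<open>The digamma function on vertical lines\<close>

text \<open>The bounds $v \le \mathrm{artanh}\,v \le v/(1-v^2)$, by comparison of derivatives.\<close>

lemma ln_ratio_bounds:
  fixes v :: real
  assumes "0 \<le> v" "v < 1"
  shows "2 * v \<le> ln (1 + v) - ln (1 - v)"
    and "ln (1 + v) - ln (1 - v) \<le> 2 * v / (1 - v\<^sup>2)"
proof -
  have sq: "x\<^sup>2 < 1" if "0 \<le> x" "x \<le> v" for x :: real
    using that assms by (simp add: power_less_one_iff abs_square_less_1)
  have "(\<lambda>v. ln (1 + v) - ln (1 - v) - 2 * v) 0 \<le> (\<lambda>v. ln (1 + v) - ln (1 - v) - 2 * v) v"
  proof (rule DERIV_nonneg_imp_nondecreasing[OF assms(1)])
    fix x assume x: "0 \<le> x" "x \<le> v"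
    have "((\<lambda>v. ln (1 + v) - ln (1 - v) - 2 * v) has_real_derivative (1 / (1 + x) + 1 / (1 - x) - 2)) (at x)"
      using x assms by (auto intro!: derivative_eq_intros)
    moreover have "1 / (1 + x) + 1 / (1 - x) - 2 = 2 * x\<^sup>2 / (1 - x\<^sup>2)"
      using x assms sq[OF x] by (simp add: field_simps power2_eq_square)
    ultimately show "\<exists>y. ((\<lambda>v. ln (1 + v) - ln (1 - v) - 2 * v) has_real_derivative y) (at x) \<and> 0 \<le> y"
      using sq[OF x] by (intro exI[of _ "2 * x\<^sup>2 / (1 - x\<^sup>2)"]) simp
  qed
  then show "2 * v \<le> ln (1 + v) - ln (1 - v)" by simp
  let ?h = "\<lambda>v::real. 2 * v / (1 - v\<^sup>2) - (ln (1 + v) - ln (1 - v))"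
  have "?h 0 \<le> ?h v"
  proof (rule DERIV_nonneg_imp_nondecreasing[OF assms(1)])
    fix x assume x: "0 \<le> x" "x \<le> v"
    let ?d = "(2 * (1 - x\<^sup>2) + 4 * x\<^sup>2) / (1 - x\<^sup>2)\<^sup>2 - (1 / (1 + x) + 1 / (1 - x))"
    have d: "(?h has_real_derivative ?d) (at x)"
      using x assms sq[OF x]
      by (auto intro!: derivative_eq_intros simp: power2_eq_square algebra_simps)
    have "1 / (1 + x) + 1 / (1 - x) = 2 / (1 - x\<^sup>2)"
      using x assms sq[OF x] by (simp add: field_simps power2_eq_square)
    moreover have "2 / (1 - x\<^sup>2) = 2 * (1 - x\<^sup>2) / (1 - x\<^sup>2)\<^sup>2"
    proof -
      have "2 / w = 2 * w / w\<^sup>2" if "w > 0" for w :: real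
        using that by (simp add: power2_eq_square)
      from this[of "1 - x\<^sup>2"] show ?thesis using sq[OF x] by simp
    qed
    ultimately have "?d = 4 * x\<^sup>2 / (1 - x\<^sup>2)\<^sup>2"
      by (simp add: add_divide_distrib diff_divide_distrib)
    with d have "(?h has_real_derivative 4 * x\<^sup>2 / (1 - x\<^sup>2)\<^sup>2) (at x)" by simp
    then show "\<exists>y. (?h has_real_derivative y) (at x) \<and> 0 \<le> y"
      by (intro exI[of _ "4 * x\<^sup>2 / (1 - x\<^sup>2)\<^sup>2"]) simp
  qed
  then show "ln (1 + v) - ln (1 - v) \<le> 2 * v / (1 - v\<^sup>2)" by simp
qed

text \<open>With $a = x^2+y^2$ the arguments of the logarithms are $a+x$ and $a-x$, so the right-hand side is
  $\mathrm{artanh}(x/a) \ge x/a$.\<close>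

lemma Re_inverse_lower_step:
  fixes x y :: real
  assumes x: "0 < x" and p: "0 < x\<^sup>2 - x + y\<^sup>2"
  shows "x / (x\<^sup>2 + y\<^sup>2) \<le> 1/2 * (ln ((x + 1)\<^sup>2 - (x + 1) + y\<^sup>2) - ln (x\<^sup>2 - x + y\<^sup>2))"
proof -
  define a where "a = x\<^sup>2 + y\<^sup>2"
  have a: "x < a" "0 < a" using p x by (auto simp: a_def)
  have v: "0 \<le> x / a" "x / a < 1" using a x by auto
  have "1 + x / a = (a + x) / a" "1 - x / a = (a - x) / a" using a by (auto simp: field_simps)
  then have "ln (1 + x / a) - ln (1 - x / a) = ln (a + x) - ln (a - x)"
    using a x by (simp add: ln_div)
  moreover have "(x + 1)\<^sup>2 - (x + 1) + y\<^sup>2 = a + x" "x\<^sup>2 - x + y\<^sup>2 = a - x"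
    by (auto simp: a_def power2_eq_square algebra_simps)
  ultimately have "2 * (x / a) \<le> ln ((x + 1)\<^sup>2 - (x + 1) + y\<^sup>2) - ln (x\<^sup>2 - x + y\<^sup>2)"
    using ln_ratio_bounds(1)[OF v] by presburger
  moreover have "u \<le> 1/2 * w" if "2 * u \<le> w" for u w :: real using that by simp
  ultimately show ?thesis unfolding a_def by blast
qed

text \<open>With $S = x^2+y^2+1$ the left-hand side is $\mathrm{artanh}(x/S) \le xS/(S^2-x^2)$, and
  $S^2 - x^2 - S(x^2+y^2) = y^2+1 > 0$.\<close>

lemma Re_inverse_upper_step:
  fixes x y :: real
  assumes x: "0 < x"
  shows "1/2 * (ln ((x + 1)\<^sup>2 - (x + 1) + (1 + y\<^sup>2)) - ln (x\<^sup>2 - x + (1 + y\<^sup>2))) \<le> x / (x\<^sup>2 + y\<^sup>2)"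
proof -
  define S where "S = x\<^sup>2 + y\<^sup>2 + 1"
  have "0 \<le> (x - 1/2)\<^sup>2" by simp
  then have "x\<^sup>2 - x \<ge> - (1/4)" by (simp add: power2_eq_square algebra_simps)
  moreover have "0 \<le> y\<^sup>2" "0 \<le> x\<^sup>2" by auto
  ultimately have S: "x < S" "0 < S" unfolding S_def by linarith+
  have v: "0 \<le> x / S" "x / S < 1" using S x by auto
  have "1 + x / S = (S + x) / S" "1 - x / S = (S - x) / S" using S by (auto simp: field_simps)
  then have "ln (1 + x / S) - ln (1 - x / S) = ln (S + x) - ln (S - x)"
    using S x by (simp add: ln_div)
  moreover have "(x + 1)\<^sup>2 - (x + 1) + (1 + y\<^sup>2) = S + x" "x\<^sup>2 - x + (1 + y\<^sup>2) = S - x"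
    by (auto simp: S_def power2_eq_square algebra_simps)
  ultimately have "ln ((x + 1)\<^sup>2 - (x + 1) + (1 + y\<^sup>2)) - ln (x\<^sup>2 - x + (1 + y\<^sup>2))
      \<le> 2 * (x / S) / (1 - (x / S)\<^sup>2)"
    using ln_ratio_bounds(2)[OF v] by presburger
  moreover have "x / S / (1 - (x / S)\<^sup>2) \<le> x / (x\<^sup>2 + y\<^sup>2)"
  proof -
    have "(S - x) * (S + x) > 0" using S x by simp
    then have pos: "S\<^sup>2 - x\<^sup>2 > 0" by (simp add: power2_eq_square algebra_simps)
    have "x / S / (1 - (x / S)\<^sup>2) = x * (S / (S\<^sup>2 - x\<^sup>2))"
      using S pos by (simp add: field_simps power2_eq_square)
    also have "S / (S\<^sup>2 - x\<^sup>2) \<le> 1 / (x\<^sup>2 + y\<^sup>2)"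
    proof -
      have "S * (x\<^sup>2 + y\<^sup>2) \<le> S\<^sup>2 - x\<^sup>2"
        by (simp add: S_def power2_eq_square algebra_simps)
      moreover have "0 < x\<^sup>2 + y\<^sup>2" using x by (simp add: add_pos_nonneg)
      ultimately show ?thesis using pos by (simp add: field_simps)
    qed
    finally show ?thesis using x by (simp add: mult_left_mono)
  qed
  moreover have "1/2 * w \<le> r" if "w \<le> 2 * u / q" "u / q \<le> r" for u w q r :: real
    using that by simp
  ultimately show ?thesis by blast
qed

lemma Re_Digamma_LIMSEQ:
  assumes "0 < x"
  shows "(\<lambda>m. ln (real m) - (\<Sum>n<m. (x + real n) / ((x + real n)\<^sup>2 + y\<^sup>2)))
           \<longlonglongrightarrow> Re (Digamma (Complex x y))"
proof -
  have "Complex x y \<noteq> 0" using assms by (auto simp: complex_eq_iff)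
  from tendsto_Re[OF Digamma_LIMSEQ[OF this]] show ?thesis
    by (simp add: complex_eq_iff Re_sum inverse_complex.sel)
qed

text \<open>Both bounds come from one computation: $x/(x^2+y^2) = \operatorname{Re} 1/(x+iy)$ lies between the
  steps of $\frac12\ln(x^2-x+y^2+1)$ and of $\frac12\ln(x^2-x+y^2)$, so the partial sums in the limit
  formula for the digamma function telescope.\<close>

lemma Re_Digamma_ge:
  assumes x: "0 < x" and p: "0 < x\<^sup>2 - x + y\<^sup>2"
  shows "1/2 * ln (x\<^sup>2 - x + y\<^sup>2) \<le> Re (Digamma (Complex x y))"
proof -
  define P where "P u = 1/2 * ln (u\<^sup>2 - u + y\<^sup>2)" for u :: real
  have pos: "0 < (x + real n)\<^sup>2 - (x + real n) + y\<^sup>2" for n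
  proof (induction n)
    case (Suc n)
    have "(x + real (Suc n))\<^sup>2 - (x + real (Suc n)) + y\<^sup>2
          = ((x + real n)\<^sup>2 - (x + real n) + y\<^sup>2) + 2 * (x + real n)"
      by (simp add: power2_eq_square algebra_simps)
    then show ?case using Suc x by simp
  qed (use p in simp)
  have step: "(x + real n) / ((x + real n)\<^sup>2 + y\<^sup>2) \<le> P (x + real (Suc n)) - P (x + real n)" for n
    using Re_inverse_lower_step[OF _ pos[of n]] x by (simp add: P_def algebra_simps)
  have "(\<Sum>n<m. (x + real n) / ((x + real n)\<^sup>2 + y\<^sup>2)) \<le> P (x + real m) - P x" for m
  proof -
    have "(\<Sum>n<m. (x + real n) / ((x + real n)\<^sup>2 + y\<^sup>2))
          \<le> (\<Sum>n<m. P (x + real (Suc n)) - P (x + real n))"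
      by (intro sum_mono step)
    also have "\<dots> = P (x + real m) - P x"
      using sum_lessThan_telescope[of "\<lambda>n. P (x + real n)" m] by simp
    finally show ?thesis .
  qed
  then have le: "(ln (real m) - P (real m + x)) + P x
      \<le> ln (real m) - (\<Sum>n<m. (x + real n) / ((x + real n)\<^sup>2 + y\<^sup>2))" for m
    by (smt (verit) add.commute)
  have "(\<lambda>m. ln (real m) - P (real m + x)) \<longlonglongrightarrow> 0"
    unfolding P_def by real_asymp
  from tendsto_add[OF this tendsto_const[of "P x"]]
  have "(\<lambda>m. (ln (real m) - P (real m + x)) + P x) \<longlonglongrightarrow> P x" by simp
  from LIMSEQ_le[OF this Re_Digamma_LIMSEQ[OF x]] show ?thesis
    using le by (auto simp: P_def)
qed

lemma Re_Digamma_le: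
  assumes x: "0 < x"
  shows "Re (Digamma (Complex x y)) \<le> 1/2 * ln (x\<^sup>2 - x + (1 + y\<^sup>2))"
proof -
  define P where "P u = 1/2 * ln (u\<^sup>2 - u + (1 + y\<^sup>2))" for u :: real
  have step: "P (x + real (Suc n)) - P (x + real n) \<le> (x + real n) / ((x + real n)\<^sup>2 + y\<^sup>2)" for n
    using Re_inverse_upper_step[of "x + real n" y] x by (simp add: P_def algebra_simps)
  have "P (x + real m) - P x \<le> (\<Sum>n<m. (x + real n) / ((x + real n)\<^sup>2 + y\<^sup>2))" for m
  proof -
    have "P (x + real m) - P x = (\<Sum>n<m. P (x + real (Suc n)) - P (x + real n))"
      using sum_lessThan_telescope[of "\<lambda>n. P (x + real n)" m] by simp
    also have "\<dots> \<le> (\<Sum>n<m. (x + real n) / ((x + real n)\<^sup>2 + y\<^sup>2))"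
      by (intro sum_mono step)
    finally show ?thesis .
  qed
  then have le: "ln (real m) - (\<Sum>n<m. (x + real n) / ((x + real n)\<^sup>2 + y\<^sup>2))
      \<le> (ln (real m) - P (real m + x)) + P x" for m
    by (smt (verit) add.commute)
  have "(\<lambda>m. ln (real m) - P (real m + x)) \<longlonglongrightarrow> 0"
    unfolding P_def by real_asymp
  from tendsto_add[OF this tendsto_const[of "P x"]]
  have "(\<lambda>m. (ln (real m) - P (real m + x)) + P x) \<longlonglongrightarrow> P x" by simp
  from LIMSEQ_le[OF Re_Digamma_LIMSEQ[OF x] this] show ?thesis
    using le by (auto simp: P_def)
qed

section \<open>The Weil symbol\<close>

lemma weil_symbol_eq:
  "weil_symbol L t = Re (Digamma (Complex (1/4) (t / 2))) - ln pi
     - (\<Sum>n | 2 \<le> n \<and> ln (real n) < 2 * L. 2 * mangoldt n / sqrt (real n) * cos (t * ln (real n)))"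
proof -
  have "1/4 + \<i> * complex_of_real t / 2 = Complex (1/4) (t / 2)" by (simp add: complex_eq_iff)
  then show ?thesis by (simp add: weil_symbol_def)
qed

lemma comb_sum_bound:
  "\<bar>\<Sum>n | 2 \<le> n \<and> ln (real n) < 2 * L. 2 * mangoldt n / sqrt (real n) * cos (t * ln (real n))\<bar>
     \<le> comb_mass L"
proof -
  have "\<bar>2 * mangoldt n / sqrt (real n) * cos (t * ln (real n))\<bar> \<le> 2 * mangoldt n / sqrt (real n)" for n
    using mult_left_mono[of "\<bar>cos (t * ln (real n))\<bar>" 1 "2 * mangoldt n / sqrt (real n)"]
    by (simp add: abs_mult mangoldt_nonneg)
  then show ?thesis
    unfolding comb_mass_def by (intro order_trans[OF sum_abs] sum_mono)
qed

lemma continuous_weil_symbol: "continuous_on A (weil_symbol L)"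
proof -
  have "1/4 + \<i> * complex_of_real t / 2 \<notin> \<int>\<^sub>\<le>\<^sub>0" for t
    by (auto elim!: nonpos_Ints_cases simp: complex_eq_iff)
  then have "continuous_on A (\<lambda>t. Digamma (1/4 + \<i> * complex_of_real t / 2))"
    by (intro continuous_on_compose2[OF continuous_on_Polygamma[of "- \<int>\<^sub>\<le>\<^sub>0"]]
          continuous_intros) auto
  then show ?thesis
    unfolding weil_symbol_def by (intro continuous_intros) auto
qed

lemma weil_symbol_measurable [measurable]: "weil_symbol L \<in> borel_measurable borel"
  by (rule borel_measurable_continuous_onI[OF continuous_weil_symbol])

lemma weil_symbol_minus: "weil_symbol L (- t) = weil_symbol L t"
proof -
  let ?f = "\<lambda>t m. ln (real m) - (\<Sum>n<m. (1/4 + real n) / ((1/4 + real n)\<^sup>2 + t\<^sup>2))"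
  have "Re (Digamma (Complex (1/4) (- t / 2))) = Re (Digamma (Complex (1/4) (t / 2)))"
    using LIMSEQ_unique[OF Re_Digamma_LIMSEQ[of "1/4" "- t / 2"]] Re_Digamma_LIMSEQ[of "1/4" "t / 2"]
    by simp
  then show ?thesis by (simp add: weil_symbol_eq)
qed

text \<open>At $x = 1/4$ the lower bound for the digamma function is $\frac12\ln(y^2-\frac3{16})$ with
  $y = |t|/2$.  It falls short of $\ln y$ by a multiple of $1/y^2$ only, and the term $1/T$ in
  $\beta^*$ pays for that because $\beta^* > 0$ forces $T > 2\pi$.\<close>

lemma weil_symbol_ge_beta_star:
  assumes T: "0 < T" "0 < beta_star L T" and t: "T \<le> \<bar>t\<bar>"
  shows "beta_star L T \<le> weil_symbol L t"
proof -
  define y where "y = \<bar>t\<bar> / 2"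
  have "2 * pi < \<bar>t\<bar>" using T1_less_if_beta_star_pos[OF T] T1_ge_two_pi[of L] t by linarith
  then have y: "3 < y" using pi_gt3 by (simp add: y_def)
  have sq: "(1/4)\<^sup>2 - 1/4 + y\<^sup>2 = y\<^sup>2 * (1 - 3 / (16 * y\<^sup>2))" using y by (simp add: field_simps power2_eq_square)
  have y1: "3 / (16 * y\<^sup>2) < 1" "y\<^sup>2 > 9"
    using y power_strict_mono[of 3 y 2] by (auto simp: field_simps)
  have "ln y - 1 / (2 * y) \<le> 1/2 * ln ((1/4)\<^sup>2 - 1/4 + y\<^sup>2)"
  proof -
    define v where "v = 3 / (16 * y\<^sup>2)"
    have v: "0 \<le> v" "v < 1" using y1 by (auto simp: v_def)
    have "- ln (1 - v) \<le> 1 / (1 - v) - 1"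
      using ln_le_minus_one[of "1 / (1 - v)"] v by (simp add: ln_div)
    also have "\<dots> = 3 / (16 * y\<^sup>2 - 3)"
      using y1 y by (simp add: v_def field_simps)
    also have "\<dots> \<le> 1 / y"
    proof -
      have "3 * y \<le> 16 * y\<^sup>2 - 3"
        using y y1(2) mult_right_mono[of 3 y y] unfolding power2_eq_square by linarith
      then show ?thesis using y y1 by (simp add: field_simps)
    qed
    finally have "- (1 / y) \<le> ln (1 - v)" by simp
    moreover have "ln (y\<^sup>2 * (1 - v)) = 2 * ln y + ln (1 - v)"
      using y v by (simp add: ln_mult ln_realpow)
    ultimately show ?thesis using sq by (simp add: v_def)
  qed
  also have "\<dots> \<le> Re (Digamma (Complex (1/4) y))"
  proof (intro Re_Digamma_ge)
    show "0 < (1/4)\<^sup>2 - 1/4 + y\<^sup>2" using y1(2) by (simp add: power2_eq_square)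
  qed simp
  also have "Re (Digamma (Complex (1/4) y)) - ln pi - comb_mass L \<le> weil_symbol L \<bar>t\<bar>"
    using comb_sum_bound[where L = L and t = "\<bar>t\<bar>"] by (simp add: weil_symbol_eq y_def)
  also have "weil_symbol L \<bar>t\<bar> = weil_symbol L t"
    by (cases "t \<ge> 0") (auto simp: weil_symbol_minus)
  finally have "ln y - 1 / (2 * y) - ln pi - comb_mass L \<le> weil_symbol L t" by simp
  moreover have "beta_star L \<bar>t\<bar> = ln y - 1 / (2 * y) - ln pi - comb_mass L"
    using y by (simp add: beta_star_def y_def ln_div ln_mult)
  moreover have "beta_star L T \<le> beta_star L \<bar>t\<bar>"
    using beta_star_strict_mono[of T "\<bar>t\<bar>" L] T t by (cases "T = \<bar>t\<bar>") auto
  ultimately show ?thesis by simp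
qed

section \<open>Legendre polynomials\<close>

definition legendre_weight :: "nat \<Rightarrow> real poly" where
  "legendre_weight n = [:-1, 0, 1:] ^ n"

lemma poly_legendre_weight: "poly (legendre_weight n) x = (x\<^sup>2 - 1) ^ n"
  by (simp add: legendre_weight_def power2_eq_square algebra_simps)

lemma legendre_poly_weight:
  "legendre_poly n = Polynomial.smult (1 / (2 ^ n * fact n)) ((pderiv ^^ n) (legendre_weight n))"
  by (simp add: legendre_poly_def legendre_weight_def)

text \<open>Each derivative removes at most one factor $x^2-1$.\<close>

lemma pderiv_legendre_weight_factor:
  "k \<le> n \<Longrightarrow> \<exists>r. (pderiv ^^ k) (legendre_weight n) = [:-1, 0, 1:] ^ (n - k) * r"
proof (induction k)
  case 0
  show ?case by (auto simp: legendre_weight_def intro: exI[of _ 1])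
next
  case (Suc k)
  then obtain r where r: "(pderiv ^^ k) (legendre_weight n) = [:-1, 0, 1:] ^ (n - k) * r" by auto
  obtain m where m: "n - k = Suc m" using Suc.prems by (cases "n - k") auto
  then have nk: "n - Suc k = m" by simp
  have "(pderiv ^^ Suc k) (legendre_weight n) = pderiv ([:-1, 0, 1:] ^ Suc m * r)"
    using r m by simp
  also have "\<dots> = [:-1, 0, 1:] ^ m * ([:-1, 0, 1:] * pderiv r + Polynomial.smult (of_nat (Suc m)) (pderiv [:-1, 0, 1:]) * r)"
    by (simp only: pderiv_mult pderiv_power_Suc) (simp add: algebra_simps)
  finally show ?case using nk by blast
qed

lemma pderiv_legendre_weight_boundary:
  assumes "k < n" "x\<^sup>2 = 1"
  shows "poly ((pderiv ^^ k) (legendre_weight n)) x = 0"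
proof -
  obtain r where "(pderiv ^^ k) (legendre_weight n) = [:-1, 0, 1:] ^ (n - k) * r"
    using pderiv_legendre_weight_factor[of k n] assms by auto
  then show ?thesis using assms by (simp add: power2_eq_square)
qed

lemma degree_legendre_weight: "degree (legendre_weight n) = 2 * n"
  by (simp add: legendre_weight_def degree_power_eq)

lemma integrable_on_interval:
  fixes f :: "real \<Rightarrow> real"
  assumes "continuous_on {a..b} f"
  shows "set_integrable lborel {a..b} f"
  using borel_integrable_atLeastAtMost'[OF assms] .

lemma set_integral_by_parts:
  fixes F G f g :: "real \<Rightarrow> real"
  assumes "a \<le> b" "\<And>x. DERIV F x :> f x" "\<And>x. DERIV G x :> g x"
    "continuous_on UNIV f" "continuous_on UNIV g"
  shows "(LBINT x:{a..b}. f x * G x) = F b * G b - F a * G a - (LBINT x:{a..b}. F x * g x)"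
proof -
  have "(LBINT x. (F x * g x) * indicator {a..b} x)
      = F b * G b - F a * G a - (LBINT x. (f x * G x) * indicator {a..b} x)"
    using assms by (intro integral_by_parts) (auto simp: continuous_on_eq_continuous_at)
  then show ?thesis by (simp add: set_lebesgue_integral_def mult.commute)
qed

text \<open>The derivatives of the weight below order \<open>n\<close> vanish at both end points, so all boundary
  terms disappear.\<close>

lemma legendre_by_parts:
  fixes G :: "nat \<Rightarrow> real \<Rightarrow> real"
  assumes G: "\<And>k x. DERIV (G k) x :> G (Suc k) x"
  shows "(LBINT x:{-1..1}. poly (legendre_poly n) x * G 0 x)
           = 1 / (2 ^ n * fact n) * (LBINT x:{-1..1}. (1 - x\<^sup>2) ^ n * G n x)"
proof -
  have cont: "continuous_on UNIV (G k)" for k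
    by (meson G DERIV_isCont continuous_at_imp_continuous_on)
  have "k \<le> n \<Longrightarrow> (LBINT x:{-1..1}. poly ((pderiv ^^ n) (legendre_weight n)) x * G 0 x)
      = (-1) ^ k * (LBINT x:{-1..1}. poly ((pderiv ^^ (n - k)) (legendre_weight n)) x * G k x)" for k
  proof (induction k)
    case (Suc k)
    define q where "q = (pderiv ^^ (n - Suc k)) (legendre_weight n)"
    have q: "pderiv q = (pderiv ^^ (n - k)) (legendre_weight n)"
      using Suc.prems by (simp add: q_def Suc_diff_Suc flip: funpow.simps(2)[unfolded o_def, THEN fun_cong])
    have zero: "poly q 1 = 0" "poly q (-1) = 0"
      unfolding q_def using Suc.prems by (auto intro!: pderiv_legendre_weight_boundary)
    have "(LBINT x:{-1..1}. poly (pderiv q) x * G k x)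
        = poly q 1 * G k 1 - poly q (-1) * G k (-1) - (LBINT x:{-1..1}. poly q x * G (Suc k) x)"
      by (intro set_integral_by_parts poly_DERIV G cont continuous_intros) auto
    with Suc zero q show ?case by (simp add: q_def)
  qed simp
  from this[of n] have *: "(LBINT x:{-1..1}. poly ((pderiv ^^ n) (legendre_weight n)) x * G 0 x)
      = (-1) ^ n * (LBINT x:{-1..1}. (x\<^sup>2 - 1) ^ n * G n x)"
    by (simp add: poly_legendre_weight)
  have "(x\<^sup>2 - 1) ^ n = (-1) ^ n * (1 - x\<^sup>2) ^ n" for x :: real
    by (simp flip: power_mult_distrib)
  then have "(LBINT x:{-1..1}. (x\<^sup>2 - 1) ^ n * G n x) = (-1) ^ n * (LBINT x:{-1..1}. (1 - x\<^sup>2) ^ n * G n x)"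
    by (simp add: mult.assoc)
  with * show ?thesis
    by (simp add: legendre_poly_weight mult.assoc flip: power_mult_distrib)
qed

lemma odd_dfact_pos: "0 < odd_dfact k"
  unfolding odd_dfact_def by (intro prod_pos) auto

lemma odd_dfact_Suc: "odd_dfact (Suc k) = (2 * real k + 3) * odd_dfact k"
  by (simp add: odd_dfact_def)

lemma odd_dfact_fact: "odd_dfact n * 2 ^ n * fact n = fact (2 * n + 1)"
proof (induction n)
  case (Suc n)
  have "odd_dfact (Suc n) * 2 ^ Suc n * fact (Suc n)
      = (2 * real n + 3) * (2 * real n + 2) * (odd_dfact n * 2 ^ n * fact n)"
    by (simp add: odd_dfact_Suc algebra_simps)
  also have "\<dots> = fact (2 * Suc n + 1)" unfolding Suc by (simp add: algebra_simps)
  finally show ?case .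
qed (simp add: odd_dfact_def)

text \<open>Wallis' integral; the recursion comes from integrating the derivative of $x(1-x^2)^{n+1}$.\<close>

lemma wallis_integral:
  "(LBINT x:{-1..1}. (1 - x\<^sup>2) ^ n) = 2 * (2 ^ n * fact n) / odd_dfact n"
proof (induction n)
  case 0
  show ?case by (simp add: odd_dfact_def set_lebesgue_integral_def)
next
  case (Suc n)
  let ?I = "\<lambda>n. (LBINT x:{-1..1::real}. (1 - x\<^sup>2) ^ n)"
  have int: "set_integrable lborel {-1..1::real} (\<lambda>x. (1 - x\<^sup>2) ^ k)" for k
    by (intro integrable_on_interval continuous_intros)
  have alg: "x * (- 2 * real (Suc n) * x * (1 - x\<^sup>2) ^ n)
      = 2 * real (Suc n) * ((1 - x\<^sup>2) ^ Suc n - (1 - x\<^sup>2) ^ n)" for x :: real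
    by (simp add: algebra_simps power2_eq_square)
  have "(LBINT x:{-1..1::real}. 1 * (1 - x\<^sup>2) ^ Suc n)
      = 1 * (1 - 1\<^sup>2) ^ Suc n - (-1) * (1 - (-1)\<^sup>2) ^ Suc n
        - (LBINT x:{-1..1}. x * (- 2 * real (Suc n) * x * (1 - x\<^sup>2) ^ n))"
    by (rule set_integral_by_parts) (auto intro!: derivative_eq_intros continuous_intros simp: algebra_simps simp del: power_Suc)
  then have "?I (Suc n) = - (2 * real (Suc n) * (?I (Suc n) - ?I n))"
    unfolding alg using int by (simp add: set_integral_diff del: power_Suc)
  then have "(2 * real n + 3) * ?I (Suc n) = 2 * real (Suc n) * ?I n"
    by (simp add: algebra_simps del: power_Suc)
  then have "?I (Suc n) = 2 * real (Suc n) * ?I n / (2 * real n + 3)"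
    by (simp add: field_simps del: power_Suc)
  then show ?case using Suc by (simp add: odd_dfact_Suc field_simps del: power_Suc) (simp add: field_simps)
qed

text \<open>After \<open>n\<close> integrations by parts the \<open>n\<close>-th derivative of \<open>G 0\<close> is averaged against a positive
  weight of known mass.  The functions $\cos(s\,\cdot)$ and $\cosh(a\,\cdot)$ will be inserted.\<close>

lemma legendre_transform_bound:
  fixes G :: "nat \<Rightarrow> real \<Rightarrow> real"
  assumes G: "\<And>k x. DERIV (G k) x :> G (Suc k) x"
    and bound: "\<And>x. x \<in> {-1..1} \<Longrightarrow> \<bar>G n x\<bar> \<le> B"
  shows "\<bar>LBINT x:{-1..1}. poly (legendre_poly n) x * G 0 x\<bar> \<le> 2 * B / odd_dfact n"
proof -
  have cont: "continuous_on A (G k)" for k A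
    by (meson G DERIV_isCont continuous_at_imp_continuous_on)
  have sq: "x\<^sup>2 \<le> 1" if "x \<in> {-1..1}" for x :: real
    using that by (simp add: abs_square_le_1 abs_le_iff)
  have "\<bar>LBINT x:{-1..1}. (1 - x\<^sup>2) ^ n * G n x\<bar> \<le> (LBINT x:{-1..1}. \<bar>(1 - x\<^sup>2) ^ n * G n x\<bar>)"
    unfolding set_lebesgue_integral_def
    by (rule order_trans[OF integral_abs_bound]) (simp add: abs_mult)
  also have "\<dots> \<le> (LBINT x:{-1..1}. B * (1 - x\<^sup>2) ^ n)"
  proof (rule set_integral_mono)
    show "set_integrable lborel {-1..1} (\<lambda>x. \<bar>(1 - x\<^sup>2) ^ n * G n x\<bar>)"
      by (intro integrable_on_interval continuous_intros cont)
    show "set_integrable lborel {-1..1} (\<lambda>x. B * (1 - x\<^sup>2) ^ n)"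
      by (intro integrable_on_interval continuous_intros)
    show "\<bar>(1 - x\<^sup>2) ^ n * G n x\<bar> \<le> B * (1 - x\<^sup>2) ^ n" if "x \<in> {-1..1}" for x
      using bound[OF that] sq[OF that] mult_right_mono[of "\<bar>G n x\<bar>" B "(1 - x\<^sup>2) ^ n"]
      by (simp add: abs_mult mult.commute)
  qed
  also have "\<dots> = B * (2 * (2 ^ n * fact n) / odd_dfact n)"
    by (simp add: wallis_integral)
  finally have "\<bar>LBINT x:{-1..1}. (1 - x\<^sup>2) ^ n * G n x\<bar> \<le> B * (2 * (2 ^ n * fact n) / odd_dfact n)" .
  then have "1 / (2 ^ n * fact n) * \<bar>LBINT x:{-1..1}. (1 - x\<^sup>2) ^ n * G n x\<bar>
      \<le> 1 / (2 ^ n * fact n) * (B * (2 * (2 ^ n * fact n) / odd_dfact n))"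
    by (intro mult_left_mono) auto
  also have "\<dots> = 2 * B / odd_dfact n" by simp
  finally show ?thesis
    unfolding legendre_by_parts[of G, OF G] by (simp add: abs_mult)
qed

lemma legendre_moment:
  "(LBINT x:{-1..1}. poly (legendre_poly n) x * poly p x)
     = 1 / (2 ^ n * fact n) * (LBINT x:{-1..1}. (1 - x\<^sup>2) ^ n * poly ((pderiv ^^ n) p) x)"
  using legendre_by_parts[of "\<lambda>k. poly ((pderiv ^^ k) p)" n] by (simp add: poly_DERIV)

lemma degree_pderiv_funpow: "degree ((pderiv ^^ k) (p :: real poly)) = degree p - k"
  by (induction k) (auto simp: degree_pderiv)

lemma coeff_pderiv_funpow:
  "coeff ((pderiv ^^ k) (p :: real poly)) m = fact (m + k) / fact m * coeff p (m + k)"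
proof (induction k arbitrary: m)
  case (Suc k)
  have "coeff ((pderiv ^^ Suc k) p) m = real (Suc m) * (fact (Suc m + k) / fact (Suc m) * coeff p (Suc m + k))"
    by (simp add: coeff_pderiv Suc.IH del: of_nat_Suc fact_Suc)
  also have "\<dots> = fact (m + Suc k) / fact m * coeff p (m + Suc k)"
    by (simp add: fact_Suc[of m] del: of_nat_Suc fact_Suc)
  finally show ?case .
qed simp

lemma legendre_orthogonal_lower_degree:
  assumes "degree p < n"
  shows "(LBINT x:{-1..1}. poly (legendre_poly n) x * poly p x) = 0"
proof -
  have "(pderiv ^^ n) p = 0"
    using assms by (intro poly_eqI) (simp add: coeff_pderiv_funpow coeff_eq_0)
  then show ?thesis by (simp add: legendre_moment)
qed

lemma coeff_legendre_weight_top: "coeff (legendre_weight n) (2 * n) = 1"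
  using lead_coeff_power[of "[:-1, 0, 1::real:]" n]
  by (simp add: legendre_weight_def degree_power_eq mult_2)

lemma degree_legendre_poly: "degree (legendre_poly n) = n"
  by (simp add: legendre_poly_weight degree_pderiv_funpow degree_legendre_weight)

lemma coeff_legendre_poly_top: "coeff (legendre_poly n) n = fact (2 * n) / (2 ^ n * (fact n)\<^sup>2)"
  using coeff_legendre_weight_top[of n]
  by (simp add: legendre_poly_weight coeff_pderiv_funpow power2_eq_square mult_2)

text \<open>The \<open>n\<close>-th derivative of the Legendre polynomial is a constant, so the moment formula reduces
  the norm to Wallis' integral.\<close>

lemma legendre_normsq: "(LBINT x:{-1..1}. (poly (legendre_poly n) x)\<^sup>2) = 1 / (real n + 1/2)"
proof -
  have "(pderiv ^^ n) (legendre_poly n) = [: fact n * coeff (legendre_poly n) n :]"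
    by (intro poly_eqI)
       (auto simp: coeff_pderiv_funpow degree_legendre_poly coeff_pCons coeff_eq_0 split: nat.split)
  then have "(LBINT x:{-1..1}. (poly (legendre_poly n) x)\<^sup>2)
     = 1 / (2 ^ n * fact n) * (LBINT x:{-1..1}. (1 - x\<^sup>2) ^ n * (fact n * coeff (legendre_poly n) n))"
    using legendre_moment[of n "legendre_poly n"] by (simp add: power2_eq_square)
  also have "\<dots> = coeff (legendre_poly n) n * fact n * (2 / odd_dfact n)"
    by (simp add: wallis_integral)
  also have "\<dots> = 2 * fact (2 * n) / (odd_dfact n * 2 ^ n * fact n)"
    by (simp add: coeff_legendre_poly_top power2_eq_square ac_simps)
  also have "\<dots> = 1 / (real n + 1/2)"
  proof -
    have "(fact (2 * n + 1) :: real) = (2 * real n + 1) * fact (2 * n)" by simp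
    then have "2 * fact (2 * n) / fact (2 * n + 1) = 2 / (2 * real n + 1)" by simp
    also have "\<dots> = 1 / (real n + 1/2)" by (simp add: field_simps)
    finally show ?thesis unfolding odd_dfact_fact .
  qed
  finally show ?thesis .
qed

lemma legendre_normalized_eq: "legendre_normalized n x = sqrt (real n + 1/2) * poly (legendre_poly n) x"
  by (simp add: legendre_normalized_def legendre_normsq real_sqrt_divide)

lemma legendre_poly_minus: "poly (legendre_poly n) (- x) = (-1) ^ n * poly (legendre_poly n) x"
proof -
  have "poly ((pderiv ^^ k) (legendre_weight n)) (- x) = (-1) ^ k * poly ((pderiv ^^ k) (legendre_weight n)) x" for k x
  proof (induction k arbitrary: x)
    case 0
    show ?case by (simp add: poly_legendre_weight)
  next
    case (Suc k)
    let ?q = "(pderiv ^^ k) (legendre_weight n)"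
    have 1: "((\<lambda>x. poly ?q (- x)) has_real_derivative (- poly (pderiv ?q) (- x))) (at x)"
      by (auto intro!: derivative_eq_intros)
    have "((\<lambda>x. (-1) ^ k * poly ?q x) has_real_derivative ((-1) ^ k * poly (pderiv ?q) x)) (at x)"
      by (auto intro!: derivative_eq_intros)
    with 1 have "- poly (pderiv ?q) (- x) = (-1) ^ k * poly (pderiv ?q) x"
      using DERIV_unique Suc by simp
    then show ?case by simp
  qed
  then show ?thesis by (simp add: legendre_poly_weight)
qed

lemma legendre_spans:
  "degree p \<le> d \<Longrightarrow> \<exists>a. p = (\<Sum>n\<le>d. Polynomial.smult (a n) (legendre_poly n))"
proof (induction d arbitrary: p)
  case 0
  have "legendre_poly 0 = 1" by (simp add: legendre_poly_def)
  with 0 show ?case by (auto elim!: degree_eq_zeroE intro!: exI[of _ "\<lambda>_. coeff p 0"])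
next
  case (Suc d)
  define c where "c = coeff p (Suc d) / coeff (legendre_poly (Suc d)) (Suc d)"
  define q where "q = p - Polynomial.smult c (legendre_poly (Suc d))"
  have nz: "coeff (legendre_poly (Suc d)) (Suc d) \<noteq> 0" by (simp add: coeff_legendre_poly_top)
  have "degree q \<le> Suc d"
    unfolding q_def using Suc.prems by (intro degree_diff_le) (auto simp: degree_legendre_poly)
  moreover have "coeff q (Suc d) = 0" using nz by (simp add: q_def c_def)
  ultimately have "degree q \<le> d"
    by (metis coeff_0 degree_0 le_SucE leading_coeff_0_iff zero_le)
  then obtain a where a: "q = (\<Sum>n\<le>d. Polynomial.smult (a n) (legendre_poly n))" using Suc.IH by blast
  have "p = (\<Sum>n\<le>Suc d. Polynomial.smult ((a(Suc d := c)) n) (legendre_poly n))"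
  proof -
    have "(\<Sum>n\<le>d. Polynomial.smult ((a(Suc d := c)) n) (legendre_poly n)) = q"
      unfolding a by (intro sum.cong) auto
    then show ?thesis by (simp add: q_def)
  qed
  then show ?case by blast
qed

section \<open>Square-integrable functions on the line\<close>

text \<open>Square-integrability without parity or support, so that translates and polynomial approximants
  stay in the class.\<close>

definition sqint :: "(real \<Rightarrow> real) \<Rightarrow> bool" where
  "sqint f \<longleftrightarrow> f \<in> borel_measurable lborel \<and> integrable lborel (\<lambda>u. (f u)\<^sup>2)"

lemma sqint_measurable: "sqint f \<Longrightarrow> f \<in> borel_measurable borel"
  by (simp add: sqint_def)

lemma integrable_mult_sqint:
  assumes "sqint f" "sqint g"
  shows "integrable lborel (\<lambda>u. f u * g u)"
proof (rule Bochner_Integration.integrable_bound)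
  show "integrable lborel (\<lambda>u. (f u)\<^sup>2 + (g u)\<^sup>2)"
    using assms by (auto simp: sqint_def)
  show "(\<lambda>u. f u * g u) \<in> borel_measurable lborel"
    using assms by (auto simp: sqint_def)
  have "\<bar>a * b\<bar> \<le> a\<^sup>2 + b\<^sup>2" for a b :: real
    using sum_squares_bound[of "\<bar>a\<bar>" "\<bar>b\<bar>"] mult_nonneg_nonneg[of "\<bar>a\<bar>" "\<bar>b\<bar>"]
    unfolding abs_mult power2_abs by linarith
  then show "AE u in lborel. norm (f u * g u) \<le> norm ((f u)\<^sup>2 + (g u)\<^sup>2)"
    by auto
qed

lemma sqint_scale: "sqint f \<Longrightarrow> sqint (\<lambda>u. c * f u)"
  by (auto simp: sqint_def power_mult_distrib)

lemma sqint_add: "sqint f \<Longrightarrow> sqint g \<Longrightarrow> sqint (\<lambda>u. f u + g u)"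
  using integrable_mult_sqint[of f g] by (auto simp: sqint_def power2_sum mult.assoc)

lemma sqint_diff: "sqint f \<Longrightarrow> sqint g \<Longrightarrow> sqint (\<lambda>u. f u - g u)"
  using integrable_mult_sqint[of f g] by (auto simp: sqint_def power2_diff mult.assoc)

lemma sqint_sum: "(\<And>i. i \<in> I \<Longrightarrow> sqint (f i)) \<Longrightarrow> sqint (\<lambda>u. \<Sum>i\<in>I. f i u)"
proof (induction I rule: infinite_finite_induct)
  case (insert i I)
  then show ?case by (simp add: sqint_add)
qed (auto simp: sqint_def)

lemma integrable_const_indicator: "integrable lborel (\<lambda>u. c * indicator {a..b::real} u :: real)"
  by (intro integrable_mult_right integrable_real_indicator) (auto simp: emeasure_lborel_Icc_eq)

lemma sqint_bounded_on_interval: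
  assumes "f \<in> borel_measurable borel" "\<And>u. u \<in> {a..b} \<Longrightarrow> \<bar>f u\<bar> \<le> K"
    "\<And>u. u \<notin> {a..b} \<Longrightarrow> f u = 0"
  shows "sqint f"
  unfolding sqint_def
proof
  show "integrable lborel (\<lambda>u. (f u)\<^sup>2)"
  proof (rule Bochner_Integration.integrable_bound)
    show "integrable lborel (\<lambda>u. K\<^sup>2 * indicator {a..b} u :: real)"
      by (rule integrable_const_indicator)
    have "(f u)\<^sup>2 \<le> K\<^sup>2" if "u \<in> {a..b}" for u
      using power_mono[OF assms(2)[OF that], of 2] by simp
    then show "AE u in lborel. norm ((f u)\<^sup>2) \<le> norm (K\<^sup>2 * indicator {a..b} u :: real)"
      using assms(3) by (auto simp: indicator_def)
  qed (use assms(1) in auto)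
qed (use assms(1) in auto)

definition cutoff :: "real \<Rightarrow> (real \<Rightarrow> real) \<Rightarrow> real \<Rightarrow> real" where
  "cutoff L g u = (if u \<in> {-L..L} then g u else 0)"

lemma sqint_cutoff:
  assumes "continuous_on {-L..L} g"
  shows "sqint (cutoff L g)"
proof -
  obtain K where K: "\<And>u. u \<in> {-L..L} \<Longrightarrow> \<bar>g u\<bar> \<le> K"
    using compact_imp_bounded[OF compact_continuous_image[OF assms compact_Icc]]
    by (force simp: bounded_real)
  have "cutoff L g \<in> borel_measurable borel"
    unfolding cutoff_def using assms
    by (intro borel_measurable_continuous_on_if) auto
  then show ?thesis
    by (rule sqint_bounded_on_interval[of _ "- L" L K]) (auto simp: cutoff_def K)
qed

lemma L2_inner_add_left: "\<lbrakk>sqint f; sqint g; sqint h\<rbrakk> \<Longrightarrow> L2_inner (\<lambda>u. f u + g u) h = L2_inner f h + L2_inner g h"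
  by (simp add: L2_inner_def distrib_right integrable_mult_sqint)

lemma L2_inner_scale_left: "L2_inner (\<lambda>u. c * f u) h = c * L2_inner f h"
  by (simp add: L2_inner_def mult.assoc)

lemma L2_inner_commute: "L2_inner f g = L2_inner g f"
  by (simp add: L2_inner_def mult.commute)

lemma L2_inner_sum_left:
  "\<lbrakk>\<And>i. i \<in> I \<Longrightarrow> sqint (f i); sqint h\<rbrakk> \<Longrightarrow> L2_inner (\<lambda>u. \<Sum>i\<in>I. f i u) h = (\<Sum>i\<in>I. L2_inner (f i) h)"
  by (simp add: L2_inner_def sum_distrib_right integrable_mult_sqint)

lemma L2_normsq_inner: "L2_normsq f = L2_inner f f"
  by (simp add: L2_normsq_def L2_inner_def power2_eq_square)

lemma L2_normsq_nonneg: "0 \<le> L2_normsq f"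
  by (simp add: L2_normsq_def)

lemma L2_normsq_add:
  assumes "sqint f" "sqint g"
  shows "L2_normsq (\<lambda>u. f u + g u) = L2_normsq f + 2 * L2_inner f g + L2_normsq g"
  using assms integrable_mult_sqint[OF assms]
  by (simp add: L2_normsq_def L2_inner_def power2_sum sqint_def mult.assoc)

lemma L2_normsq_diff:
  assumes "sqint f" "sqint g"
  shows "L2_normsq (\<lambda>u. f u - g u) = L2_normsq f - 2 * L2_inner f g + L2_normsq g"
  using assms integrable_mult_sqint[OF assms]
  by (simp add: L2_normsq_def L2_inner_def power2_diff sqint_def mult.assoc)

lemma L2_normsq_triangle:
  assumes "sqint f" "sqint g" "sqint h"
  shows "L2_normsq (\<lambda>u. f u - h u) \<le> 2 * L2_normsq (\<lambda>u. f u - g u) + 2 * L2_normsq (\<lambda>u. g u - h u)"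
proof -
  have int: "integrable lborel (\<lambda>u. (a u - b u)\<^sup>2)" if "sqint a" "sqint b" for a b
    using sqint_diff[OF that] by (simp add: sqint_def)
  have "(a - c)\<^sup>2 \<le> 2 * (a - b)\<^sup>2 + 2 * (b - c)\<^sup>2" for a b c :: real
    using zero_le_power2[of "(a - b) - (b - c)"] by (simp add: power2_eq_square algebra_simps)
  then have "L2_normsq (\<lambda>u. f u - h u) \<le> (LBINT u. 2 * (f u - g u)\<^sup>2 + 2 * (g u - h u)\<^sup>2)"
    unfolding L2_normsq_def using assms by (intro integral_mono) (auto intro!: int)
  also have "\<dots> = 2 * L2_normsq (\<lambda>u. f u - g u) + 2 * L2_normsq (\<lambda>u. g u - h u)"
    unfolding L2_normsq_def using assms by (simp add: int)
  finally show ?thesis .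
qed

section \<open>Density of polynomials\<close>

definition poly_approximable :: "real \<Rightarrow> (real \<Rightarrow> real) \<Rightarrow> bool" where
  "poly_approximable L f \<longleftrightarrow> sqint f \<and>
     (\<forall>e>0. \<exists>p. L2_normsq (\<lambda>u. f u - cutoff L (poly p) u) < e)"

text \<open>Two errors below $e/4$ suffice, since squared norms satisfy the triangle inequality with factors 2.\<close>

lemma poly_approximable_limit:
  assumes "sqint f" "\<And>k. poly_approximable L (g k)"
    and "(\<lambda>k. L2_normsq (\<lambda>u. f u - g k u)) \<longlonglongrightarrow> 0"
  shows "poly_approximable L f"
  unfolding poly_approximable_def
proof (intro conjI allI impI assms(1))
  fix e :: real assume e: "0 < e"
  then have "eventually (\<lambda>k. L2_normsq (\<lambda>u. f u - g k u) < e / 4) sequentially"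
    using order_tendstoD(2)[OF assms(3), of "e / 4"] by simp
  then obtain k where k: "L2_normsq (\<lambda>u. f u - g k u) < e / 4"
    by (auto simp: eventually_sequentially)
  obtain p where p: "L2_normsq (\<lambda>u. g k u - cutoff L (poly p) u) < e / 4"
    using assms(2)[of k] e unfolding poly_approximable_def by (meson divide_pos_pos zero_less_numeral)
  have "sqint (cutoff L (poly p))" by (intro sqint_cutoff continuous_intros)
  with L2_normsq_triangle[OF assms(1) _ this, of "g k"] k p assms(2)[of k]
  show "\<exists>p. L2_normsq (\<lambda>u. f u - cutoff L (poly p) u) < e"
    by (intro exI[of _ p]) (simp add: poly_approximable_def)
qed

lemma L2_normsq_cutoff_le:
  assumes "0 \<le> L" "sqint (cutoff L g)" "\<And>u. u \<in> {-L..L} \<Longrightarrow> \<bar>g u\<bar> \<le> K"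
  shows "L2_normsq (cutoff L g) \<le> 2 * L * K\<^sup>2"
proof -
  have "L2_normsq (cutoff L g) \<le> (LBINT u. K\<^sup>2 * indicator {-L..L} u)"
    unfolding L2_normsq_def
  proof (rule integral_mono)
    show "integrable lborel (\<lambda>u. (cutoff L g u)\<^sup>2)" using assms by (simp add: sqint_def)
    show "(cutoff L g u)\<^sup>2 \<le> K\<^sup>2 * indicator {-L..L} u" for u
      using power_mono[OF assms(3), of u 2] by (auto simp: cutoff_def)
  qed (rule integrable_const_indicator)
  then show ?thesis using assms(1) by (simp add: mult.commute)
qed

lemma poly_approximable_continuous:
  assumes "0 < L" "continuous_on {-L..L} g"
  shows "poly_approximable L (cutoff L g)"
  unfolding poly_approximable_def
proof (intro conjI allI impI sqint_cutoff assms)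
  fix e :: real assume e: "0 < e"
  define d where "d = sqrt (e / (4 * L))"
  have d: "0 < d" "2 * L * d\<^sup>2 < e" using e assms(1) by (auto simp: d_def)
  obtain q where q: "real_polynomial_function q" "\<And>u. u \<in> {-L..L} \<Longrightarrow> \<bar>g u - q u\<bar> < d"
    using Stone_Weierstrass_real_polynomial_function[OF compact_Icc assms(2) d(1)] by blast
  obtain a n where an: "q = (\<lambda>x. \<Sum>i\<le>n::nat. a i * x ^ i)"
    using q(1) by (auto simp: real_polynomial_function_iff_sum)
  define p where "p = (\<Sum>i\<le>n. monom (a i) i)"
  have p: "poly p x = q x" for x by (simp add: p_def an poly_sum poly_monom)
  have eq: "(\<lambda>u. cutoff L g u - cutoff L (poly p) u) = cutoff L (\<lambda>u. g u - q u)"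
    by (auto simp: cutoff_def p)
  have "continuous_on {-L..L} q" unfolding an by (intro continuous_intros)
  then have "L2_normsq (cutoff L (\<lambda>u. g u - q u)) \<le> 2 * L * d\<^sup>2"
    using q(2) assms
    by (intro L2_normsq_cutoff_le sqint_cutoff continuous_intros) (auto intro: less_imp_le)
  with d eq show "\<exists>p. L2_normsq (\<lambda>u. cutoff L g u - cutoff L (poly p) u) < e"
    by (intro exI[of _ p]) simp
qed

definition clamp_to :: "real \<Rightarrow> real \<Rightarrow> real" where
  "clamp_to K x = max (- K) (min K x)"

text \<open>A measurable function is almost everywhere a limit of continuous functions.  Clamping these to
  the bounds of \<open>f\<close> makes the convergence dominated.\<close>

lemma poly_approximable_bounded:
  assumes L: "0 < L" and f: "f \<in> borel_measurable borel" and K: "0 \<le> K" "\<And>u. \<bar>f u\<bar> \<le> K"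
  shows "poly_approximable L (cutoff L f)"
proof -
  have "f measurable_on UNIV"
    using f by (intro lebesgue_measurable_imp_measurable_on) (auto intro: borel_measurable_if_D measurable_completion)
  then obtain N g where N: "negligible N" and g: "\<And>n. continuous_on UNIV (g n)"
    and lim: "\<And>x. x \<notin> N \<Longrightarrow> (\<lambda>n. g n x) \<longlonglongrightarrow> f x"
    unfolding measurable_on_def by auto
  define h where "h n x = clamp_to K (g n x)" for n x
  have h: "continuous_on A (h n)" for n A
    unfolding h_def clamp_to_def using continuous_on_subset[OF g[of n]]
    by (intro continuous_on_max continuous_on_min continuous_intros) auto
  have hK: "\<bar>h n x\<bar> \<le> K" for n x using K(1) by (auto simp: h_def clamp_to_def)
  have "AE x in lebesgue. x \<notin> N"
    using N by (intro AE_not_in) (simp add: negligible_iff_null_sets)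
  then have "AE x in lborel. x \<notin> N" by (simp add: AE_completion_iff)
  then have AE: "AE x in lborel. (\<lambda>n. (cutoff L f x - cutoff L (h n) x)\<^sup>2) \<longlonglongrightarrow> 0"
  proof eventually_elim
    case (elim x)
    have "(\<lambda>n. h n x) \<longlonglongrightarrow> clamp_to K (f x)"
      unfolding h_def clamp_to_def using lim[OF elim] by (intro tendsto_intros)
    moreover have "clamp_to K (f x) = f x" using K(2)[of x] by (auto simp: clamp_to_def)
    ultimately have "(\<lambda>n. (f x - h n x)\<^sup>2) \<longlonglongrightarrow> (f x - f x)\<^sup>2" by (intro tendsto_intros) simp
    then show ?case by (auto simp: cutoff_def)
  qed
  have hm: "h n \<in> borel_measurable borel" for n by (rule borel_measurable_continuous_onI[OF h])
  have meas: "cutoff L f \<in> borel_measurable borel" "cutoff L (h n) \<in> borel_measurable borel" for n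
    unfolding cutoff_def using f hm[of n] by measurable
  have sq: "sqint (cutoff L f)"
    using meas K by (intro sqint_bounded_on_interval[of _ "- L" L K]) (auto simp: cutoff_def)
  have "(\<lambda>n. L2_normsq (\<lambda>u. cutoff L f u - cutoff L (h n) u)) \<longlonglongrightarrow> (LBINT u::real. 0)"
    unfolding L2_normsq_def
  proof (rule integral_dominated_convergence[where w = "\<lambda>u. (2 * K)\<^sup>2 * indicator {-L..L} u"])
    show "integrable lborel (\<lambda>u. (2 * K)\<^sup>2 * indicator {-L..L} u :: real)"
      by (rule integrable_const_indicator)
    show "AE u in lborel. norm ((cutoff L f u - cutoff L (h n) u)\<^sup>2) \<le> (2 * K)\<^sup>2 * indicator {-L..L} u" for n
    proof (rule AE_I2)
      fix u
      have "\<bar>f u - h n u\<bar> \<le> 2 * K" using K(2)[of u] hK[of n u] by linarith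
      from power_mono[OF this, of 2]
      show "norm ((cutoff L f u - cutoff L (h n) u)\<^sup>2) \<le> (2 * K)\<^sup>2 * indicator {-L..L} u"
        by (simp add: cutoff_def)
    qed
  qed (use AE meas in auto)
  then show ?thesis
    using poly_approximable_limit[OF sq, of L "\<lambda>n. cutoff L (h n)"] poly_approximable_continuous[OF L h] by simp
qed

lemma poly_approximable_sqint:
  assumes L: "0 < L" and f: "sqint f" and supp: "AE u in lborel. u \<notin> {-L..L} \<longrightarrow> f u = 0"
  shows "poly_approximable L f"
proof -
  define g where "g k u = clamp_to (real k) (f u)" for k u
  have fm [measurable]: "f \<in> borel_measurable borel" using f by (rule sqint_measurable)
  have gm: "g k \<in> borel_measurable borel" for k
    unfolding g_def clamp_to_def by measurable
  have meas: "cutoff L (g k) \<in> borel_measurable borel" for k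
    unfolding cutoff_def using gm[of k] by measurable
  have app: "poly_approximable L (cutoff L (g k))" for k
    by (rule poly_approximable_bounded[OF L gm, of "real k"]) (auto simp: g_def clamp_to_def)
  have lim: "(\<lambda>k. (f u - g k u)\<^sup>2) \<longlonglongrightarrow> 0" for u
  proof (rule tendsto_eventually)
    have "eventually (\<lambda>k. \<bar>f u\<bar> \<le> real k) sequentially"
      by real_asymp
    then show "eventually (\<lambda>k. (f u - g k u)\<^sup>2 = 0) sequentially"
      by eventually_elim (auto simp: g_def clamp_to_def)
  qed
  have "(\<lambda>k. L2_normsq (\<lambda>u. f u - cutoff L (g k) u)) \<longlonglongrightarrow> (LBINT u::real. 0)"
    unfolding L2_normsq_def
  proof (rule integral_dominated_convergence[where w = "\<lambda>u. (f u)\<^sup>2"])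
    show "AE u in lborel. (\<lambda>k. (f u - cutoff L (g k) u)\<^sup>2) \<longlonglongrightarrow> 0"
      using supp
    proof eventually_elim
      case (elim u)
      show ?case
      proof (cases "u \<in> {-L..L}")
        case True
        then show ?thesis using lim[of u] by (simp add: cutoff_def)
      next
        case False
        then have "cutoff L (g k) u = 0" for k unfolding cutoff_def by (rule if_not_P)
        then show ?thesis using elim False by simp
      qed
    qed
    show "AE u in lborel. norm ((f u - cutoff L (g k) u)\<^sup>2) \<le> (f u)\<^sup>2" for k
    proof (rule AE_I2)
      fix u
      have "\<bar>f u - cutoff L (g k) u\<bar> \<le> \<bar>f u\<bar>" by (auto simp: cutoff_def g_def clamp_to_def)
      from power_mono[OF this, of 2] show "norm ((f u - cutoff L (g k) u)\<^sup>2) \<le> (f u)\<^sup>2" by simp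
    qed
  qed (use f meas in \<open>auto simp: sqint_def\<close>)
  then show ?thesis
    using poly_approximable_limit[OF f, of L "\<lambda>k. cutoff L (g k)"] app by simp
qed

section \<open>The Legendre functions\<close>

lemma legendre_fun_eq:
  "legendre_fun L n = cutoff L (\<lambda>x. sqrt (real n + 1/2) / sqrt L * poly (legendre_poly n) (x / L))"
  by (auto simp: legendre_fun_def cutoff_def legendre_normalized_eq)

lemma sqint_legendre_fun: "0 < L \<Longrightarrow> sqint (legendre_fun L n)"
  unfolding legendre_fun_eq by (intro sqint_cutoff continuous_intros) auto

lemma integral_cutoff_rescale:
  assumes "0 < L"
  shows "(LBINT x. cutoff L (\<lambda>x. h (x / L)) x) = L * (LBINT y:{-1..1}. h y)"
proof -
  have at: "cutoff L (\<lambda>x. h (x / L)) (L * y) = indicator {-1..1} y *\<^sub>R h y" for y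
    using assms mult_le_cancel_left_pos[of L "-1" y] mult_le_cancel_left_pos[of L y 1]
    by (auto simp: cutoff_def indicator_def)
  have "(LBINT x. cutoff L (\<lambda>x. h (x / L)) x) = L * (LBINT y. cutoff L (\<lambda>x. h (x / L)) (L * y))"
    using lborel_integral_real_affine[of L "cutoff L (\<lambda>x. h (x / L))" 0] assms by simp
  then show ?thesis unfolding at by (simp add: set_lebesgue_integral_def)
qed

lemma legendre_pairing:
  assumes "0 < L"
  shows "L2_inner (legendre_fun L n) g
           = sqrt (L * (real n + 1/2)) * (LBINT y:{-1..1}. poly (legendre_poly n) y * g (L * y))"
proof -
  let ?h = "\<lambda>y. sqrt (real n + 1/2) / sqrt L * (poly (legendre_poly n) y * g (L * y))"
  have "legendre_fun L n x * g x = cutoff L (\<lambda>x. ?h (x / L)) x" for x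
    using assms by (auto simp: legendre_fun_eq cutoff_def)
  then have "L2_inner (legendre_fun L n) g = L * (LBINT y:{-1..1}. ?h y)"
    unfolding L2_inner_def using integral_cutoff_rescale[OF assms, of ?h] by simp
  also have "\<dots> = (L / sqrt L) * sqrt (real n + 1/2) * (LBINT y:{-1..1}. poly (legendre_poly n) y * g (L * y))"
    by simp
  also have "L / sqrt L = sqrt L" using assms by (simp add: real_div_sqrt)
  finally show ?thesis by (simp add: real_sqrt_mult)
qed

lemma legendre_orthonormal:
  assumes "0 < L"
  shows "L2_inner (legendre_fun L n) (legendre_fun L m) = (if n = m then 1 else 0)"
proof -
  have at: "legendre_fun L k (L * y) = sqrt (real k + 1/2) / sqrt L * poly (legendre_poly k) y"
    if "y \<in> {-1..1}" for k y
    using that assms mult_le_cancel_left_pos[of L "-1" y] mult_le_cancel_left_pos[of L y 1]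
    by (auto simp: legendre_fun_eq cutoff_def)
  have eq: "L2_inner (legendre_fun L n) (legendre_fun L m)
      = sqrt (L * (real n + 1/2)) * (sqrt (real m + 1/2) / sqrt L)
        * (LBINT y:{-1..1}. poly (legendre_poly n) y * poly (legendre_poly m) y)" for n m
  proof -
    have "(LBINT y:{-1..1}. poly (legendre_poly n) y * legendre_fun L m (L * y))
        = (LBINT y:{-1..1}. (sqrt (real m + 1/2) / sqrt L) * (poly (legendre_poly n) y * poly (legendre_poly m) y))"
      by (intro set_lebesgue_integral_cong) (auto simp: at)
    then show ?thesis unfolding legendre_pairing[OF assms] by simp
  qed
  have zero: "L2_inner (legendre_fun L n) (legendre_fun L m) = 0" if "m < n" for n m
    using that legendre_orthogonal_lower_degree[of "legendre_poly m" n]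
    by (simp add: eq degree_legendre_poly)
  show ?thesis
  proof (cases n m rule: linorder_cases)
    case equal
    have "L2_inner (legendre_fun L m) (legendre_fun L m)
       = sqrt (L * (real m + 1/2)) * (sqrt (real m + 1/2) / sqrt L) * (1 / (real m + 1/2))"
      using legendre_normsq[of m] by (simp add: eq power2_eq_square)
    also have "\<dots> = 1" using assms by (simp add: real_sqrt_mult)
    finally show ?thesis using equal by simp
  next
    case less
    then show ?thesis using zero[OF less] by (subst L2_inner_commute) simp
  qed (use zero in auto)
qed

lemma cutoff_poly_legendre:
  assumes "0 < L"
  shows "\<exists>N b. cutoff L (poly p) = (\<lambda>u. \<Sum>n<N. b n * legendre_fun L n u)"
proof -
  define q where "q = pcompose p [:0, L:]"
  obtain a where a: "q = (\<Sum>n\<le>degree q. Polynomial.smult (a n) (legendre_poly n))"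
    using legendre_spans[of q "degree q"] by auto
  define b where "b n = a n * (sqrt L / sqrt (real n + 1/2))" for n
  have "cutoff L (poly p) u = (\<Sum>n<Suc (degree q). b n * legendre_fun L n u)" for u
  proof (cases "u \<in> {-L..L}")
    case True
    have "poly p u = poly q (u / L)" using assms by (simp add: q_def poly_pcompose)
    also have "\<dots> = (\<Sum>n\<le>degree q. a n * poly (legendre_poly n) (u / L))"
      by (subst a) (simp add: poly_sum)
    also have "\<dots> = (\<Sum>n\<le>degree q. b n * legendre_fun L n u)"
    proof (intro sum.cong refl)
      fix n
      have "sqrt (real n + 1/2) \<noteq> 0" "sqrt L \<noteq> 0" using assms by auto
      then show "a n * poly (legendre_poly n) (u / L) = b n * legendre_fun L n u"
        using True by (simp add: b_def legendre_fun_eq cutoff_def)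
    qed
    finally show ?thesis using True by (simp add: cutoff_def lessThan_Suc_atMost)
  next
    case False
    then have "cutoff L g u = 0" for g unfolding cutoff_def by (rule if_not_P)
    then show ?thesis by (simp add: legendre_fun_eq)
  qed
  then show ?thesis by blast
qed

text \<open>Pythagoras: the distance to a linear combination is smallest for the Legendre coefficients.
  Together with density this gives Parseval's identity.\<close>

lemma legendre_distance:
  assumes L: "0 < L" and f: "sqint f"
  shows "L2_normsq (\<lambda>u. f u - (\<Sum>n<N. b n * legendre_fun L n u))
    = L2_normsq f - (\<Sum>n<N. (L2_inner f (legendre_fun L n))\<^sup>2)
      + (\<Sum>n<N. (b n - L2_inner f (legendre_fun L n))\<^sup>2)"
proof -
  define s where "s u = (\<Sum>n<N. b n * legendre_fun L n u)" for u
  let ?c = "\<lambda>n. L2_inner f (legendre_fun L n)"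
  have sq: "sqint (\<lambda>u. b n * legendre_fun L n u)" for n
    by (intro sqint_scale sqint_legendre_fun L)
  have s: "sqint s" unfolding s_def by (intro sqint_sum sq)
  have left: "L2_inner s h = (\<Sum>n<N. b n * L2_inner (legendre_fun L n) h)" if "sqint h" for h
    unfolding s_def using that by (subst L2_inner_sum_left) (auto intro: sq simp: L2_inner_scale_left)
  have fs: "L2_inner f s = (\<Sum>n<N. b n * ?c n)"
    unfolding L2_inner_commute[of f s] left[OF f] by (simp add: L2_inner_commute)
  have "L2_inner (legendre_fun L n) s = (\<Sum>m<N. b m * (if m = n then 1 else 0))" for n
    unfolding L2_inner_commute[of _ s] left[OF sqint_legendre_fun[OF L]] legendre_orthonormal[OF L] ..
  then have "L2_inner (legendre_fun L n) s = b n" if "n < N" for n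
    using that by (simp add: if_distrib cong: if_cong)
  then have ss: "L2_inner s s = (\<Sum>n<N. (b n)\<^sup>2)"
    unfolding left[OF s] by (simp add: power2_eq_square)
  have "L2_normsq (\<lambda>u. f u - s u) = L2_normsq f - 2 * (\<Sum>n<N. b n * ?c n) + (\<Sum>n<N. (b n)\<^sup>2)"
    unfolding L2_normsq_diff[OF f s] fs L2_normsq_inner[of s] ss ..
  moreover have "(\<Sum>n<N. (b n - ?c n)\<^sup>2) = (\<Sum>n<N. (b n)\<^sup>2) - 2 * (\<Sum>n<N. b n * ?c n) + (\<Sum>n<N. (?c n)\<^sup>2)"
    by (simp add: power2_diff sum.distrib sum_subtractf sum_distrib_left mult.assoc)
  ultimately show ?thesis by (simp add: s_def)
qed

lemma legendre_parseval_all: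
  assumes L: "0 < L" and f: "sqint f" and supp: "AE u in lborel. u \<notin> {-L..L} \<longrightarrow> f u = 0"
  shows "(\<lambda>n. (L2_inner f (legendre_fun L n))\<^sup>2) sums L2_normsq f"
  unfolding sums_def
proof (rule LIMSEQ_I)
  fix e :: real assume e: "0 < e"
  define c where "c n = L2_inner f (legendre_fun L n)" for n
  obtain p where p: "L2_normsq (\<lambda>u. f u - cutoff L (poly p) u) < e"
    using poly_approximable_sqint[OF L f supp] e by (auto simp: poly_approximable_def)
  obtain N b where Nb: "cutoff L (poly p) = (\<lambda>u. \<Sum>n<N. b n * legendre_fun L n u)"
    using cutoff_poly_legendre[OF L] by blast
  have "L2_normsq f - (\<Sum>n<N. (c n)\<^sup>2) < e"
    using p legendre_distance[OF L f, of b N, folded c_def] sum_nonneg[of "{..<N}" "\<lambda>n. (b n - c n)\<^sup>2"]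
    by (simp add: Nb)
  moreover have "0 \<le> L2_normsq f - (\<Sum>n<M. (c n)\<^sup>2)" for M
    using legendre_distance[OF L f, of c M, folded c_def] L2_normsq_nonneg[of "\<lambda>u. f u - (\<Sum>n<M. c n * legendre_fun L n u)"]
    by simp
  moreover have "(\<Sum>n<N. (c n)\<^sup>2) \<le> (\<Sum>n<M. (c n)\<^sup>2)" if "N \<le> M" for M
    using that by (intro sum_mono2) auto
  ultimately have "\<bar>(\<Sum>n<M. (c n)\<^sup>2) - L2_normsq f\<bar> < e" if "N \<le> M" for M
  proof -
    note * = \<open>L2_normsq f - (\<Sum>n<N. (c n)\<^sup>2) < e\<close>
    have "abs (a - b) < e" if "0 \<le> b - a" "a' \<le> a" "b - a' < e" for a a' b :: real
      using that by linarith
    from this[OF \<open>\<And>M. 0 \<le> L2_normsq f - (\<Sum>n<M. (c n)\<^sup>2)\<close> \<open>\<And>M. N \<le> M \<Longrightarrow> (\<Sum>n<N. (c n)\<^sup>2) \<le> (\<Sum>n<M. (c n)\<^sup>2)\<close>[OF that] *]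
    show ?thesis .
  qed
  then show "\<exists>no. \<forall>M\<ge>no. norm ((\<Sum>n<M. (L2_inner f (legendre_fun L n))\<^sup>2) - L2_normsq f) < e"
    unfolding c_def by auto
qed

lemma even_L2_iff:
  "f \<in> even_L2 L \<longleftrightarrow> sqint f \<and> (AE u in lborel. f (- u) = f u)
      \<and> (AE u in lborel. u \<notin> {-L..L} \<longrightarrow> f u = 0)"
  by (auto simp: even_L2_def sqint_def)

lemma even_L2_add: "f \<in> even_L2 L \<Longrightarrow> g \<in> even_L2 L \<Longrightarrow> (\<lambda>u. f u + g u) \<in> even_L2 L"
  unfolding even_L2_iff by (intro conjI sqint_add) (auto elim: eventually_elim2)

lemma integral_even_odd:
  fixes f g :: "real \<Rightarrow> real"
  assumes "AE u in lborel. f (- u) = f u" "\<And>u. g (- u) = - g u"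
    "f \<in> borel_measurable borel" "g \<in> borel_measurable borel"
  shows "(LBINT u. f u * g u) = 0"
proof -
  have "(LBINT u. f u * g u) = (LBINT u. f (- u) * g (- u))"
    using lborel_integral_real_affine[of "-1" "\<lambda>u. f u * g u" 0] by simp
  also have "\<dots> = (LBINT u. - (f u * g u))"
    using assms by (intro integral_cong_AE) (auto elim: eventually_mono)
  finally show ?thesis by simp
qed

text \<open>For even \<open>f\<close> the odd Legendre coefficients vanish.\<close>

lemma legendre_parseval:
  assumes L: "0 < L" and f: "f \<in> even_L2 L"
  shows "((\<lambda>i. (L2_inner f (legendre_fun L (2 * i)))\<^sup>2) has_sum L2_normsq f) UNIV"
proof -
  have f': "sqint f" "AE u in lborel. f (- u) = f u" "AE u in lborel. u \<notin> {-L..L} \<longrightarrow> f u = 0"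
    using f by (auto simp: even_L2_iff)
  have odd: "L2_inner f (legendre_fun L n) = 0" if "odd n" for n
    unfolding L2_inner_def
  proof (rule integral_even_odd[OF f'(2)])
    show "legendre_fun L n (- u) = - legendre_fun L n u" for u
      using that legendre_poly_minus[of n "u / L"] by (auto simp: legendre_fun_eq cutoff_def)
    show "f \<in> borel_measurable borel" "legendre_fun L n \<in> borel_measurable borel"
      using f'(1) sqint_legendre_fun[OF L] by (auto intro: sqint_measurable)
  qed
  have "((\<lambda>n. (L2_inner f (legendre_fun L n))\<^sup>2) has_sum L2_normsq f) UNIV"
    using legendre_parseval_all[OF L f'(1,3)] by (rule sums_nonneg_imp_has_sum) simp
  also have "?this \<longleftrightarrow> ((\<lambda>n. (L2_inner f (legendre_fun L n))\<^sup>2) has_sum L2_normsq f) (range ((*) 2))"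
  proof (rule has_sum_cong_neutral)
    fix n :: nat assume "n \<in> UNIV - range ((*) 2)"
    then have "odd n" by (auto elim!: evenE)
    then show "(L2_inner f (legendre_fun L n))\<^sup>2 = 0" by (simp add: odd)
  qed auto
  also have "\<dots> \<longleftrightarrow> ((\<lambda>i. (L2_inner f (legendre_fun L (2 * i)))\<^sup>2) has_sum L2_normsq f) UNIV"
    by (subst has_sum_reindex) (auto simp: inj_def o_def)
  finally show ?thesis .
qed

lemma legendre_parseval_inner:
  assumes L: "0 < L" and f: "f \<in> even_L2 L" and g: "g \<in> even_L2 L"
  shows "((\<lambda>i. L2_inner f (legendre_fun L (2 * i)) * L2_inner g (legendre_fun L (2 * i)))
           has_sum L2_inner f g) UNIV"
proof -
  have sq: "sqint f" "sqint g" using f g by (auto simp: even_L2_iff)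
  let ?c = "\<lambda>f i. L2_inner f (legendre_fun L (2 * i))"
  have "((\<lambda>i. 1/2 * ((?c (\<lambda>u. f u + g u) i)\<^sup>2 + ((-1) * (?c f i)\<^sup>2 + (-1) * (?c g i)\<^sup>2)))
      has_sum (1/2 * (L2_normsq (\<lambda>u. f u + g u) + ((-1) * L2_normsq f + (-1) * L2_normsq g)))) UNIV"
    by (intro has_sum_cmult_right has_sum_add legendre_parseval L even_L2_add f g)
  moreover have "?c (\<lambda>u. f u + g u) i = ?c f i + ?c g i" for i
    by (intro L2_inner_add_left sq sqint_legendre_fun L)
  ultimately show ?thesis
    unfolding L2_normsq_add[OF sq] by (simp add: power2_sum)
qed

section \<open>Fourier transforms of even functions\<close>

text \<open>For even \<open>f\<close> this is the whole Fourier transform on the real line.\<close>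

definition cos_transform :: "(real \<Rightarrow> real) \<Rightarrow> real \<Rightarrow> real" where
  "cos_transform f t = (LBINT u. f u * cos (t * u))"

lemma integrable_mult_bounded:
  fixes f g :: "real \<Rightarrow> real"
  assumes "integrable lborel f" "g \<in> borel_measurable borel" "\<And>u. \<bar>g u\<bar> \<le> B"
  shows "integrable lborel (\<lambda>u. f u * g u)"
proof (rule Bochner_Integration.integrable_bound)
  show "integrable lborel (\<lambda>u. \<bar>f u\<bar> * B)" using assms by auto
  show "AE u in lborel. norm (f u * g u) \<le> norm (\<bar>f u\<bar> * B)"
  proof (rule AE_I2)
    fix u
    have "0 \<le> B" using assms(3)[of u] by linarith
    then show "norm (f u * g u) \<le> norm (\<bar>f u\<bar> * B)"
      using assms(3)[of u] by (simp add: abs_mult mult_left_mono)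
  qed
qed (use assms in auto)

lemma fhat_real_eq:
  assumes "integrable lborel f"
  shows "fhat f (complex_of_real t) = Complex (cos_transform f t) (LBINT u. f u * sin (t * u))"
proof -
  have c: "integrable lborel (\<lambda>u. f u * cos (t * u))" "integrable lborel (\<lambda>u. f u * sin (t * u))"
    using assms by (auto intro!: integrable_mult_bounded[where B = 1])
  define a b where "a u = f u * cos (t * u)" and "b u = f u * sin (t * u)" for u
  have "complex_of_real (f u) * exp (\<i> * complex_of_real u * complex_of_real t)
      = complex_of_real (a u) + \<i> * complex_of_real (b u)" for u
    by (simp add: a_def b_def complex_eq_iff Re_exp Im_exp mult.commute)
  then have "fhat f (complex_of_real t)
      = complex_of_real (LBINT u. a u) + \<i> * complex_of_real (LBINT u. b u)"
    unfolding fhat_def using c by (simp add: integral_complex_of_real flip: a_def b_def)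
  then show ?thesis by (simp add: complex_eq_iff cos_transform_def a_def b_def)
qed

lemma even_L2_AE_cutoff:
  assumes "f \<in> even_L2 L"
  shows "AE u in lborel. f u * g u = f u * cutoff L g u"
proof -
  have "AE u in lborel. u \<notin> {-L..L} \<longrightarrow> f u = 0" using assms by (simp add: even_L2_iff)
  then show ?thesis by eventually_elim (metis cutoff_def mult_zero_left)
qed

lemma even_L2_measurable: "f \<in> even_L2 L \<Longrightarrow> f \<in> borel_measurable borel"
  by (auto simp: even_L2_iff sqint_measurable)

lemma integrable_even_L2_mult:
  assumes f: "f \<in> even_L2 L" and g: "continuous_on UNIV g"
  shows "integrable lborel (\<lambda>u. f u * g u)"
proof -
  have "integrable lborel (\<lambda>u. f u * cutoff L g u)"
    using f continuous_on_subset[OF g] by (intro integrable_mult_sqint sqint_cutoff) (auto simp: even_L2_iff)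
  moreover have "g \<in> borel_measurable borel" by (rule borel_measurable_continuous_onI[OF g])
  ultimately show ?thesis
    using even_L2_AE_cutoff[OF f, of g] even_L2_measurable[OF f]
    by (subst integrable_cong_AE[where g = "\<lambda>u. f u * cutoff L g u"]) auto
qed

lemma integrable_even_L2: "f \<in> even_L2 L \<Longrightarrow> integrable lborel f"
  using integrable_even_L2_mult[of f L "\<lambda>_. 1"] by simp

lemma integral_even_L2_cutoff:
  assumes f: "f \<in> even_L2 L" and g: "continuous_on UNIV g"
  shows "(LBINT u. f u * g u) = L2_inner f (cutoff L g)"
proof -
  have "cutoff L g \<in> borel_measurable borel"
    using continuous_on_subset[OF g] by (intro sqint_measurable sqint_cutoff) auto
  moreover have "g \<in> borel_measurable borel" by (rule borel_measurable_continuous_onI[OF g])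
  ultimately show ?thesis
    unfolding L2_inner_def using even_L2_AE_cutoff[OF f, of g] even_L2_measurable[OF f]
    by (intro integral_cong_AE) auto
qed

lemma even_L2_sin_zero:
  assumes "f \<in> even_L2 L"
  shows "(LBINT u. f u * sin (t * u)) = 0"
  using assms by (intro integral_even_odd) (auto simp: even_L2_iff sqint_measurable)

lemma fhat_even_real:
  assumes "f \<in> even_L2 L"
  shows "fhat f (complex_of_real t) = complex_of_real (cos_transform f t)"
  using fhat_real_eq[OF integrable_even_L2[OF assms]] even_L2_sin_zero[OF assms]
  by (simp add: complex_eq_iff)

lemma cos_transform_inner:
  "f \<in> even_L2 L \<Longrightarrow> cos_transform f t = L2_inner f (cutoff L (\<lambda>u. cos (t * u)))"
  unfolding cos_transform_def by (intro integral_even_L2_cutoff continuous_intros)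

lemma fhat_even_i_half:
  assumes f: "f \<in> even_L2 L"
  shows "Re (fhat f (\<i> / 2)) = L2_inner f (cutoff L (\<lambda>u. cosh (u / 2)))"
proof -
  have int: "integrable lborel (\<lambda>u. f u * exp (- u / 2))"
    by (intro integrable_even_L2_mult[OF f] continuous_intros) simp
  have ce: "continuous_on UNIV (\<lambda>u. exp (- u / 2) :: real)" "continuous_on UNIV (\<lambda>u. cosh (u / 2) :: real)"
    "continuous_on UNIV (\<lambda>u. sinh (u / 2) :: real)"
    by (intro continuous_intros; simp)+
  have "complex_of_real (f u) * exp (\<i> * complex_of_real u * (\<i> / 2)) = complex_of_real (f u * exp (- u / 2))" for u
    by (simp add: exp_of_real[symmetric] algebra_simps)
  then have "fhat f (\<i> / 2) = complex_of_real (LBINT u. f u * exp (- u / 2))"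
    unfolding fhat_def by (simp only: integral_complex_of_real)
  then have "Re (fhat f (\<i> / 2)) = (LBINT u. f u * exp (- u / 2))" by simp
  also have "\<dots> = (LBINT u. f u * cosh (u / 2) - f u * sinh (u / 2))"
    by (simp add: right_diff_distrib[symmetric] cosh_minus_sinh)
  also have "\<dots> = (LBINT u. f u * cosh (u / 2)) - (LBINT u. f u * sinh (u / 2))"
    by (intro Bochner_Integration.integral_diff integrable_even_L2_mult[OF f] ce)
  also have "(LBINT u. f u * sinh (u / 2)) = 0"
    using f by (intro integral_even_odd) (auto simp: even_L2_iff sqint_measurable borel_measurable_continuous_onI[OF ce(3)])
  also have "(LBINT u. f u * cosh (u / 2)) - 0 = L2_inner f (cutoff L (\<lambda>u. cosh (u / 2)))"
    using integral_even_L2_cutoff[OF f ce(2)] by simp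
  finally show ?thesis .
qed

lemma cos_transform_measurable:
  assumes [measurable]: "f \<in> borel_measurable borel"
  shows "cos_transform f \<in> borel_measurable borel"
  unfolding cos_transform_def by measurable

lemma cos_transform_bound:
  assumes "integrable lborel f"
  shows "\<bar>cos_transform f t\<bar> \<le> (LBINT u. \<bar>f u\<bar>)"
proof -
  have "\<bar>cos_transform f t\<bar> \<le> (LBINT u. \<bar>f u * cos (t * u)\<bar>)"
    unfolding cos_transform_def by (rule integral_abs_bound)
  also have "\<dots> \<le> (LBINT u. \<bar>f u\<bar>)"
    using assms by (intro integral_mono integrable_abs integrable_mult_bounded[where B = 1])
      (auto simp: abs_mult mult_left_le)
  finally show ?thesis .
qed

lemma cos_transform_minus: "cos_transform f (- t) = cos_transform f t"
  by (simp add: cos_transform_def)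

section \<open>Translations and the autocorrelation\<close>

lemma sqint_translate: "sqint f \<Longrightarrow> sqint (\<lambda>u. f (u + h))"
  using lborel_integrable_real_affine[of "\<lambda>u. (f u)\<^sup>2" 1 h]
  by (auto simp: sqint_def add.commute)

lemma integral_translate: "(LBINT u. f (u + h)) = (LBINT u. f u :: real)" for h :: real
  using lborel_integral_real_affine[of 1 f h] by (simp add: add.commute)

lemma L2_normsq_translate: "L2_normsq (\<lambda>u. f (u + h)) = L2_normsq f"
  using integral_translate[of "\<lambda>u. (f u)\<^sup>2" h] by (simp add: L2_normsq_def)

definition autocorr :: "(real \<Rightarrow> real) \<Rightarrow> real \<Rightarrow> real" where
  "autocorr f h = L2_inner f (\<lambda>u. f (u + h))"

text \<open>A polynomial cut off at the ends of the interval is bounded and continuous except at two points,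
  so dominated convergence applies.\<close>

lemma translate_continuous_poly:
  assumes L: "0 < L" and h: "h \<longlonglongrightarrow> 0"
  shows "(\<lambda>k::nat. L2_normsq (\<lambda>u. cutoff L (poly p) u - cutoff L (poly p) (u + h k))) \<longlonglongrightarrow> 0"
proof -
  let ?g = "cutoff L (poly p)"
  obtain K where K: "\<And>u. u \<in> {-L..L} \<Longrightarrow> \<bar>poly p u\<bar> \<le> K"
    using compact_imp_bounded[OF compact_continuous_image[OF _ compact_Icc, of "-L" L "poly p"]]
    by (force simp: bounded_real intro: continuous_intros)
  have K0: "0 \<le> K" using K[of 0] L by (auto intro: order_trans[OF abs_ge_zero])
  have gK: "\<bar>?g u\<bar> \<le> K" for u using K[of u] K0 by (auto simp: cutoff_def)
  have gm [measurable]: "?g \<in> borel_measurable borel"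
    by (intro sqint_measurable sqint_cutoff continuous_intros)
  have cont: "isCont ?g u" if "u \<noteq> L" "u \<noteq> - L" for u
  proof (cases "u \<in> {-L<..<L}")
    case True
    have "eventually (\<lambda>v. v \<in> {-L<..<L}) (nhds u)"
      using True by (intro eventually_nhds_in_open) auto
    then have ev: "eventually (\<lambda>v. ?g v = poly p v) (nhds u)"
      by eventually_elim (auto simp: cutoff_def)
    have "isCont (poly p) u" by simp
    with ev show ?thesis using isCont_cong by blast
  next
    case False
    then have "u \<in> - {-L..L}" using that by auto
    then have "eventually (\<lambda>v. v \<in> - {-L..L}) (nhds u)"
      by (intro eventually_nhds_in_open) auto
    then have ev: "eventually (\<lambda>v. ?g v = 0) (nhds u)"
      by eventually_elim (auto simp: cutoff_def)
    with isCont_cong[OF ev] show ?thesis by simp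
  qed
  obtain k0 where k0: "\<And>k. k \<ge> k0 \<Longrightarrow> \<bar>h k\<bar> < 1"
    using LIMSEQ_D[OF h, of 1] by auto
  have "(\<lambda>k. L2_normsq (\<lambda>u. ?g u - ?g (u + h (k + k0)))) \<longlonglongrightarrow> (LBINT u::real. 0)"
    unfolding L2_normsq_def
  proof (rule integral_dominated_convergence[where w = "\<lambda>u. (2 * K)\<^sup>2 * indicator {-(L+1)..L+1} u"])
    have "AE u in lborel. u \<noteq> L" "AE u in lborel. u \<noteq> - L" by (rule AE_lborel_singleton)+
    then show "AE u in lborel. (\<lambda>k. (?g u - ?g (u + h (k + k0)))\<^sup>2) \<longlonglongrightarrow> 0"
    proof eventually_elim
      case (elim u)
      have "(\<lambda>k. u + h (k + k0)) \<longlonglongrightarrow> u + 0"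
        by (intro tendsto_intros LIMSEQ_ignore_initial_segment[OF h])
      then have "(\<lambda>k. ?g (u + h (k + k0))) \<longlonglongrightarrow> ?g u"
        using isCont_tendsto_compose[OF cont[OF elim]] by simp
      then have "(\<lambda>k. (?g u - ?g (u + h (k + k0)))\<^sup>2) \<longlonglongrightarrow> (?g u - ?g u)\<^sup>2" by (intro tendsto_intros)
      then show ?case by simp
    qed
    show "AE u in lborel. norm ((?g u - ?g (u + h (k + k0)))\<^sup>2) \<le> (2 * K)\<^sup>2 * indicator {-(L+1)..L+1} u" for k
    proof (rule AE_I2)
      fix u
      show "norm ((?g u - ?g (u + h (k + k0)))\<^sup>2) \<le> (2 * K)\<^sup>2 * indicator {-(L+1)..L+1} u"
      proof (cases "u \<in> {-(L+1)..L+1}")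
        case True
        have "\<bar>?g u - ?g (u + h (k + k0))\<bar> \<le> 2 * K" using gK[of u] gK[of "u + h (k + k0)"] by linarith
        from power_mono[OF this, of 2] show ?thesis using True by simp
      next
        case False
        then have "u \<notin> {-L..L}" "u + h (k + k0) \<notin> {-L..L}" using k0[of "k + k0"] by auto
        then have "?g u = 0" "?g (u + h (k + k0)) = 0" unfolding cutoff_def by (metis (full_types))+
        then show ?thesis using False by simp
      qed
    qed
    show "integrable lborel (\<lambda>u. (2 * K)\<^sup>2 * indicator {-(L+1)..L+1} u)"
      by (rule integrable_const_indicator)
  qed auto
  then show ?thesis by (simp add: LIMSEQ_offset)
qed

text \<open>Translation preserves the norm, so a polynomial that is close to \<open>f\<close> stays as close after
  translation.  With errors below $e/12$ for the approximation and $e/8$ for the translate of the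
  polynomial the total is below $6 e/12 + 4 e/8 = e$.\<close>

lemma translate_continuous:
  assumes L: "0 < L" and f: "sqint f" and supp: "AE u in lborel. u \<notin> {-L..L} \<longrightarrow> f u = 0"
    and h: "h \<longlonglongrightarrow> 0"
  shows "(\<lambda>k::nat. L2_normsq (\<lambda>u. f u - f (u + h k))) \<longlonglongrightarrow> 0"
proof (rule LIMSEQ_I)
  fix e :: real assume e: "0 < e"
  obtain p where p: "L2_normsq (\<lambda>u. f u - cutoff L (poly p) u) < e / 12"
    using poly_approximable_sqint[OF L f supp] e unfolding poly_approximable_def
    by (meson divide_pos_pos zero_less_numeral)
  define g where "g = cutoff L (poly p)"
  have g: "sqint g" unfolding g_def by (intro sqint_cutoff continuous_intros)
  have "eventually (\<lambda>k. L2_normsq (\<lambda>u. g u - g (u + h k)) < e / 8) sequentially"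
    using order_tendstoD(2)[OF translate_continuous_poly[OF L h, of p], of "e / 8"] e by (simp add: g_def)
  then obtain k0 where k0: "\<And>k. k \<ge> k0 \<Longrightarrow> L2_normsq (\<lambda>u. g u - g (u + h k)) < e / 8"
    by (auto simp: eventually_sequentially)
  have "L2_normsq (\<lambda>u. f u - f (u + h k)) < e" if k: "k \<ge> k0" for k
  proof -
    have 1: "L2_normsq (\<lambda>u. f u - f (u + h k))
        \<le> 2 * L2_normsq (\<lambda>u. f u - g u) + 2 * L2_normsq (\<lambda>u. g u - f (u + h k))"
      by (intro L2_normsq_triangle f g sqint_translate)
    have 2: "L2_normsq (\<lambda>u. g u - f (u + h k))
        \<le> 2 * L2_normsq (\<lambda>u. g u - g (u + h k)) + 2 * L2_normsq (\<lambda>u. g (u + h k) - f (u + h k))"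
      by (intro L2_normsq_triangle f g sqint_translate)
    have "L2_normsq (\<lambda>u. g (u + h k) - f (u + h k)) = L2_normsq (\<lambda>u. f u - g u)"
      using L2_normsq_translate[of "\<lambda>u. g u - f u" "h k"] by (simp add: L2_normsq_def power2_commute)
    with 1 2 p k0[OF k] show ?thesis unfolding g_def by linarith
  qed
  then show "\<exists>no. \<forall>k\<ge>no. norm (L2_normsq (\<lambda>u. f u - f (u + h k)) - 0) < e"
    using L2_normsq_nonneg by (intro exI[of _ k0]) (simp add: abs_of_nonneg)
qed

lemma autocorr_eq:
  assumes "sqint f"
  shows "autocorr f h = L2_normsq f - 1/2 * L2_normsq (\<lambda>u. f u - f (u + h))"
  using L2_normsq_diff[OF assms sqint_translate[OF assms], of h]
  by (simp add: autocorr_def L2_normsq_translate field_simps)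

lemma autocorr_abs_le:
  assumes "sqint f"
  shows "\<bar>autocorr f h\<bar> \<le> L2_normsq f"
  using L2_normsq_diff[OF assms sqint_translate[OF assms], of h] L2_normsq_add[OF assms sqint_translate[OF assms], of h]
    L2_normsq_nonneg[of "\<lambda>u. f u - f (u + h)"] L2_normsq_nonneg[of "\<lambda>u. f u + f (u + h)"]
  by (simp add: autocorr_def L2_normsq_translate)

lemma autocorr_measurable:
  assumes [measurable]: "f \<in> borel_measurable borel"
  shows "autocorr f \<in> borel_measurable borel"
  unfolding autocorr_def L2_inner_def by measurable

lemma autocorr_tendsto:
  assumes L: "0 < L" and f: "sqint f" and supp: "AE u in lborel. u \<notin> {-L..L} \<longrightarrow> f u = 0"
    and h: "h \<longlonglongrightarrow> 0"
  shows "(\<lambda>k::nat. autocorr f (h k)) \<longlonglongrightarrow> L2_normsq f"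
proof -
  have "(\<lambda>k. L2_normsq f - 1/2 * L2_normsq (\<lambda>u. f u - f (u + h k))) \<longlonglongrightarrow> L2_normsq f - 1/2 * 0"
    by (intro tendsto_intros translate_continuous[OF L f supp h])
  then show ?thesis unfolding autocorr_eq[OF f] by simp
qed

section \<open>Plancherel's inequality\<close>

lemma integrable_pair_autocorr:
  fixes f :: "real \<Rightarrow> real"
  assumes f: "integrable lborel f"
  shows "integrable (lborel \<Otimes>\<^sub>M lborel) (\<lambda>(u, h). f u * f (u + h) :: real)"
proof (rule lborel_pair.Fubini_integrable)
  have [measurable]: "f \<in> borel_measurable borel" using f by auto
  show "(\<lambda>(u, h). f u * f (u + h)) \<in> borel_measurable (lborel \<Otimes>\<^sub>M lborel)" by measurable
  have "(LBINT h. \<bar>f (u + h)\<bar>) = (LBINT h. \<bar>f h\<bar>)" for u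
    using integral_translate[of "\<lambda>h. \<bar>f h\<bar>" u] by (simp add: add.commute)
  then show "integrable lborel (\<lambda>u. LBINT h. norm (case (u, h) of (u, h) \<Rightarrow> f u * f (u + h)))"
    using f by (simp add: abs_mult)
  show "AE u in lborel. integrable lborel (\<lambda>h. case (u, h) of (u, h) \<Rightarrow> f u * f (u + h))"
    using lborel_integrable_real_affine[OF f, of 1] by simp
qed

lemma integrable_autocorr:
  assumes f: "integrable lborel f"
  shows "integrable lborel (autocorr f)"
proof -
  have "integrable (lborel \<Otimes>\<^sub>M lborel) (\<lambda>(h, u). f u * f (u + h))"
    using integrable_pair_autocorr[OF f] lborel_pair.integrable_product_swap[of "\<lambda>(u, h). f u * f (u + h)"]
    by (simp add: case_prod_beta')
  from lborel_pair.integrable_fst'[OF this] show ?thesis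
    unfolding autocorr_def[abs_def] L2_inner_def by simp
qed

text \<open>The transform of the autocorrelation is the squared transform: by Fubini the right-hand side is a
  double integral over $\cos(t(v-u))$, and the sine part of the addition theorem integrates to 0
  because \<open>f\<close> is even.\<close>

lemma cos_transform_square:
  assumes f: "f \<in> even_L2 L"
  shows "(cos_transform f t)\<^sup>2 = (LBINT h. autocorr f h * cos (t * h))"
proof -
  have int: "integrable lborel f" by (rule integrable_even_L2[OF f])
  have [measurable]: "f \<in> borel_measurable borel" using int by auto
  have ci: "integrable lborel (\<lambda>u. f u * cos (t * u))" "integrable lborel (\<lambda>u. f u * sin (t * u))"
    using int by (auto intro!: integrable_mult_bounded[where B = 1])
  have inner: "(LBINT h. f (u + h) * cos (t * h)) = cos (t * u) * cos_transform f t" for u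
  proof -
    have "(LBINT h. f (u + h) * cos (t * h)) = (LBINT v. f v * cos (t * (v - u)))"
      using integral_translate[of "\<lambda>v. f v * cos (t * (v - u))" u] by (simp add: add.commute)
    also have "\<dots> = (LBINT v. cos (t * u) * (f v * cos (t * v)) + sin (t * u) * (f v * sin (t * v)))"
      by (simp add: right_diff_distrib cos_diff algebra_simps)
    also have "\<dots> = cos (t * u) * cos_transform f t + sin (t * u) * (LBINT v. f v * sin (t * v))"
      using ci by (simp add: cos_transform_def)
    finally show ?thesis by (simp add: even_L2_sin_zero[OF f])
  qed
  have pair: "integrable (lborel \<Otimes>\<^sub>M lborel) (\<lambda>(u, h). f u * f (u + h) * cos (t * h))"
  proof (rule Bochner_Integration.integrable_bound[OF integrable_pair_autocorr[OF int]])
    show "(\<lambda>(u, h). f u * f (u + h) * cos (t * h)) \<in> borel_measurable (lborel \<Otimes>\<^sub>M lborel)" by measurable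
    show "AE x in lborel \<Otimes>\<^sub>M lborel. norm (case x of (u, h) \<Rightarrow> f u * f (u + h) * cos (t * h))
        \<le> norm (case x of (u, h) \<Rightarrow> f u * f (u + h))"
      by (intro AE_I2) (auto simp: abs_mult mult_left_le)
  qed
  have "(cos_transform f t)\<^sup>2 = (LBINT u. f u * cos (t * u) * cos_transform f t)"
    by (simp add: cos_transform_def power2_eq_square)
  also have "\<dots> = (LBINT u. LBINT h. f u * f (u + h) * cos (t * h))"
    using inner by (simp add: mult.assoc)
  also have "\<dots> = (LBINT h. LBINT u. f u * f (u + h) * cos (t * h))"
    using lborel_pair.Fubini_integral[OF pair] by simp
  also have "\<dots> = (LBINT h. autocorr f h * cos (t * h))"
    by (simp add: autocorr_def L2_inner_def)
  finally show ?thesis .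
qed

lemma std_normal_density_cos:
  "(LBINT s. std_normal_density s * cos (x * s)) = exp (- (x\<^sup>2) / 2)"
proof -
  have "integrable lborel std_normal_density" by (rule integrable_normal_density) simp
  then have int: "integrable lborel (\<lambda>s. std_normal_density s *\<^sub>R iexp (x * s))"
    by (rule Bochner_Integration.integrable_bound) (auto simp: normal_density_nonneg)
  have "char std_normal_distribution x = (CLBINT s. std_normal_density s *\<^sub>R iexp (x * s))"
    unfolding char_def by (subst integral_density) (auto simp: normal_density_nonneg)
  then have "Re (char std_normal_distribution x) = (LBINT s. Re (std_normal_density s *\<^sub>R iexp (x * s)))"
    using integral_Re[OF int] by simp
  also have "\<dots> = (LBINT s. std_normal_density s * cos (x * s))" by (simp add: Re_exp)
  finally have "Re (char std_normal_distribution x) = (LBINT s. std_normal_density s * cos (x * s))" .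
  then show ?thesis by (simp add: char_std_normal_distribution)
qed

lemma exp_eq_std_normal_density: "exp (- (w\<^sup>2) / 2) = sqrt (2 * pi) * std_normal_density w"
  by (simp add: std_normal_density_def)

lemma gaussian_cos_integral:
  assumes s: "0 < s"
  shows "(LBINT t. cos (t * h) * exp (- ((s * t)\<^sup>2) / 2)) = sqrt (2 * pi) / s * exp (- ((h / s)\<^sup>2) / 2)"
proof -
  have "(LBINT t. cos (t * h) * exp (- ((s * t)\<^sup>2) / 2))
      = 1 / s * (LBINT x. cos (x / s * h) * exp (- (x\<^sup>2) / 2))"
    using lborel_integral_real_affine[of "1 / s" "\<lambda>t. cos (t * h) * exp (- ((s * t)\<^sup>2) / 2)" 0] s by simp
  also have "(LBINT x. cos (x / s * h) * exp (- (x\<^sup>2) / 2))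
      = (LBINT x. sqrt (2 * pi) * (std_normal_density x * cos (h / s * x)))"
    unfolding exp_eq_std_normal_density by (simp add: ac_simps)
  finally show ?thesis using std_normal_density_cos[of "h / s"] by simp
qed

text \<open>The Gaussian is, up to scaling, its own Fourier transform, so a wide Gaussian weight on the squared
  transform becomes a narrow one on the autocorrelation.\<close>

lemma gaussian_mean_of_square:
  assumes f: "f \<in> even_L2 L" and s: "0 < s"
  shows "(LBINT t. (cos_transform f t)\<^sup>2 * exp (- ((s * t)\<^sup>2) / 2))
           = 2 * pi * (LBINT w. autocorr f (s * w) * std_normal_density w)"
proof -
  let ?G = "\<lambda>t. exp (- ((s * t)\<^sup>2) / 2) :: real"
  have ac: "integrable lborel (autocorr f)" by (intro integrable_autocorr integrable_even_L2[OF f])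
  have [measurable]: "autocorr f \<in> borel_measurable borel" using ac by auto
  have "integrable lborel (\<lambda>x. sqrt (2 * pi) * std_normal_density x)"
    by (intro integrable_mult_right integrable_normal_density) simp
  from lborel_integrable_real_affine[OF this, of s 0] s
  have G: "integrable lborel ?G" unfolding exp_eq_std_normal_density by simp
  have pair: "integrable (lborel \<Otimes>\<^sub>M lborel) (\<lambda>(h, t). autocorr f h * cos (t * h) * ?G t)"
  proof (rule Bochner_Integration.integrable_bound)
    show "integrable (lborel \<Otimes>\<^sub>M lborel) (\<lambda>(h, t). \<bar>autocorr f h\<bar> * ?G t)"
    proof (rule lborel_pair.Fubini_integrable)
      show "integrable lborel (\<lambda>h. LBINT t. norm (case (h, t) of (h, t) \<Rightarrow> \<bar>autocorr f h\<bar> * ?G t))"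
        using ac by (simp add: abs_mult)
      show "AE h in lborel. integrable lborel (\<lambda>t. case (h, t) of (h, t) \<Rightarrow> \<bar>autocorr f h\<bar> * ?G t)"
        using G by simp
    qed measurable
    show "AE x in lborel \<Otimes>\<^sub>M lborel. norm (case x of (h, t) \<Rightarrow> autocorr f h * cos (t * h) * ?G t)
        \<le> norm (case x of (h, t) \<Rightarrow> \<bar>autocorr f h\<bar> * ?G t)"
      by (intro AE_I2) (auto simp: abs_mult intro!: mult_right_mono mult_left_le)
  qed measurable
  have "(LBINT t. (cos_transform f t)\<^sup>2 * ?G t) = (LBINT t. LBINT h. autocorr f h * cos (t * h) * ?G t)"
    unfolding cos_transform_square[OF f] by simp
  also have "\<dots> = (LBINT h. LBINT t. autocorr f h * cos (t * h) * ?G t)"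
    using lborel_pair.Fubini_integral[OF pair] by simp
  also have "\<dots> = (LBINT h. autocorr f h * (sqrt (2 * pi) / s * exp (- ((h / s)\<^sup>2) / 2)))"
    by (simp only: mult.assoc integral_mult_right_zero gaussian_cos_integral[OF s])
  also have "\<dots> = s * (LBINT w. autocorr f (s * w) * (sqrt (2 * pi) / s * exp (- (w\<^sup>2) / 2)))"
    using lborel_integral_real_affine[of s "\<lambda>h. autocorr f h * (sqrt (2 * pi) / s * exp (- ((h / s)\<^sup>2) / 2))" 0] s
    by simp
  also have "\<dots> = s * (LBINT w. (2 * pi / s) * (autocorr f (s * w) * std_normal_density w))"
    unfolding exp_eq_std_normal_density by (simp add: ac_simps)
  finally show ?thesis using s by simp
qed

text \<open>The Gaussian means are at most the full integral and tend to the squared norm as the weight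
  becomes flat.\<close>

lemma plancherel_ge:
  assumes L: "0 < L" and f: "f \<in> even_L2 L"
    and int: "integrable lborel (\<lambda>t. (cos_transform f t)\<^sup>2)"
  shows "2 * pi * L2_normsq f \<le> (LBINT t. (cos_transform f t)\<^sup>2)"
proof -
  have f': "sqint f" "AE u in lborel. u \<notin> {-L..L} \<longrightarrow> f u = 0" using f by (auto simp: even_L2_iff)
  define s where "s k = 1 / (real k + 1)" for k
  have s: "0 < s k" for k by (simp add: s_def)
  have [measurable]: "autocorr f \<in> borel_measurable borel" "cos_transform f \<in> borel_measurable borel"
    using even_L2_measurable[OF f] by (auto intro: autocorr_measurable cos_transform_measurable)
  have le: "2 * pi * (LBINT w. autocorr f (s k * w) * std_normal_density w) \<le> (LBINT t. (cos_transform f t)\<^sup>2)" for k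
    unfolding gaussian_mean_of_square[OF f s, symmetric]
  proof (rule integral_mono)
    show "integrable lborel (\<lambda>t. (cos_transform f t)\<^sup>2 * exp (- ((s k * t)\<^sup>2) / 2))"
      using int by (rule integrable_mult_bounded[where B = 1]) auto
  qed (use int in \<open>auto intro: mult_left_le\<close>)
  have "(\<lambda>k. LBINT w. autocorr f (s k * w) * std_normal_density w)
      \<longlonglongrightarrow> (LBINT w. L2_normsq f * std_normal_density w)"
  proof (rule integral_dominated_convergence[where w = "\<lambda>w. L2_normsq f * std_normal_density w"])
    show "integrable lborel (\<lambda>w. L2_normsq f * std_normal_density w)"
      by (intro integrable_mult_right integrable_normal_density) simp
    show "AE w in lborel. (\<lambda>k. autocorr f (s k * w) * std_normal_density w)
        \<longlonglongrightarrow> L2_normsq f * std_normal_density w"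
    proof (intro AE_I2 tendsto_intros autocorr_tendsto[OF L f'])
      fix w show "(\<lambda>k. s k * w) \<longlonglongrightarrow> 0" unfolding s_def by real_asymp
    qed
    show "AE w in lborel. norm (autocorr f (s k * w) * std_normal_density w) \<le> L2_normsq f * std_normal_density w" for k
      using autocorr_abs_le[OF f'(1)] by (intro AE_I2) (auto simp: abs_mult normal_density_nonneg mult_right_mono)
  qed measurable
  moreover have "(LBINT w. L2_normsq f * std_normal_density w) = L2_normsq f"
    by (simp add: integral_normal_density)
  ultimately have "(\<lambda>k. 2 * pi * (LBINT w. autocorr f (s k * w) * std_normal_density w)) \<longlonglongrightarrow> 2 * pi * L2_normsq f"
    by (intro tendsto_intros) simp
  then show ?thesis by (rule LIMSEQ_le_const2) (use le in auto)
qed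

section \<open>Reduction of the Weil form\<close>

lemma integral_symmetric_interval:
  fixes k :: "real \<Rightarrow> real"
  assumes T: "0 \<le> T" and k: "set_integrable lborel {-T..T} k" and even: "\<And>t. k (- t) = k t"
  shows "(LBINT t:{-T..T}. k t) = 2 * (LBINT t:{0..T}. k t)"
proof -
  have int: "set_integrable lborel {0..T} k" "set_integrable lborel {-T..0} k"
    using k T by (auto intro: set_integrable_subset)
  have "(LBINT t:{-T..0}. k t) = (LBINT t. indicator {-T..0} (- t) *\<^sub>R k (- t))"
    using lborel_integral_real_affine[of "-1" "\<lambda>t. indicator {-T..0} t *\<^sub>R k t" 0]
    by (simp add: set_lebesgue_integral_def)
  also have "\<dots> = (LBINT t:{0..T}. k t)"
    unfolding set_lebesgue_integral_def
    by (intro Bochner_Integration.integral_cong) (auto simp: even indicator_def)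
  finally have neg: "(LBINT t:{-T..0}. k t) = (LBINT t:{0..T}. k t)" .
  have "(LBINT t:{-T..T}. k t) = (LBINT t:{-T..0} \<union> {0..T}. k t)"
    using T by (simp add: ivl_disj_un_two_touch)
  also have "\<dots> = (LBINT t:{-T..0}. k t) + (LBINT t:{0..T}. k t)"
  proof (rule set_integral_Un_AE)
    have "AE t in lborel. t \<noteq> (0::real)" by (rule AE_lborel_singleton)
    then show "AE t in lborel. \<not> (t \<in> {-T..0} \<and> t \<in> {0..T})" by eventually_elim auto
  qed (use int in auto)
  finally show ?thesis using neg by simp
qed

lemma ext_integral_cases:
  assumes "g \<in> borel_measurable M" "(\<integral>\<^sup>+ x. ennreal (- g x) \<partial>M) < \<infinity>"
  obtains "ext_integral M g = \<infinity>" | "integrable M g" "ext_integral M g = ereal (integral\<^sup>L M g)"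
proof (cases "(\<integral>\<^sup>+ x. ennreal (g x) \<partial>M) = \<infinity>")
  case True
  obtain n where n: "(\<integral>\<^sup>+ x. ennreal (- g x) \<partial>M) = ennreal n" "0 \<le> n"
    using assms(2) by (cases "\<integral>\<^sup>+ x. ennreal (- g x) \<partial>M") auto
  have "ext_integral M g = \<infinity>"
    using True n by (simp add: ext_integral_def)
  then show ?thesis using that by blast
next
  case False
  obtain n where n: "(\<integral>\<^sup>+ x. ennreal (- g x) \<partial>M) = ennreal n" "0 \<le> n"
    using assms(2) by (cases "\<integral>\<^sup>+ x. ennreal (- g x) \<partial>M") auto
  obtain p where p: "(\<integral>\<^sup>+ x. ennreal (g x) \<partial>M) = ennreal p" "0 \<le> p"
    using False by (cases "\<integral>\<^sup>+ x. ennreal (g x) \<partial>M") auto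
  have int: "integrable M g" using assms(1) n p by (simp add: real_integrable_def)
  then have "integral\<^sup>L M g = p - n" using n p by (simp add: real_lebesgue_integral_def)
  then have "ext_integral M g = ereal (integral\<^sup>L M g)"
    using n p by (simp add: ext_integral_def)
  then show ?thesis using int that by blast
qed

lemma weil_symbol_bounded_on:
  obtains K where "0 \<le> K" "\<And>t. t \<in> {a..b} \<Longrightarrow> \<bar>weil_symbol L t\<bar> \<le> K"
proof -
  obtain K where K: "\<And>t. t \<in> {a..b} \<Longrightarrow> \<bar>weil_symbol L t\<bar> \<le> K"
    using compact_imp_bounded[OF compact_continuous_image[OF continuous_weil_symbol[where L = L] compact_Icc[of a b]]]
    by (force simp: bounded_real)
  show thesis
    by (rule that[of "\<bar>K\<bar>"]) (use K in \<open>force intro: order_trans[OF _ abs_ge_self]\<close>)+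
qed

lemma set_integrable_weil_weighted:
  assumes "F \<in> borel_measurable borel" "\<And>t. \<bar>F t\<bar> \<le> B"
  shows "set_integrable lborel {a..b} (\<lambda>t. (weil_symbol L t - c) * F t)"
proof -
  have "set_integrable lborel {a..b} (\<lambda>t. weil_symbol L t - c)"
    by (intro integrable_on_interval continuous_intros continuous_weil_symbol)
  then have "integrable lborel (\<lambda>t. (indicator {a..b} t *\<^sub>R (weil_symbol L t - c)) * F t)"
    unfolding set_integrable_def by (rule integrable_mult_bounded) (use assms in auto)
  then show ?thesis by (simp add: set_integrable_def mult.assoc)
qed

text \<open>If the integral in \<open>Q\<close> is infinite there is nothing to show.  Otherwise $|F|^2$ is integrable,
  since outside $[-T,T]$ it is at most $1/\beta^*$ times the integrand; then $\beta^*|F|^2$ can be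
  split off and compared with $\beta^*\|f\|^2$ by Plancherel.\<close>

lemma weil_Q_ge_form_R:
  assumes L: "0 < L" and T: "0 < T" and beta: "0 < beta_star L T" and f: "f \<in> even_L2 L"
  shows "ereal (form_R L T f) \<le> weil_Q L f"
proof -
  define F where "F = cos_transform f"
  define B where "B = (LBINT u. \<bar>f u\<bar>)"
  define g where "g t = (F t)\<^sup>2 * weil_symbol L t" for t
  let ?b = "beta_star L T"
  have B: "\<bar>F t\<bar> \<le> B" for t
    unfolding F_def B_def by (rule cos_transform_bound[OF integrable_even_L2[OF f]])
  then have B2: "(F t)\<^sup>2 \<le> B\<^sup>2" for t by (rule abs_le_square_iff[THEN iffD1, OF order_trans[OF _ abs_ge_self]])
  have Fm [measurable]: "F \<in> borel_measurable borel"
    unfolding F_def by (rule cos_transform_measurable[OF even_L2_measurable[OF f]])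
  have gm [measurable]: "g \<in> borel_measurable borel" unfolding g_def by measurable
  have cm: "(cmod (fhat f (complex_of_real t)))\<^sup>2 = (F t)\<^sup>2" for t
    by (simp add: fhat_even_real[OF f] F_def)
  have out: "?b * (F t)\<^sup>2 \<le> g t" if "t \<notin> {-T..T}" for t
    unfolding g_def using weil_symbol_ge_beta_star[OF T beta, of t] that
    by (subst mult.commute) (intro mult_left_mono, auto)
  obtain K where K: "0 \<le> K" "\<And>t. t \<in> {-T..T} \<Longrightarrow> \<bar>weil_symbol L t\<bar> \<le> K"
    using weil_symbol_bounded_on[of "-T" T L] by blast
  have "(\<integral>\<^sup>+ t. ennreal (- g t) \<partial>lborel) \<le> (\<integral>\<^sup>+ t. ennreal (B\<^sup>2 * K * indicator {-T..T} t) \<partial>lborel)"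
  proof (intro nn_integral_mono ennreal_leI)
    fix t
    show "- g t \<le> B\<^sup>2 * K * indicator {-T..T} t"
    proof (cases "t \<in> {-T..T}")
      case True
      have "- g t \<le> (F t)\<^sup>2 * \<bar>weil_symbol L t\<bar>"
        unfolding g_def mult_minus_right[symmetric] by (intro mult_left_mono) auto
      also have "\<dots> \<le> B\<^sup>2 * K" using B2 K(2)[OF True] K(1) by (intro mult_mono) auto
      finally show ?thesis using True by simp
    next
      case False
      have "0 \<le> ?b * (F t)\<^sup>2" using beta by simp
      with out[OF False] False show ?thesis by simp
    qed
  qed
  also have "\<dots> < \<infinity>"
    using integrable_const_indicator[of "B\<^sup>2 * K" "-T" T] K(1) by (simp add: nn_integral_eq_integral)
  finally have neg: "(\<integral>\<^sup>+ t. ennreal (- g t) \<partial>lborel) < \<infinity>" .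
  have Q: "weil_Q L f = ereal (2 * (Re (fhat f (\<i>/2)))\<^sup>2) + ereal (1 / (2 * pi)) * ext_integral lborel g"
    unfolding weil_Q_def cm g_def ..
  from gm have gm': "g \<in> borel_measurable lborel" by simp
  show ?thesis
  proof (cases rule: ext_integral_cases[OF gm' neg])
    case 1
    then have "weil_Q L f = \<infinity>" unfolding Q by simp
    then show ?thesis by simp
  next
    case 2
    have F2: "integrable lborel (\<lambda>t. (F t)\<^sup>2)"
    proof (rule Bochner_Integration.integrable_bound)
      show "integrable lborel (\<lambda>t. B\<^sup>2 * indicator {-T..T} t + \<bar>g t\<bar> / ?b)"
        using 2(1) by (intro Bochner_Integration.integrable_add integrable_const_indicator) auto
      show "AE t in lborel. norm ((F t)\<^sup>2) \<le> norm (B\<^sup>2 * indicator {-T..T} t + \<bar>g t\<bar> / ?b)"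
      proof (rule AE_I2)
        fix t
        have "(F t)\<^sup>2 \<le> B\<^sup>2 * indicator {-T..T} t + \<bar>g t\<bar> / ?b"
        proof (cases "t \<in> {-T..T}")
          case True
          then show ?thesis using B2[of t] beta by (simp add: add_increasing2)
        next
          case False
          have "?b * (F t)\<^sup>2 \<le> \<bar>g t\<bar>" using out[OF False] by linarith
          then show ?thesis using False beta by (simp add: field_simps)
        qed
        then show "norm ((F t)\<^sup>2) \<le> norm (B\<^sup>2 * indicator {-T..T} t + \<bar>g t\<bar> / ?b)" by simp
      qed
    qed simp
    let ?k = "\<lambda>t. (weil_symbol L t - ?b) * (F t)\<^sup>2"
    have k: "set_integrable lborel {-T..T} ?k"
      by (rule set_integrable_weil_weighted[of _ "B\<^sup>2"]) (use B2 in auto)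
    have "2 * (LBINT t:{0..T}. ?k t) = (LBINT t:{-T..T}. ?k t)"
      by (rule integral_symmetric_interval[symmetric])
         (use T k in \<open>auto simp: weil_symbol_minus F_def cos_transform_minus\<close>)
    also have "\<dots> \<le> (LBINT t. g t - ?b * (F t)\<^sup>2)"
      unfolding set_lebesgue_integral_def
    proof (rule integral_mono)
      fix t
      show "indicator {-T..T} t *\<^sub>R ?k t \<le> g t - ?b * (F t)\<^sup>2"
        using out[of t] by (auto simp: g_def indicator_def algebra_simps)
    qed (use k 2(1) F2 in \<open>auto simp: set_integrable_def\<close>)
    also have "\<dots> = (LBINT t. g t) - ?b * (LBINT t. (F t)\<^sup>2)"
      using 2(1) F2 by simp
    finally have 1: "2 * (LBINT t:{0..T}. ?k t) + ?b * (LBINT t. (F t)\<^sup>2) \<le> (LBINT t. g t)" by simp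
    have "?b * (2 * pi * L2_normsq f) \<le> ?b * (LBINT t. (F t)\<^sup>2)"
      using plancherel_ge[OF L f] F2 beta by (intro mult_left_mono) (auto simp: F_def)
    with 1 have "2 * (LBINT t:{0..T}. ?k t) + ?b * (2 * pi * L2_normsq f) \<le> (LBINT t. g t)" by linarith
    then have "1 / (2 * pi) * (2 * (LBINT t:{0..T}. ?k t) + ?b * (2 * pi * L2_normsq f)) \<le> 1 / (2 * pi) * (LBINT t. g t)"
      by (intro mult_left_mono) auto
    then have "1 / pi * (LBINT t:{0..T}. ?k t) + ?b * L2_normsq f \<le> 1 / (2 * pi) * (LBINT t. g t)"
      by (simp add: field_simps)
    then show ?thesis
      unfolding Q 2(2) form_R_def cm by simp
  qed
qed

section \<open>The matrix of the reduced form\<close>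

lemma cutoff_even_L2:
  assumes "continuous_on UNIV g" "\<And>u. g (- u) = g u"
  shows "cutoff L g \<in> even_L2 L"
  unfolding even_L2_iff
proof (intro conjI AE_I2)
  show "sqint (cutoff L g)" using continuous_on_subset[OF assms(1)] by (intro sqint_cutoff) auto
qed (auto simp: cutoff_def assms(2))

lemma legendre_fun_even_L2: "0 < L \<Longrightarrow> legendre_fun L (2 * i) \<in> even_L2 L"
  unfolding legendre_fun_eq
  by (intro cutoff_even_L2 continuous_intros) (auto simp: legendre_poly_minus[of _ "_ / L", simplified])

lemma cutoff_cos_even_L2: "cutoff L (\<lambda>u. cos (t * u)) \<in> even_L2 L"
  by (intro cutoff_even_L2 continuous_intros) auto

lemma cutoff_cosh_even_L2: "cutoff L (\<lambda>u. cosh (u / 2)) \<in> even_L2 L"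
  by (intro cutoff_even_L2 continuous_intros) auto

lemma Re_fhat_legendre:
  assumes "0 < L"
  shows "Re (fhat (legendre_fun L n) (complex_of_real t)) = L2_inner (legendre_fun L n) (\<lambda>u. cos (t * u))"
proof -
  have "integrable lborel (\<lambda>u. legendre_fun L n u * cutoff L (\<lambda>_. 1) u)"
    using assms by (intro integrable_mult_sqint sqint_legendre_fun sqint_cutoff) auto
  moreover have "legendre_fun L n u * cutoff L (\<lambda>_. 1) u = legendre_fun L n u" for u
    by (simp add: legendre_fun_eq cutoff_def)
  ultimately show ?thesis by (simp add: fhat_real_eq cos_transform_def L2_inner_def)
qed

lemma L2_inner_legendre_cutoff:
  "L2_inner (legendre_fun L n) (cutoff L g) = L2_inner (legendre_fun L n) g"
  unfolding L2_inner_def by (intro Bochner_Integration.integral_cong) (auto simp: legendre_fun_eq cutoff_def)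

lemma p_vec_eq: "p_vec L n = L2_inner (legendre_fun L n) (\<lambda>u. cosh (u / 2))"
  unfolding p_vec_def L2_inner_def set_lebesgue_integral_def
  by (intro Bochner_Integration.integral_cong) (auto simp: legendre_fun_eq cutoff_def)

lemma finite_subset_square:
  fixes F :: "(nat \<times> nat) set"
  assumes "finite F"
  shows "\<exists>n. F \<subseteq> {..<n} \<times> {..<n}"
proof -
  have "finite (fst ` F \<union> snd ` F)" using assms by simp
  then obtain n where n: "\<forall>x\<in>fst ` F \<union> snd ` F. x < n"
    unfolding finite_nat_set_iff_bounded ..
  have "F \<subseteq> {..<n} \<times> {..<n}"
  proof
    fix z assume "z \<in> F"
    then have "fst z < n" "snd z < n" using n by auto
    then show "z \<in> {..<n} \<times> {..<n}" by (cases z) auto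
  qed
  then show ?thesis ..
qed

lemma has_sum_imp_square_sums:
  fixes h :: "nat \<times> nat \<Rightarrow> real"
  assumes "(h has_sum S) UNIV"
  shows "(\<lambda>n. \<Sum>i<n. \<Sum>j<n. h (i, j)) \<longlonglongrightarrow> S"
proof -
  have "filterlim (\<lambda>n. {..<n} \<times> {..<n}) (finite_subsets_at_top (UNIV :: (nat \<times> nat) set)) sequentially"
    unfolding filterlim_finite_subsets_at_top
  proof (intro allI impI)
    fix X :: "(nat \<times> nat) set" assume "finite X \<and> X \<subseteq> UNIV"
    then obtain n where "X \<subseteq> {..<n} \<times> {..<n}" using finite_subset_square by blast
    then have "X \<subseteq> {..<m} \<times> {..<m}" if "n \<le> m" for m using that by fastforce
    then show "\<forall>\<^sub>F y in sequentially. finite ({..<y} \<times> {..<y}) \<and> X \<subseteq> {..<y} \<times> {..<y} \<and> {..<y} \<times> {..<y} \<subseteq> UNIV"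
      by (intro eventually_sequentiallyI[of n]) auto
  qed
  from filterlim_compose[OF assms[unfolded has_sum_def] this]
  show ?thesis by (simp add: sum.cartesian_product)
qed

text \<open>Every finite set of pairs lies in a square, so bounded absolute sums over squares give
  summability, and the value can be computed along squares.\<close>

lemma has_sum_of_square_sums:
  fixes h :: "nat \<times> nat \<Rightarrow> real"
  assumes bd: "\<And>n. (\<Sum>i<n. \<Sum>j<n. \<bar>h (i, j)\<bar>) \<le> B"
    and lim: "(\<lambda>n. \<Sum>i<n. \<Sum>j<n. h (i, j)) \<longlonglongrightarrow> S"
  shows "(h has_sum S) UNIV"
proof -
  have "(\<lambda>x. \<bar>h x\<bar>) summable_on UNIV"
  proof (rule nonneg_bdd_above_summable_on)
    have "sum (\<lambda>x. \<bar>h x\<bar>) F \<le> B" if fin: "finite F" for F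
    proof -
      obtain n where "F \<subseteq> {..<n} \<times> {..<n}" using finite_subset_square[OF fin] by blast
      then have "sum (\<lambda>x. \<bar>h x\<bar>) F \<le> sum (\<lambda>x. \<bar>h x\<bar>) ({..<n} \<times> {..<n})" by (intro sum_mono2) auto
      then show ?thesis using bd[of n] by (simp add: sum.cartesian_product)
    qed
    then show "bdd_above (sum (\<lambda>x. \<bar>h x\<bar>) ` {F. F \<subseteq> UNIV \<and> finite F})" by (auto intro!: bdd_aboveI)
  qed auto
  then have "h summable_on UNIV" using abs_summable_summable[of h] by simp
  then obtain S' where S': "(h has_sum S') UNIV" by (auto simp: summable_on_def)
  then have "S = S'" using has_sum_imp_square_sums lim LIMSEQ_unique by blast
  with S' show ?thesis by simp
qed

lemma bessel:
  assumes "0 < L" "f \<in> even_L2 L" "finite I"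
  shows "(\<Sum>i\<in>I. (L2_inner f (legendre_fun L (2 * i)))\<^sup>2) \<le> L2_normsq f"
  using assms by (intro finite_sum_le_has_sum[OF legendre_parseval]) auto

lemma sum_abs_product_le:
  fixes x y :: "nat \<Rightarrow> real"
  shows "(\<Sum>i\<in>I. \<bar>x i * y i\<bar>) \<le> ((\<Sum>i\<in>I. (x i)\<^sup>2) + (\<Sum>i\<in>I. (y i)\<^sup>2)) / 2"
proof -
  have "\<bar>a * b\<bar> \<le> (a\<^sup>2 + b\<^sup>2) / 2" for a b :: real
    using sum_squares_bound[of "\<bar>a\<bar>" "\<bar>b\<bar>"] by (simp add: abs_mult)
  then have "(\<Sum>i\<in>I. \<bar>x i * y i\<bar>) \<le> (\<Sum>i\<in>I. ((x i)\<^sup>2 + (y i)\<^sup>2) / 2)" by (intro sum_mono)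
  then show ?thesis by (simp add: sum.distrib add_divide_distrib sum_divide_distrib)
qed

lemma L2_normsq_cutoff_cos_le: "0 < L \<Longrightarrow> L2_normsq (cutoff L (\<lambda>u. cos (t * u))) \<le> 2 * L"
  using L2_normsq_cutoff_le[of L "\<lambda>u. cos (t * u)" 1]
  by (simp add: sqint_cutoff continuous_intros)

lemma double_sum_square: "(\<Sum>i\<in>I. \<Sum>j\<in>I. y i * y j) = (\<Sum>i\<in>I. y i :: real)\<^sup>2"
  by (simp add: power2_eq_square sum_product)

text \<open>Over a square of side \<open>n\<close> the double sum is the form with $F(i/2)$ and $F(t)$ replaced by the
  \<open>n\<close>-th partial sums of their Legendre expansions.  These partial sums are bounded uniformly in \<open>t\<close>
  by Bessel's inequality, so the limit passes under the integral.\<close>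

lemma form_R_has_sum:
  assumes L: "0 < L" and T: "0 < T" and f: "f \<in> even_L2 L"
  shows "((\<lambda>(i, j). M_R L T i j * L2_inner f (legendre_fun L (2 * i)) * L2_inner f (legendre_fun L (2 * j)))
           has_sum form_R L T f) UNIV"
proof -
  let ?b = "beta_star L T"
  define x where "x i = L2_inner f (legendre_fun L (2 * i))" for i
  define a where "a i t = Re (fhat (legendre_fun L (2 * i)) (complex_of_real t))" for i t
  define p where "p i = p_vec L (2 * i)" for i
  define w where "w t = indicator {0..T} t * (weil_symbol L t - ?b)" for t
  define Bd where "Bd = (L2_normsq f + 2 * L) / 2"
  define Bp where "Bp = (L2_normsq f + L2_normsq (cutoff L (\<lambda>u. cosh (u / 2)))) / 2"
  define F where "F = cos_transform f"
  have a_inner: "a i t = L2_inner (cutoff L (\<lambda>u. cos (t * u))) (legendre_fun L (2 * i))" for i t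
    unfolding a_def Re_fhat_legendre[OF L] by (subst L2_inner_commute) (simp add: L2_inner_legendre_cutoff)
  have a_cos: "a i = cos_transform (legendre_fun L (2 * i))" for i
    unfolding a_def Re_fhat_legendre[OF L] by (auto simp: cos_transform_def L2_inner_def)
  have p_inner: "p i = L2_inner (cutoff L (\<lambda>u. cosh (u / 2))) (legendre_fun L (2 * i))" for i
    unfolding p_def p_vec_eq by (subst L2_inner_commute) (simp add: L2_inner_legendre_cutoff)
  have am [measurable]: "a i \<in> borel_measurable borel" for i
    unfolding a_cos by (intro cos_transform_measurable sqint_measurable sqint_legendre_fun L)
  have wi: "integrable lborel w"
    using integrable_on_interval[of 0 T "\<lambda>t. weil_symbol L t - ?b"]
    by (simp add: w_def[abs_def] set_integrable_def continuous_intros continuous_weil_symbol)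
  then have wm [measurable]: "w \<in> borel_measurable borel" by auto
  have sum_xa: "(\<Sum>i<n. \<bar>x i * a i t\<bar>) \<le> Bd" for n t
  proof -
    have "(\<Sum>i<n. (x i)\<^sup>2) \<le> L2_normsq f" unfolding x_def by (intro bessel L f) auto
    moreover have "(\<Sum>i<n. (a i t)\<^sup>2) \<le> 2 * L"
      unfolding a_inner by (intro order_trans[OF bessel L2_normsq_cutoff_cos_le] L cutoff_cos_even_L2) auto
    ultimately show ?thesis
      using sum_abs_product_le[of x "\<lambda>i. a i t" "{..<n}"] by (simp add: Bd_def)
  qed
  have sum_xp: "(\<Sum>i<n. \<bar>x i * p i\<bar>) \<le> Bp" for n
  proof -
    have "(\<Sum>i<n. (x i)\<^sup>2) \<le> L2_normsq f" unfolding x_def by (intro bessel L f) auto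
    moreover have "(\<Sum>i<n. (p i)\<^sup>2) \<le> L2_normsq (cutoff L (\<lambda>u. cosh (u / 2)))"
      unfolding p_inner by (intro bessel L cutoff_cosh_even_L2) auto
    ultimately show ?thesis
      using sum_abs_product_le[of x p "{..<n}"] by (simp add: Bp_def)
  qed
  have a_bd: "\<exists>B. \<forall>t. \<bar>a i t\<bar> \<le> B" for i
    unfolding a_cos using cos_transform_bound[OF integrable_even_L2[OF legendre_fun_even_L2[OF L]]] by blast
  have waa: "integrable lborel (\<lambda>t. w t * (a i t * a j t))" for i j
  proof -
    obtain Bi Bj where B: "\<And>t. \<bar>a i t\<bar> \<le> Bi" "\<And>t. \<bar>a j t\<bar> \<le> Bj" using a_bd by meson
    have "\<bar>a i t * a j t\<bar> \<le> Bi * Bj" for t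
      unfolding abs_mult using B[of t] order_trans[OF abs_ge_zero B(1)[of t]] by (intro mult_mono) auto
    then show ?thesis by (intro integrable_mult_bounded[OF wi]) auto
  qed
  have C: "C_mat L T (2 * i) (2 * j) = 1 / pi * (LBINT t. w t * (a i t * a j t))" for i j
    unfolding C_mat_def set_lebesgue_integral_def w_def a_def by (simp add: mult.assoc)
  have Bd0: "0 \<le> Bd" using L L2_normsq_nonneg[of f] by (simp add: Bd_def)
  have sq_le: "(\<Sum>i<n. \<Sum>j<n. \<bar>y i * y j\<bar>) \<le> B\<^sup>2" if "(\<Sum>i<n. \<bar>y i\<bar>) \<le> B" for y :: "nat \<Rightarrow> real" and n B
    using power_mono[OF that, of 2] by (simp add: abs_mult double_sum_square sum_nonneg)
  let ?h = "\<lambda>(i, j). M_R L T i j * x i * x j"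
  have split: "M_R L T i j * x i * x j = (if i = j then ?b * (x i)\<^sup>2 else 0)
      + 2 * ((x i * p i) * (x j * p j)) + C_mat L T (2 * i) (2 * j) * x i * x j" for i j
    by (simp add: M_R_def p_def power2_eq_square algebra_simps)
  have Csum: "(\<Sum>i<n. \<Sum>j<n. C_mat L T (2 * i) (2 * j) * x i * x j)
      = 1 / pi * (LBINT t. w t * (\<Sum>i<n. x i * a i t)\<^sup>2)" for n
  proof -
    have "w t * (\<Sum>i<n. x i * a i t)\<^sup>2 = (\<Sum>i<n. \<Sum>j<n. x i * x j * (w t * (a i t * a j t)))" for t
      unfolding double_sum_square[symmetric] by (simp add: sum_distrib_left ac_simps)
    then have "(LBINT t. w t * (\<Sum>i<n. x i * a i t)\<^sup>2) = (\<Sum>i<n. \<Sum>j<n. x i * x j * (LBINT t. w t * (a i t * a j t)))"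
      using waa by simp
    then show ?thesis unfolding C by (simp add: sum_distrib_left ac_simps)
  qed
  have Cabs: "(\<Sum>i<n. \<Sum>j<n. \<bar>C_mat L T (2 * i) (2 * j) * x i * x j\<bar>) \<le> 1 / pi * (Bd\<^sup>2 * (LBINT t. \<bar>w t\<bar>))" for n
  proof -
    have one: "\<bar>C_mat L T (2 * i) (2 * j) * x i * x j\<bar> \<le> 1 / pi * (LBINT t. \<bar>w t\<bar> * \<bar>(x i * a i t) * (x j * a j t)\<bar>)" for i j
    proof -
      have "\<bar>C_mat L T (2 * i) (2 * j) * x i * x j\<bar> = 1 / pi * (\<bar>LBINT t. w t * (a i t * a j t)\<bar> * \<bar>x i * x j\<bar>)"
        by (simp add: C abs_mult)
      also have "\<dots> \<le> 1 / pi * ((LBINT t. \<bar>w t * (a i t * a j t)\<bar>) * \<bar>x i * x j\<bar>)"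
        by (intro mult_left_mono mult_right_mono integral_abs_bound) auto
      also have "(LBINT t. \<bar>w t * (a i t * a j t)\<bar>) * \<bar>x i * x j\<bar> = (LBINT t. \<bar>w t * (a i t * a j t)\<bar> * \<bar>x i * x j\<bar>)"
        by simp
      finally show ?thesis by (simp add: abs_mult ac_simps)
    qed
    have int: "integrable lborel (\<lambda>t. \<bar>w t\<bar> * \<bar>(x i * a i t) * (x j * a j t)\<bar>)" for i j
      using integrable_mult_right[OF integrable_abs[OF waa[of i j]], of "\<bar>x i * x j\<bar>"] by (simp add: abs_mult ac_simps)
    have "(\<Sum>i<n. \<Sum>j<n. \<bar>C_mat L T (2 * i) (2 * j) * x i * x j\<bar>)
        \<le> (\<Sum>i<n. \<Sum>j<n. 1 / pi * (LBINT t. \<bar>w t\<bar> * \<bar>(x i * a i t) * (x j * a j t)\<bar>))"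
      by (intro sum_mono one)
    also have "\<dots> = 1 / pi * (LBINT t. \<bar>w t\<bar> * (\<Sum>i<n. \<Sum>j<n. \<bar>(x i * a i t) * (x j * a j t)\<bar>))"
      using int by (simp add: sum_distrib_left)
    also have "\<dots> \<le> 1 / pi * (LBINT t. \<bar>w t\<bar> * Bd\<^sup>2)"
    proof (intro mult_left_mono integral_mono)
      show "integrable lborel (\<lambda>t. \<bar>w t\<bar> * (\<Sum>i<n. \<Sum>j<n. \<bar>(x i * a i t) * (x j * a j t)\<bar>))"
        using int by (simp add: sum_distrib_left)
    qed (use wi sq_le[OF sum_xa] in auto)
    finally show ?thesis by (simp add: mult.commute)
  qed
  have "((\<lambda>(i, j). M_R L T i j * x i * x j) has_sum form_R L T f) UNIV"
  proof (rule has_sum_of_square_sums)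
    fix n
    have "(\<Sum>i<n. \<Sum>j<n. \<bar>case (i, j) of (i, j) \<Rightarrow> M_R L T i j * x i * x j\<bar>)
        \<le> (\<Sum>i<n. \<Sum>j<n. (if i = j then \<bar>?b\<bar> * (x i)\<^sup>2 else 0)
            + 2 * \<bar>(x i * p i) * (x j * p j)\<bar> + \<bar>C_mat L T (2 * i) (2 * j) * x i * x j\<bar>)"
    proof (intro sum_mono)
      fix i j
      show "\<bar>case (i, j) of (i, j) \<Rightarrow> M_R L T i j * x i * x j\<bar> \<le> (if i = j then \<bar>?b\<bar> * (x i)\<^sup>2 else 0)
            + 2 * \<bar>(x i * p i) * (x j * p j)\<bar> + \<bar>C_mat L T (2 * i) (2 * j) * x i * x j\<bar>"
        unfolding prod.case split by (rule order_trans[OF abs_triangle_ineq] add_mono)+ (auto simp: abs_mult)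
    qed
    also have "\<dots> = \<bar>?b\<bar> * (\<Sum>i<n. (x i)\<^sup>2) + 2 * (\<Sum>i<n. \<Sum>j<n. \<bar>(x i * p i) * (x j * p j)\<bar>)
        + (\<Sum>i<n. \<Sum>j<n. \<bar>C_mat L T (2 * i) (2 * j) * x i * x j\<bar>)"
      by (simp add: sum.distrib sum_distrib_left)
    also have "\<dots> \<le> \<bar>?b\<bar> * L2_normsq f + 2 * Bp\<^sup>2 + 1 / pi * (Bd\<^sup>2 * (LBINT t. \<bar>w t\<bar>))"
      by (intro add_mono mult_left_mono Cabs sq_le sum_xp) (auto simp: x_def intro!: bessel L f)
    finally show "(\<Sum>i<n. \<Sum>j<n. \<bar>case (i, j) of (i, j) \<Rightarrow> M_R L T i j * x i * x j\<bar>)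
        \<le> \<bar>?b\<bar> * L2_normsq f + 2 * Bp\<^sup>2 + 1 / pi * (Bd\<^sup>2 * (LBINT t. \<bar>w t\<bar>))" .
  next
    have l1: "(\<lambda>n. \<Sum>i<n. (x i)\<^sup>2) \<longlonglongrightarrow> L2_normsq f"
      using has_sum_imp_sums[OF legendre_parseval[OF L f]] by (simp add: sums_def x_def)
    have l2: "(\<lambda>n. \<Sum>i<n. x i * p i) \<longlonglongrightarrow> Re (fhat f (\<i>/2))"
      using has_sum_imp_sums[OF legendre_parseval_inner[OF L f cutoff_cosh_even_L2]]
      by (simp add: sums_def x_def p_inner fhat_even_i_half[OF f])
    have l3: "(\<lambda>n. \<Sum>i<n. x i * a i t) \<longlonglongrightarrow> F t" for t
      using has_sum_imp_sums[OF legendre_parseval_inner[OF L f cutoff_cos_even_L2]]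
      by (simp add: sums_def x_def a_inner F_def cos_transform_inner[OF f])
    have l4: "(\<lambda>n. LBINT t. w t * (\<Sum>i<n. x i * a i t)\<^sup>2) \<longlonglongrightarrow> (LBINT t. w t * (F t)\<^sup>2)"
    proof (rule integral_dominated_convergence[where w = "\<lambda>t. \<bar>w t\<bar> * Bd\<^sup>2"])
      show "(\<lambda>t. w t * (F t)\<^sup>2) \<in> borel_measurable lborel"
        unfolding F_def using cos_transform_measurable[OF even_L2_measurable[OF f]] by measurable
      show "AE t in lborel. (\<lambda>n. w t * (\<Sum>i<n. x i * a i t)\<^sup>2) \<longlonglongrightarrow> w t * (F t)\<^sup>2"
        by (intro AE_I2 tendsto_intros l3)
      show "AE t in lborel. norm (w t * (\<Sum>i<n. x i * a i t)\<^sup>2) \<le> \<bar>w t\<bar> * Bd\<^sup>2" for n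
      proof (rule AE_I2)
        fix t
        have "\<bar>\<Sum>i<n. x i * a i t\<bar> \<le> Bd" using sum_abs[of "\<lambda>i. x i * a i t" "{..<n}"] sum_xa[where n = n and t = t] by linarith
        from power_mono[OF this, of 2] show "norm (w t * (\<Sum>i<n. x i * a i t)\<^sup>2) \<le> \<bar>w t\<bar> * Bd\<^sup>2"
          by (simp add: abs_mult mult_left_mono)
      qed
    qed (use wi in auto)
    have "(\<lambda>n. ?b * (\<Sum>i<n. (x i)\<^sup>2) + 2 * (\<Sum>i<n. x i * p i)\<^sup>2
        + 1 / pi * (LBINT t. w t * (\<Sum>i<n. x i * a i t)\<^sup>2))
      \<longlonglongrightarrow> ?b * L2_normsq f + 2 * (Re (fhat f (\<i>/2)))\<^sup>2 + 1 / pi * (LBINT t. w t * (F t)\<^sup>2)"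
      by (intro tendsto_intros l1 l2 l4)
    moreover have "(\<Sum>i<n. \<Sum>j<n. case (i, j) of (i, j) \<Rightarrow> M_R L T i j * x i * x j)
        = ?b * (\<Sum>i<n. (x i)\<^sup>2) + 2 * (\<Sum>i<n. x i * p i)\<^sup>2 + 1 / pi * (LBINT t. w t * (\<Sum>i<n. x i * a i t)\<^sup>2)" for n
    proof -
      have pp: "(\<Sum>i<n. \<Sum>j<n. 2 * ((x i * p i) * (x j * p j))) = 2 * (\<Sum>i<n. x i * p i)\<^sup>2"
        unfolding double_sum_square[symmetric] by (simp only: sum_distrib_left)
      have xx: "(\<Sum>i<n. \<Sum>j<n. if i = j then ?b * (x i)\<^sup>2 else 0) = ?b * (\<Sum>i<n. (x i)\<^sup>2)"
        by (simp add: sum_distrib_left)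
      show ?thesis
        unfolding prod.case split Csum[symmetric] pp[symmetric] xx[symmetric] by (simp only: sum.distrib)
    qed
    moreover have "form_R L T f = ?b * L2_normsq f + 2 * (Re (fhat f (\<i>/2)))\<^sup>2 + 1 / pi * (LBINT t. w t * (F t)\<^sup>2)"
      unfolding form_R_def fhat_even_real[OF f] set_lebesgue_integral_def w_def F_def
      by (simp add: mult.assoc)
    ultimately show "(\<lambda>n. \<Sum>i<n. \<Sum>j<n. case (i, j) of (i, j) \<Rightarrow> M_R L T i j * x i * x j) \<longlonglongrightarrow> form_R L T f"
      by simp
  qed
  then show ?thesis by (simp add: x_def)
qed

section \<open>The Hilbert spaces of square-summable families\<close>

definition ell2_inner :: "(nat \<Rightarrow> real) \<Rightarrow> (nat \<Rightarrow> real) \<Rightarrow> real" where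
  "ell2_inner x y = (\<Sum>\<^sub>\<infinity>i. x i * y i)"

lemma ell2_norm_sq: "(ell2_norm x)\<^sup>2 = ell2_inner x x"
  unfolding ell2_norm_def ell2_inner_def by (simp add: infsum_nonneg flip: power2_eq_square)

lemma ell2_norm_nonneg [simp]: "0 \<le> ell2_norm x"
  by (simp add: ell2_norm_def infsum_nonneg)

lemma ell2_summable_mult:
  assumes "x \<in> ell2 I" "y \<in> ell2 J"
  shows "(\<lambda>i. x i * y i) summable_on UNIV"
proof (rule abs_summable_summable[OF abs_summable_product])
  show "(\<lambda>i. norm (x i * x i)) summable_on UNIV" "(\<lambda>i. norm (y i * y i)) summable_on UNIV"
    using assms by (simp_all add: ell2_def power2_eq_square)
qed

lemma ell2_add: "x \<in> ell2 I \<Longrightarrow> y \<in> ell2 I \<Longrightarrow> (\<lambda>i. x i + y i) \<in> ell2 I"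
  using ell2_summable_mult[of x I y I]
  by (auto simp: ell2_def power2_sum mult.assoc intro!: summable_on_add summable_on_cmult_right)

lemma ell2_scale: "x \<in> ell2 I \<Longrightarrow> (\<lambda>i. c * x i) \<in> ell2 I"
  by (auto simp: ell2_def power_mult_distrib intro!: summable_on_cmult_right)

lemma ell2_diff: "x \<in> ell2 I \<Longrightarrow> y \<in> ell2 I \<Longrightarrow> (\<lambda>i. x i - y i) \<in> ell2 I"
  using ell2_add[of x I "\<lambda>i. (-1) * y i"] ell2_scale[of y I "-1"] by simp

lemma ell2_zero: "(\<lambda>i. 0) \<in> ell2 I"
  by (simp add: ell2_def)

lemma ell2_inner_commute: "ell2_inner x y = ell2_inner y x"
  by (simp add: ell2_inner_def mult.commute)

lemma ell2_inner_scale_right: "ell2_inner x (\<lambda>i. c * y i) = c * ell2_inner x y"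
  by (simp add: ell2_inner_def infsum_cmult_right' mult.left_commute)

lemma ell2_inner_add_right:
  "\<lbrakk>x \<in> ell2 I; y \<in> ell2 I; z \<in> ell2 I\<rbrakk> \<Longrightarrow> ell2_inner x (\<lambda>i. y i + z i) = ell2_inner x y + ell2_inner x z"
  unfolding ell2_inner_def distrib_left by (intro infsum_add ell2_summable_mult)

lemma ell2_inner_diff_right:
  assumes "x \<in> ell2 I" "y \<in> ell2 I" "z \<in> ell2 I"
  shows "ell2_inner x (\<lambda>i. y i - z i) = ell2_inner x y - ell2_inner x z"
  using ell2_inner_add_right[OF assms(1,2) ell2_scale[OF assms(3), of "-1"]]
    ell2_inner_scale_right[of x "-1" z] by simp

lemma ell2_inner_diff_left:
  assumes "x \<in> ell2 I" "y \<in> ell2 I" "z \<in> ell2 I"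
  shows "ell2_inner (\<lambda>i. y i - z i) x = ell2_inner y x - ell2_inner z x"
  using ell2_inner_diff_right[OF assms] by (simp add: ell2_inner_commute)

lemma ell2_norm_scale: "ell2_norm (\<lambda>i. c * x i) = \<bar>c\<bar> * ell2_norm x"
  by (simp add: ell2_norm_def power_mult_distrib infsum_cmult_right' real_sqrt_mult)

lemma ell2_finite_sum_le:
  assumes "x \<in> ell2 I" "finite A"
  shows "(\<Sum>i\<in>A. (x i)\<^sup>2) \<le> (ell2_norm x)\<^sup>2"
  using assms finite_sum_le_infsum[of "\<lambda>i. (x i)\<^sup>2" UNIV A]
  by (simp add: ell2_def ell2_norm_def infsum_nonneg)

lemma ell2_boundedI:
  assumes "\<And>i. i \<notin> I \<Longrightarrow> x i = 0" "0 \<le> c" "\<And>A. finite A \<Longrightarrow> A \<subseteq> I \<Longrightarrow> (\<Sum>i\<in>A. (x i)\<^sup>2) \<le> c\<^sup>2"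
  shows "x \<in> ell2 I" "ell2_norm x \<le> c"
proof -
  have le: "(\<Sum>i\<in>A. (x i)\<^sup>2) \<le> c\<^sup>2" if "finite A" for A
  proof -
    have "(\<Sum>i\<in>A. (x i)\<^sup>2) = (\<Sum>i\<in>A \<inter> I. (x i)\<^sup>2)"
      using that assms(1) by (intro sum.mono_neutral_right) auto
    then show ?thesis using assms(3)[of "A \<inter> I"] that by simp
  qed
  have s: "(\<lambda>i. (x i)\<^sup>2) summable_on UNIV"
    using le by (intro nonneg_bdd_above_summable_on bdd_aboveI[of _ "c\<^sup>2"]) auto
  then show "x \<in> ell2 I" using assms(1) by (simp add: ell2_def)
  have "(\<Sum>\<^sub>\<infinity>i. (x i)\<^sup>2) \<le> c\<^sup>2" using le by (intro infsum_le_finite_sums s) auto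
  then show "ell2_norm x \<le> c" using assms(2) unfolding ell2_norm_def by (simp add: real_le_lsqrt)
qed

lemma ell2_finite_support:
  assumes "finite A" "A \<subseteq> I" "\<And>i. i \<notin> A \<Longrightarrow> x i = 0"
  shows "x \<in> ell2 I" "ell2_inner x y = (\<Sum>i\<in>A. x i * y i)"
proof -
  show "x \<in> ell2 I"
  proof (rule ell2_boundedI)
    show "x i = 0" if "i \<notin> I" for i using assms that by auto
    show "(\<Sum>i\<in>B. (x i)\<^sup>2) \<le> (sqrt (\<Sum>i\<in>A. (x i)\<^sup>2))\<^sup>2" if "finite B" for B
    proof -
      have "(\<Sum>i\<in>B. (x i)\<^sup>2) = (\<Sum>i\<in>B \<inter> A. (x i)\<^sup>2)"
        using that assms by (intro sum.mono_neutral_right) auto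
      also have "\<dots> \<le> (\<Sum>i\<in>A. (x i)\<^sup>2)" using assms by (intro sum_mono2) auto
      finally show ?thesis by (simp add: sum_nonneg)
    qed
  qed (simp add: sum_nonneg)
  have "ell2_inner x y = infsum (\<lambda>i. x i * y i) A"
    unfolding ell2_inner_def using assms by (intro infsum_cong_neutral) auto
  then show "ell2_inner x y = (\<Sum>i\<in>A. x i * y i)" using assms by simp
qed

lemma ell2_cauchy_schwarz:
  assumes "x \<in> ell2 I" "y \<in> ell2 J"
  shows "\<bar>ell2_inner x y\<bar> \<le> ell2_norm x * ell2_norm y"
proof -
  have fin: "\<bar>\<Sum>i\<in>A. x i * y i\<bar> \<le> ell2_norm x * ell2_norm y" if "finite A" for A
  proof -
    have "(\<Sum>i\<in>A. x i * y i)\<^sup>2 \<le> (\<Sum>i\<in>A. (x i)\<^sup>2) * (\<Sum>i\<in>A. (y i)\<^sup>2)"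
      by (rule Cauchy_Schwarz_ineq_sum)
    also have "\<dots> \<le> (ell2_norm x)\<^sup>2 * (ell2_norm y)\<^sup>2"
      using that by (intro mult_mono ell2_finite_sum_le[OF assms(1)] ell2_finite_sum_le[OF assms(2)]) (auto intro: sum_nonneg)
    finally have "\<bar>\<Sum>i\<in>A. x i * y i\<bar>\<^sup>2 \<le> (ell2_norm x * ell2_norm y)\<^sup>2" by (simp add: power_mult_distrib)
    then show ?thesis by (rule power2_le_imp_le) simp
  qed
  have lim: "((\<lambda>A. \<bar>\<Sum>i\<in>A. x i * y i\<bar>) \<longlongrightarrow> \<bar>ell2_inner x y\<bar>) (finite_subsets_at_top UNIV)"
    unfolding ell2_inner_def by (intro tendsto_rabs infsum_tendsto ell2_summable_mult[OF assms])
  show ?thesis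
    by (rule tendsto_upperbound[OF lim]) (use fin in auto)
qed

lemma ell2_norm_eq_0:
  assumes "x \<in> ell2 I" "ell2_norm x = 0"
  shows "x = (\<lambda>i. 0)"
proof
  fix i
  have "(x i)\<^sup>2 \<le> 0" using ell2_finite_sum_le[OF assms(1), of "{i}"] assms(2) by simp
  then show "x i = 0" by simp
qed

lemma ell2_norm_triangle:
  assumes "x \<in> ell2 I" "y \<in> ell2 I"
  shows "ell2_norm (\<lambda>i. x i + y i) \<le> ell2_norm x + ell2_norm y"
proof (rule power2_le_imp_le)
  have "(ell2_norm (\<lambda>i. x i + y i))\<^sup>2 = ell2_inner x x + 2 * ell2_inner x y + ell2_inner y y"
    unfolding ell2_norm_sq
    using ell2_inner_add_right[OF ell2_add[OF assms] assms] ell2_inner_add_right[OF assms(1) assms]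
      ell2_inner_add_right[OF assms(2) assms]
    by (simp add: ell2_inner_commute)
  also have "\<dots> \<le> (ell2_norm x)\<^sup>2 + 2 * (ell2_norm x * ell2_norm y) + (ell2_norm y)\<^sup>2"
    unfolding ell2_norm_sq using ell2_cauchy_schwarz[OF assms] by simp
  finally show "(ell2_norm (\<lambda>i. x i + y i))\<^sup>2 \<le> (ell2_norm x + ell2_norm y)\<^sup>2"
    by (simp add: power2_sum)
qed simp

lemma ell2_metric: "Metric_space (ell2 I) (\<lambda>x y. ell2_norm (\<lambda>i. x i - y i))"
proof
  show "ell2_norm (\<lambda>i. x i - y i) = ell2_norm (\<lambda>i. y i - x i)" for x y :: "nat \<Rightarrow> real"
    by (simp add: ell2_norm_def power2_commute)
  show "ell2_norm (\<lambda>i. x i - y i) = 0 \<longleftrightarrow> x = y" if "x \<in> ell2 I" "y \<in> ell2 I" for x y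
  proof
    assume "ell2_norm (\<lambda>i. x i - y i) = 0"
    from ell2_norm_eq_0[OF ell2_diff[OF that] this] show "x = y" by (simp add: fun_eq_iff)
  qed (simp add: ell2_norm_def)
  show "ell2_norm (\<lambda>i. x i - z i) \<le> ell2_norm (\<lambda>i. x i - y i) + ell2_norm (\<lambda>i. y i - z i)"
    if "x \<in> ell2 I" "y \<in> ell2 I" "z \<in> ell2 I" for x y z
    using ell2_norm_triangle[OF ell2_diff[OF that(1,2)] ell2_diff[OF that(2,3)]] by simp
qed simp

lemma ell2_complete: "Metric_space.mcomplete (ell2 I) (\<lambda>x y. ell2_norm (\<lambda>i. x i - y i))"
proof -
  interpret Metric_space "ell2 I" "\<lambda>x y. ell2_norm (\<lambda>i. x i - y i)" by (rule ell2_metric)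
  show ?thesis
    unfolding mcomplete_def
  proof (intro allI impI)
    fix s assume s: "MCauchy s"
    then have mem: "s n \<in> ell2 I" for n by (auto simp: MCauchy_def)
    have coord: "\<bar>s n i - s m i\<bar> \<le> ell2_norm (\<lambda>i. s n i - s m i)" for n m i
      using ell2_finite_sum_le[OF ell2_diff[OF mem mem], of "{i}" n m]
      by (auto intro!: power2_le_imp_le[of "\<bar>_\<bar>"])
    have "Cauchy (\<lambda>n. s n i)" for i
    proof (rule CauchyI)
      fix e :: real assume "0 < e"
      then obtain N where "\<forall>n n'. N \<le> n \<longrightarrow> N \<le> n' \<longrightarrow> ell2_norm (\<lambda>i. s n i - s n' i) < e"
        using s by (auto simp: MCauchy_def)
      then show "\<exists>M. \<forall>m\<ge>M. \<forall>n\<ge>M. norm (s m i - s n i) < e"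
        using le_less_trans[OF coord] by (intro exI[of _ N]) auto
    qed
    then have "\<exists>l. (\<lambda>n. s n i) \<longlonglongrightarrow> l" for i by (simp add: Cauchy_convergent_iff convergent_def)
    then obtain l where l: "\<And>i. (\<lambda>n. s n i) \<longlonglongrightarrow> l i" by metis
    have close: "\<exists>N. \<forall>n\<ge>N. (\<lambda>i. s n i - l i) \<in> ell2 I \<and> ell2_norm (\<lambda>i. s n i - l i) \<le> e" if e: "0 < e" for e
    proof -
      obtain N where N: "\<And>n n'. N \<le> n \<Longrightarrow> N \<le> n' \<Longrightarrow> ell2_norm (\<lambda>i. s n i - s n' i) < e"
        using s e unfolding MCauchy_def by meson
      have fin: "(\<Sum>i\<in>A. (s n i - l i)\<^sup>2) \<le> e\<^sup>2" if "N \<le> n" "finite A" for n A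
      proof (rule LIMSEQ_le_const2)
        show "(\<lambda>m. \<Sum>i\<in>A. (s n i - s m i)\<^sup>2) \<longlonglongrightarrow> (\<Sum>i\<in>A. (s n i - l i)\<^sup>2)"
          by (intro tendsto_intros l)
        have "(\<Sum>i\<in>A. (s n i - s m i)\<^sup>2) \<le> e\<^sup>2" if "N \<le> m" for m
          using ell2_finite_sum_le[OF ell2_diff[OF mem mem] \<open>finite A\<close>, of n m] N[OF \<open>N \<le> n\<close> that]
            power_mono[of "ell2_norm (\<lambda>i. s n i - s m i)" e 2]
          by simp
        then show "\<exists>M. \<forall>m\<ge>M. (\<Sum>i\<in>A. (s n i - s m i)\<^sup>2) \<le> e\<^sup>2" by blast
      qed
      have zero: "s n i - l i = 0" if "i \<notin> I" for n i
      proof -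
        have "s m i = 0" for m using mem[of m] that by (simp add: ell2_def)
        then have "l i = 0" using l[of i] by (simp add: LIMSEQ_const_iff)
        then show ?thesis using \<open>\<And>m. s m i = 0\<close> by simp
      qed
      show ?thesis
        using ell2_boundedI[of I "\<lambda>i. s _ i - l i" e] fin zero e by (intro exI[of _ N]) force
    qed
    obtain N0 where "(\<lambda>i. s N0 i - l i) \<in> ell2 I" using close[of 1] by auto
    from ell2_diff[OF mem[of N0] this] have lmem: "l \<in> ell2 I" by simp
    have "limitin mtopology s l sequentially"
      unfolding limit_metric_sequentially
    proof (intro conjI lmem allI impI)
      fix e :: real assume "0 < e"
      then obtain N where "\<forall>n\<ge>N. ell2_norm (\<lambda>i. s n i - l i) \<le> e / 2" using close[of "e / 2"] by auto
      then show "\<exists>N. \<forall>n\<ge>N. s n \<in> ell2 I \<and> ell2_norm (\<lambda>i. s n i - l i) < e"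
        using mem \<open>0 < e\<close> by (intro exI[of _ N]) force
    qed
    then show "\<exists>x. limitin mtopology s x sequentially" by (intro exI[of _ l])
  qed
qed

section \<open>Spectrum and numerical range\<close>

text \<open>An operator is represented by a function that may be arbitrary off \<open>ell2 I\<close>; all assumptions are
  restricted to that space.\<close>

locale ell2_symmetric =
  fixes I :: "nat set" and A :: "(nat \<Rightarrow> real) \<Rightarrow> nat \<Rightarrow> real" and Lam :: real
  assumes closed: "x \<in> ell2 I \<Longrightarrow> A x \<in> ell2 I"
    and diff: "x \<in> ell2 I \<Longrightarrow> y \<in> ell2 I \<Longrightarrow> A (\<lambda>i. x i - y i) = (\<lambda>i. A x i - A y i)"
    and scale: "x \<in> ell2 I \<Longrightarrow> A (\<lambda>i. c * x i) = (\<lambda>i. c * A x i)"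
    and sym: "x \<in> ell2 I \<Longrightarrow> y \<in> ell2 I \<Longrightarrow> ell2_inner (A x) y = ell2_inner x (A y)"
    and bounded: "x \<in> ell2 I \<Longrightarrow> ell2_norm (A x) \<le> Lam * ell2_norm x"
    and Lam_nonneg: "0 \<le> Lam"
begin

text \<open>The negation of membership in the spectrum, as in \<open>block_spec\<close>, for an arbitrary operator.\<close>

definition invertible_at :: "real \<Rightarrow> bool" where
  "invertible_at \<mu> \<longleftrightarrow> (\<exists>S. (\<forall>y\<in>ell2 I. S y \<in> ell2 I)
               \<and> (\<exists>c. \<forall>y\<in>ell2 I. ell2_norm (S y) \<le> c * ell2_norm y)
               \<and> (\<forall>x\<in>ell2 I. S (\<lambda>i. A x i - \<mu> * x i) = x)
               \<and> (\<forall>y\<in>ell2 I. (\<lambda>i. A (S y) i - \<mu> * S y i) = y))"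

lemma shifted: "ell2_symmetric I (\<lambda>x i. A x i - \<mu> * x i) (Lam + \<bar>\<mu>\<bar>)"
proof
  fix x y :: "nat \<Rightarrow> real" and c :: real
  assume x: "x \<in> ell2 I"
  show "(\<lambda>i. A x i - \<mu> * x i) \<in> ell2 I" by (intro ell2_diff closed ell2_scale x)
  show "(\<lambda>i. A (\<lambda>i. c * x i) i - \<mu> * (c * x i)) = (\<lambda>i. c * (A x i - \<mu> * x i))"
    by (simp add: scale[OF x] algebra_simps)
  have "ell2_norm (\<lambda>i. A x i + (- \<mu>) * x i) \<le> ell2_norm (A x) + ell2_norm (\<lambda>i. (- \<mu>) * x i)"
    by (intro ell2_norm_triangle[where I = I] closed x ell2_scale)
  also have "\<dots> \<le> Lam * ell2_norm x + \<bar>\<mu>\<bar> * ell2_norm x"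
    unfolding ell2_norm_scale using bounded[OF x] by simp
  finally show "ell2_norm (\<lambda>i. A x i - \<mu> * x i) \<le> (Lam + \<bar>\<mu>\<bar>) * ell2_norm x"
    by (simp add: algebra_simps)
  assume y: "y \<in> ell2 I"
  show "(\<lambda>i. A (\<lambda>i. x i - y i) i - \<mu> * (x i - y i)) = (\<lambda>i. (A x i - \<mu> * x i) - (A y i - \<mu> * y i))"
    by (simp add: diff[OF x y] algebra_simps)
  show "ell2_inner (\<lambda>i. A x i - \<mu> * x i) y = ell2_inner x (\<lambda>i. A y i - \<mu> * y i)"
    using sym[OF x y] ell2_inner_diff_left[OF y closed[OF x] ell2_scale[OF x]]
      ell2_inner_diff_right[OF x closed[OF y] ell2_scale[OF y]]
    by (simp add: ell2_inner_scale_right ell2_inner_commute[of "\<lambda>i. \<mu> * x i"]) (simp add: ell2_inner_commute)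
qed (use Lam_nonneg in simp)

lemma form_diff_scale:
  assumes x: "x \<in> ell2 I" and y: "y \<in> ell2 I"
  shows "ell2_inner (\<lambda>i. x i - t * y i) (A (\<lambda>i. x i - t * y i))
    = ell2_inner x (A x) - 2 * t * ell2_inner y (A x) + t\<^sup>2 * ell2_inner y (A y)"
proof -
  note ty = ell2_scale[OF y, of t]
  have "ell2_inner x (A y) = ell2_inner y (A x)"
    using sym[OF x y] by (simp add: ell2_inner_commute)
  then show ?thesis
    using ell2_inner_diff_left[OF closed[OF ell2_diff[OF x ty]] x ty]
      ell2_inner_diff_right[OF x closed[OF x] ell2_scale[OF closed[OF y], of t]]
      ell2_inner_diff_right[OF ty closed[OF x] ell2_scale[OF closed[OF y], of t]]
    by (simp add: diff[OF x ty] scale[OF y] ell2_inner_scale_right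
        ell2_inner_commute[of "\<lambda>i. t * y i"])
      (simp add: ell2_inner_commute power2_eq_square algebra_simps)
qed

text \<open>For a nonnegative form the vector \<open>A x\<close> is small as soon as the value of the form at \<open>x\<close> is:
  this is the Cauchy-Schwarz inequality for the form, in the shape of one well-chosen point on the
  line through \<open>x\<close> in direction \<open>A x\<close>.\<close>

lemma norm_sq_le_form:
  assumes pos: "\<And>x. x \<in> ell2 I \<Longrightarrow> 0 \<le> ell2_inner x (A x)" and x: "x \<in> ell2 I"
  shows "(ell2_norm (A x))\<^sup>2 \<le> (Lam + 1) * ell2_inner x (A x)"
proof -
  let ?t = "1 / (Lam + 1)"
  note y = closed[OF x]
  have "0 \<le> ell2_inner x (A x) - 2 * ?t * ell2_inner (A x) (A x) + ?t\<^sup>2 * ell2_inner (A x) (A (A x))"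
    using pos[OF ell2_diff[OF x ell2_scale[OF y, of ?t]]] form_diff_scale[OF x y, of ?t] by simp
  note main = this
  have "ell2_inner (A x) (A (A x)) \<le> (Lam + 1) * ell2_inner (A x) (A x)"
  proof -
    have "ell2_inner (A x) (A (A x)) \<le> ell2_norm (A x) * ell2_norm (A (A x))"
      using ell2_cauchy_schwarz[OF y closed[OF y]] by linarith
    also have "\<dots> \<le> ell2_norm (A x) * (Lam * ell2_norm (A x))"
      by (intro mult_left_mono bounded y) simp
    also have "\<dots> = Lam * ell2_inner (A x) (A x)"
      unfolding ell2_norm_sq[symmetric] by (simp add: power2_eq_square)
    also have "\<dots> \<le> (Lam + 1) * ell2_inner (A x) (A x)"
      unfolding ell2_norm_sq[symmetric] by (simp add: mult_right_mono)
    finally show ?thesis .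
  qed
  then have "?t\<^sup>2 * ell2_inner (A x) (A (A x)) \<le> ?t\<^sup>2 * ((Lam + 1) * ell2_inner (A x) (A x))"
    by (intro mult_left_mono) auto
  also have "\<dots> = ?t * ell2_inner (A x) (A x)"
    using Lam_nonneg by (simp add: power2_eq_square)
  finally have "?t * ell2_inner (A x) (A x) \<le> ell2_inner x (A x)"
    using main by linarith
  then show ?thesis
    unfolding ell2_norm_sq using Lam_nonneg by (simp add: field_simps)
qed

definition lower_bound :: real where
  "lower_bound = Inf {ell2_inner x (A x) | x. x \<in> ell2 I \<and> ell2_norm x = 1}"

lemma form_ge:
  assumes x: "x \<in> ell2 I"
  shows "- (Lam * (ell2_norm x)\<^sup>2) \<le> ell2_inner x (A x)"
  using ell2_cauchy_schwarz[OF x closed[OF x]] mult_left_mono[OF bounded[OF x], of "ell2_norm x"]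
  by (simp add: power2_eq_square algebra_simps)

lemma form_ge_lower_bound:
  assumes x: "x \<in> ell2 I"
  shows "lower_bound * (ell2_norm x)\<^sup>2 \<le> ell2_inner x (A x)"
proof (cases "ell2_norm x = 0")
  case True
  then show ?thesis using form_ge[OF x] by simp
next
  case False
  define c where "c = 1 / ell2_norm x"
  have n: "ell2_norm (\<lambda>i. c * x i) = 1" unfolding ell2_norm_scale c_def using False by simp
  have "lower_bound \<le> ell2_inner (\<lambda>i. c * x i) (A (\<lambda>i. c * x i))"
    unfolding lower_bound_def
  proof (rule cInf_lower)
    show "bdd_below {ell2_inner x (A x) | x. x \<in> ell2 I \<and> ell2_norm x = 1}"
      using form_ge by (intro bdd_belowI[of _ "- Lam"]) force
  qed (use n ell2_scale[OF x] in blast)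
  also have "\<dots> = c\<^sup>2 * ell2_inner x (A x)"
    by (simp add: scale[OF x] ell2_inner_scale_right ell2_inner_commute[of "\<lambda>i. c * x i"] power2_eq_square)
       (simp add: ell2_inner_commute)
  finally show ?thesis using False by (simp add: c_def field_simps)
qed

lemma unit_vector: "I \<noteq> {} \<Longrightarrow> \<exists>x\<in>ell2 I. ell2_norm x = 1"
proof -
  assume "I \<noteq> {}"
  then obtain k where k: "k \<in> I" by auto
  define x where "x i = (if i = k then 1 else 0 :: real)" for i
  have "x \<in> ell2 I" "ell2_inner x x = 1"
    using ell2_finite_support(1)[of "{k}" I x] ell2_finite_support(2)[of "{k}" I x x] k by (auto simp: x_def)
  then have "x \<in> ell2 I" "(ell2_norm x)\<^sup>2 = 1" by (simp_all add: ell2_norm_sq)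
  then show ?thesis using ell2_norm_nonneg[of x] by (auto simp: power2_eq_1_iff)
qed

lemma lower_bound_ge:
  assumes "I \<noteq> {}" "\<And>x. x \<in> ell2 I \<Longrightarrow> l * (ell2_norm x)\<^sup>2 \<le> ell2_inner x (A x)"
  shows "l \<le> lower_bound"
  unfolding lower_bound_def
proof (rule cInf_greatest)
  show "{ell2_inner x (A x) | x. x \<in> ell2 I \<and> ell2_norm x = 1} \<noteq> {}" using unit_vector[OF assms(1)] by blast
qed (use assms(2) in force)

text \<open>The infimum of the numerical range belongs to the spectrum: unit vectors that nearly attain it
  are nearly annihilated, so there is no bounded inverse.\<close>

lemma not_invertible_at_lower_bound:
  assumes I: "I \<noteq> {}"
  shows "\<not> invertible_at lower_bound"
proof
  assume "invertible_at lower_bound"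
  then obtain S c where Sc: "\<And>y. y \<in> ell2 I \<Longrightarrow> ell2_norm (S y) \<le> c * ell2_norm y"
    and S: "\<And>x. x \<in> ell2 I \<Longrightarrow> S (\<lambda>i. A x i - lower_bound * x i) = x"
    unfolding invertible_at_def by blast
  define G where "G x = (\<lambda>i. A x i - lower_bound * x i)" for x
  interpret G: ell2_symmetric I G "Lam + \<bar>lower_bound\<bar>"
    unfolding G_def by (rule shifted)
  have form: "ell2_inner x (G x) = ell2_inner x (A x) - lower_bound * (ell2_norm x)\<^sup>2" if "x \<in> ell2 I" for x
    unfolding G_def ell2_inner_diff_right[OF that closed[OF that] ell2_scale[OF that]]
    by (simp add: ell2_inner_scale_right ell2_norm_sq)
  have pos: "0 \<le> ell2_inner x (G x)" if "x \<in> ell2 I" for x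
    using form_ge_lower_bound[OF that] form[OF that] by simp
  define K where "K = Lam + \<bar>lower_bound\<bar> + 1"
  have K: "0 < K" using Lam_nonneg by (simp add: K_def)
  define d where "d = 1 / (c\<^sup>2 * K + 1)"
  have d: "0 < d" "c\<^sup>2 * K * d < 1" using K by (auto simp: d_def add_nonneg_pos divide_simps)
  have "\<exists>v\<in>{ell2_inner x (A x) | x. x \<in> ell2 I \<and> ell2_norm x = 1}. v < lower_bound + d"
    unfolding lower_bound_def
  proof (rule cInf_lessD)
    show "{ell2_inner x (A x) | x. x \<in> ell2 I \<and> ell2_norm x = 1} \<noteq> {}" using unit_vector[OF I] by blast
  qed (use d in simp)
  then obtain x where x: "x \<in> ell2 I" "ell2_norm x = 1" "ell2_inner x (A x) < lower_bound + d" by auto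
  have "1 = (ell2_norm (S (G x)))\<^sup>2" using S[OF x(1)] x(2) by (simp add: G_def)
  also have "\<dots> \<le> (c * ell2_norm (G x))\<^sup>2" using Sc[OF G.closed[OF x(1)]] by (intro power_mono) auto
  also have "\<dots> \<le> c\<^sup>2 * (K * ell2_inner x (G x))"
    using G.norm_sq_le_form[OF pos x(1)] unfolding power_mult_distrib K_def by (intro mult_left_mono) auto
  also have "\<dots> \<le> c\<^sup>2 * (K * d)" using form[OF x(1)] x K by (intro mult_left_mono) auto
  finally show False using d by (simp add: mult.assoc)
qed

text \<open>Below a lower bound of its form the shifted operator \<open>G\<close> is coercive, so it is bounded below and
  the equation $Gx = y$ is solvable by a contraction, as in the Lax-Milgram theorem.\<close>

lemma invertible_below:
  assumes l: "\<And>x. x \<in> ell2 I \<Longrightarrow> l * (ell2_norm x)\<^sup>2 \<le> ell2_inner x (A x)" and mu: "\<mu> < l"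
  shows "invertible_at \<mu>"
proof -
  define G where "G x = (\<lambda>i. A x i - \<mu> * x i)" for x
  interpret G: ell2_symmetric I G "Lam + \<bar>\<mu>\<bar>"
    unfolding G_def by (rule shifted)
  define d where "d = l - \<mu>"
  have d: "0 < d" using mu by (simp add: d_def)
  have coer: "d * (ell2_norm x)\<^sup>2 \<le> ell2_inner x (G x)" if "x \<in> ell2 I" for x
  proof -
    have "ell2_inner x (G x) = ell2_inner x (A x) - \<mu> * (ell2_norm x)\<^sup>2"
      unfolding G_def ell2_inner_diff_right[OF that closed[OF that] ell2_scale[OF that]]
      by (simp add: ell2_inner_scale_right ell2_norm_sq)
    then show ?thesis using l[OF that] by (simp add: d_def algebra_simps)
  qed
  have below: "d * ell2_norm x \<le> ell2_norm (G x)" if "x \<in> ell2 I" for x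
  proof (cases "ell2_norm x = 0")
    case False
    have "d * (ell2_norm x)\<^sup>2 \<le> ell2_norm x * ell2_norm (G x)"
      using coer[OF that] ell2_cauchy_schwarz[OF that G.closed[OF that]] by linarith
    then have "ell2_norm x * (d * ell2_norm x) \<le> ell2_norm x * ell2_norm (G x)"
      by (simp add: power2_eq_square algebra_simps)
    moreover have "0 < ell2_norm x" using False ell2_norm_nonneg[of x] by linarith
    ultimately show ?thesis by simp
  qed simp
  have inj: "x = y" if "x \<in> ell2 I" "y \<in> ell2 I" "G x = G y" for x y
  proof -
    have "d * ell2_norm (\<lambda>i. x i - y i) \<le> ell2_norm (\<lambda>i. G x i - G y i)"
      using below[OF ell2_diff[OF that(1,2)]] unfolding G.diff[OF that(1,2)] .
    then have "ell2_norm (\<lambda>i. x i - y i) = 0"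
      using d that(3) ell2_norm_nonneg[of "\<lambda>i. x i - y i"] by (simp add: ell2_norm_def mult_le_0_iff)
    from ell2_norm_eq_0[OF ell2_diff[OF that(1,2)] this] show ?thesis by (simp add: fun_eq_iff)
  qed
  \<comment> \<open>\<open>G x = y\<close> is solved by iterating \<open>x \<mapsto> x - t (G x - y)\<close>.\<close>
  have surj: "\<exists>x\<in>ell2 I. G x = y" if y: "y \<in> ell2 I" for y
  proof -
    define K where "K = Lam + \<bar>\<mu>\<bar> + d"
    have K: "d \<le> K" "0 < K" "Lam + \<bar>\<mu>\<bar> \<le> K" using Lam_nonneg d by (auto simp: K_def)
    \<comment> \<open>This step size minimises the bound $1 - 2td + t^2K^2$ for the squared contraction factor.\<close>
    define t where "t = d / K\<^sup>2"
    define k where "k = sqrt (1 - d\<^sup>2 / K\<^sup>2)"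
    have dK: "d\<^sup>2 / K\<^sup>2 \<le> 1" using K d by (simp add: power_mono)
    have k: "k < 1" "k\<^sup>2 = 1 - d\<^sup>2 / K\<^sup>2" "0 \<le> k"
      unfolding k_def using K d dK by (auto simp: real_less_lsqrt)
    define \<phi> where "\<phi> x = (\<lambda>i. x i - t * (G x i - y i))" for x
    have contr: "ell2_norm (\<lambda>i. z i - t * G z i) \<le> k * ell2_norm z" if z: "z \<in> ell2 I" for z
    proof (rule power2_le_imp_le)
      have Gz: "G z \<in> ell2 I" by (rule G.closed[OF z])
      have "(ell2_norm (\<lambda>i. z i - t * G z i))\<^sup>2
          = (ell2_norm z)\<^sup>2 - 2 * t * ell2_inner z (G z) + t\<^sup>2 * (ell2_norm (G z))\<^sup>2"
        unfolding ell2_norm_sq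
        using ell2_inner_diff_left[OF ell2_diff[OF z ell2_scale[OF Gz]] z ell2_scale[OF Gz, of t]]
          ell2_inner_diff_right[OF z z ell2_scale[OF Gz, of t]]
          ell2_inner_diff_right[OF ell2_scale[OF Gz, of t] z ell2_scale[OF Gz, of t]]
        by (simp add: ell2_inner_scale_right ell2_inner_commute[of "\<lambda>i. t * G z i"])
          (simp add: ell2_inner_commute power2_eq_square algebra_simps)
      also have "\<dots> \<le> (ell2_norm z)\<^sup>2 - 2 * t * (d * (ell2_norm z)\<^sup>2) + t\<^sup>2 * (K * ell2_norm z)\<^sup>2"
      proof -
        have "ell2_norm (G z) \<le> K * ell2_norm z"
          using G.bounded[OF z] mult_right_mono[OF K(3), of "ell2_norm z"] by simp
        then have "t\<^sup>2 * (ell2_norm (G z))\<^sup>2 \<le> t\<^sup>2 * (K * ell2_norm z)\<^sup>2"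
          by (intro mult_left_mono power_mono) auto
        moreover have "2 * t * (d * (ell2_norm z)\<^sup>2) \<le> 2 * t * ell2_inner z (G z)"
          using coer[OF z] d by (intro mult_left_mono) (auto simp: t_def)
        ultimately show ?thesis by linarith
      qed
      also have "\<dots> = (k * ell2_norm z)\<^sup>2"
        unfolding power_mult_distrib k(2) t_def using K by (simp add: field_simps power2_eq_square)
      finally show "(ell2_norm (\<lambda>i. z i - t * G z i))\<^sup>2 \<le> (k * ell2_norm z)\<^sup>2" .
    qed (use k in simp)
    interpret Met: Metric_space "ell2 I" "\<lambda>x y. ell2_norm (\<lambda>i. x i - y i)" by (rule ell2_metric)
    obtain x where x: "x \<in> ell2 I" "\<phi> x = x"
    proof (rule Met.Banach_fixedpoint_thm[OF ell2_complete _ _ k(1)])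
      show "ell2 I \<noteq> {}" using ell2_zero by blast
      show "\<phi> \<in> ell2 I \<rightarrow> ell2 I"
        unfolding \<phi>_def using y by (auto intro!: ell2_diff ell2_scale G.closed)
      show "ell2_norm (\<lambda>i. \<phi> u i - \<phi> v i) \<le> k * ell2_norm (\<lambda>i. u i - v i)" if "u \<in> ell2 I" "v \<in> ell2 I" for u v
      proof -
        have "(\<lambda>i. \<phi> u i - \<phi> v i) = (\<lambda>i. (u i - v i) - t * G (\<lambda>i. u i - v i) i)"
          unfolding G.diff[OF that] \<phi>_def by (auto simp: algebra_simps)
        then show ?thesis using contr[OF ell2_diff[OF that]] by simp
      qed
    qed
    have "t \<noteq> 0" using d K by (simp add: t_def)
    then have "G x i = y i" for i using fun_cong[OF x(2), of i] by (simp add: \<phi>_def)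
    then show ?thesis using x(1) by blast
  qed
  define S where "S y = (SOME x. x \<in> ell2 I \<and> G x = y)" for y
  have S: "S y \<in> ell2 I" "G (S y) = y" if "y \<in> ell2 I" for y
    using someI_ex[of "\<lambda>x. x \<in> ell2 I \<and> G x = y"] surj[OF that] by (auto simp: S_def)
  have "ell2_norm (S y) \<le> (1 / d) * ell2_norm y" if "y \<in> ell2 I" for y
    using below[OF S(1)[OF that]] d unfolding S(2)[OF that] by (simp add: field_simps)
  moreover have "S (G x) = x" if "x \<in> ell2 I" for x
    using inj[OF S(1) that] S(2) G.closed[OF that] by blast
  ultimately show ?thesis
    unfolding invertible_at_def using S unfolding G_def by blast
qed

lemma Inf_not_invertible_eq_lower_bound:
  assumes "I \<noteq> {}"
  shows "Inf {\<mu>. \<not> invertible_at \<mu>} = lower_bound"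
proof (rule cInf_eq_minimum)
  show "lower_bound \<in> {\<mu>. \<not> invertible_at \<mu>}" using not_invertible_at_lower_bound[OF assms] by simp
  show "lower_bound \<le> \<mu>" if "\<mu> \<in> {\<mu>. \<not> invertible_at \<mu>}" for \<mu>
    using that invertible_below[OF form_ge_lower_bound, of \<mu>] by (auto simp: not_less[symmetric])
qed

end

section \<open>Hilbert-Schmidt blocks\<close>

text \<open>Bounds on the sums over finite rectangles, from which all summability follows.\<close>

definition hs_le :: "(nat \<Rightarrow> nat \<Rightarrow> real) \<Rightarrow> nat set \<Rightarrow> nat set \<Rightarrow> real \<Rightarrow> bool" where
  "hs_le H I J S \<longleftrightarrow> 0 \<le> S \<and>
     (\<forall>A B. finite A \<longrightarrow> finite B \<longrightarrow> A \<subseteq> I \<longrightarrow> B \<subseteq> J \<longrightarrow> (\<Sum>i\<in>A. \<Sum>j\<in>B. (H i j)\<^sup>2) \<le> S\<^sup>2)"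

lemma hs_le_nonneg: "hs_le H I J S \<Longrightarrow> 0 \<le> S"
  by (simp add: hs_le_def)

lemma hs_leD: "\<lbrakk>hs_le H I J S; finite A; finite B; A \<subseteq> I; B \<subseteq> J\<rbrakk> \<Longrightarrow> (\<Sum>i\<in>A. \<Sum>j\<in>B. (H i j)\<^sup>2) \<le> S\<^sup>2"
  by (simp add: hs_le_def)

lemma hs_le_subset: "\<lbrakk>hs_le H I J S; I' \<subseteq> I; J' \<subseteq> J\<rbrakk> \<Longrightarrow> hs_le H I' J' S"
  unfolding hs_le_def by (meson subset_trans)

text \<open>Minkowski's inequality on each finite rectangle.\<close>

lemma hs_le_add:
  assumes "hs_le G I J S" "hs_le H I J R"
  shows "hs_le (\<lambda>i j. G i j + H i j) I J (S + R)"
  unfolding hs_le_def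
proof (intro conjI allI impI)
  show "0 \<le> S + R" using assms by (simp add: hs_le_def)
  fix A B assume AB: "finite (A :: nat set)" "finite (B :: nat set)" "A \<subseteq> I" "B \<subseteq> J"
  have L2: "L2_set (\<lambda>(i, j). K i j) (A \<times> B) \<le> Q" if "hs_le K I J Q" for K Q
  proof -
    have "(\<Sum>(i, j)\<in>A \<times> B. (K i j)\<^sup>2) \<le> Q\<^sup>2"
      using hs_leD[OF that AB] by (simp add: sum.cartesian_product)
    then have "sqrt (\<Sum>(i, j)\<in>A \<times> B. (K i j)\<^sup>2) \<le> Q"
      using hs_le_nonneg[OF that] by (simp add: real_le_lsqrt)
    then show ?thesis by (simp add: L2_set_def case_prod_beta')
  qed
  have "L2_set (\<lambda>x. (case x of (i, j) \<Rightarrow> G i j) + (case x of (i, j) \<Rightarrow> H i j)) (A \<times> B) \<le> S + R"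
    using L2_set_triangle_ineq[of "\<lambda>(i, j). G i j" "\<lambda>(i, j). H i j" "A \<times> B"] L2[OF assms(1)] L2[OF assms(2)]
    by linarith
  then have "(L2_set (\<lambda>x. (case x of (i, j) \<Rightarrow> G i j) + (case x of (i, j) \<Rightarrow> H i j)) (A \<times> B))\<^sup>2 \<le> (S + R)\<^sup>2"
    by (intro power_mono) auto
  then show "(\<Sum>i\<in>A. \<Sum>j\<in>B. (G i j + H i j)\<^sup>2) \<le> (S + R)\<^sup>2"
    by (simp add: L2_set_def sum_nonneg sum.cartesian_product case_prod_beta')
qed

lemma hs_summable:
  assumes H: "hs_le H I J S" and i: "i \<in> I" and x: "x \<in> ell2 J"
  shows "(\<lambda>j. H i j * x j) summable_on J"
proof -
  define h where "h j = (if j \<in> J then H i j else 0)" for j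
  have "h \<in> ell2 J"
  proof (rule ell2_boundedI(1)[OF _ hs_le_nonneg[OF H]])
    fix B assume "finite B" "B \<subseteq> J"
    then have "(\<Sum>j\<in>B. (H i j)\<^sup>2) \<le> S\<^sup>2" using hs_leD[OF H, of "{i}" B] i by simp
    moreover have "(\<Sum>j\<in>B. (h j)\<^sup>2) = (\<Sum>j\<in>B. (H i j)\<^sup>2)"
      using \<open>B \<subseteq> J\<close> by (intro sum.cong) (auto simp: h_def)
    ultimately show "(\<Sum>j\<in>B. (h j)\<^sup>2) \<le> S\<^sup>2" by simp
  qed (simp add: h_def)
  from summable_on_subset_banach[OF ell2_summable_mult[OF this x], of J]
  have "(\<lambda>j. h j * x j) summable_on J" by simp
  also have "?this \<longleftrightarrow> ?thesis" by (intro summable_on_cong) (simp add: h_def)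
  finally show ?thesis .
qed

text \<open>The Cauchy-Schwarz inequality on finite rectangles, followed by a limit in the column set.\<close>

lemma hs_block_op:
  assumes H: "hs_le H I J S" and x: "x \<in> ell2 J"
  shows "block_op H I J x \<in> ell2 I" "ell2_norm (block_op H I J x) \<le> S * ell2_norm x"
proof -
  have S: "0 \<le> S" by (rule hs_le_nonneg[OF H])
  have fin: "(\<Sum>i\<in>A. (block_op H I J x i)\<^sup>2) \<le> (S * ell2_norm x)\<^sup>2" if A: "finite A" "A \<subseteq> I" for A
  proof (rule tendsto_upperbound)
    have "((\<lambda>B. \<Sum>i\<in>A. (\<Sum>j\<in>B. H i j * x j)\<^sup>2) \<longlongrightarrow> (\<Sum>i\<in>A. (\<Sum>\<^sub>\<infinity>j\<in>J. H i j * x j)\<^sup>2)) (finite_subsets_at_top J)"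
      using A by (intro tendsto_intros infsum_tendsto hs_summable[OF H _ x]) auto
    also have "(\<Sum>i\<in>A. (\<Sum>\<^sub>\<infinity>j\<in>J. H i j * x j)\<^sup>2) = (\<Sum>i\<in>A. (block_op H I J x i)\<^sup>2)"
      using A by (intro sum.cong) (auto simp: block_op_def)
    finally show "((\<lambda>B. \<Sum>i\<in>A. (\<Sum>j\<in>B. H i j * x j)\<^sup>2) \<longlongrightarrow> (\<Sum>i\<in>A. (block_op H I J x i)\<^sup>2)) (finite_subsets_at_top J)" .
    have "(\<Sum>i\<in>A. (\<Sum>j\<in>B. H i j * x j)\<^sup>2) \<le> (S * ell2_norm x)\<^sup>2" if B: "finite B" "B \<subseteq> J" for B
    proof -
      have "(\<Sum>i\<in>A. (\<Sum>j\<in>B. H i j * x j)\<^sup>2) \<le> (\<Sum>i\<in>A. (\<Sum>j\<in>B. (H i j)\<^sup>2) * (\<Sum>j\<in>B. (x j)\<^sup>2))"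
        by (intro sum_mono Cauchy_Schwarz_ineq_sum)
      also have "\<dots> = (\<Sum>i\<in>A. \<Sum>j\<in>B. (H i j)\<^sup>2) * (\<Sum>j\<in>B. (x j)\<^sup>2)" by (simp add: sum_distrib_right)
      also have "\<dots> \<le> S\<^sup>2 * (ell2_norm x)\<^sup>2"
        using A B by (intro mult_mono hs_leD[OF H] ell2_finite_sum_le[OF x]) (auto intro: sum_nonneg)
      finally show ?thesis by (simp add: power_mult_distrib)
    qed
    then show "\<forall>\<^sub>F B in finite_subsets_at_top J. (\<Sum>i\<in>A. (\<Sum>j\<in>B. H i j * x j)\<^sup>2) \<le> (S * ell2_norm x)\<^sup>2"
      by (rule eventually_finite_subsets_at_top_weakI)
  qed simp
  show "block_op H I J x \<in> ell2 I"
    by (rule ell2_boundedI(1)[of _ _ "S * ell2_norm x"]) (use S fin in \<open>auto simp: block_op_def\<close>)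
  show "ell2_norm (block_op H I J x) \<le> S * ell2_norm x"
    by (rule ell2_boundedI(2)[of I]) (use S fin in \<open>auto simp: block_op_def\<close>)
qed

lemma block_op_scale: "block_op H I J (\<lambda>i. c * x i) = (\<lambda>i. c * block_op H I J x i)"
  by (auto simp: block_op_def infsum_cmult_right' mult.left_commute)

lemma hs_double_sum_summable:
  assumes H: "hs_le H I J S" and x: "x \<in> ell2 J" and y: "y \<in> ell2 I"
  shows "(\<lambda>(i, j). H i j * x j * y i) summable_on I \<times> J"
proof -
  have bd: "\<bar>h * a * b\<bar> \<le> h\<^sup>2 + a\<^sup>2 * b\<^sup>2" for h a b :: real
  proof -
    have "2 * (\<bar>h\<bar> * \<bar>a * b\<bar>) \<le> \<bar>h\<bar>\<^sup>2 + \<bar>a * b\<bar>\<^sup>2"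
      using sum_squares_bound[of "\<bar>h\<bar>" "\<bar>a * b\<bar>"] by (simp add: mult.assoc)
    moreover have "0 \<le> \<bar>h\<bar> * \<bar>a * b\<bar>" by simp
    ultimately have "\<bar>h\<bar> * \<bar>a * b\<bar> \<le> \<bar>h\<bar>\<^sup>2 + \<bar>a * b\<bar>\<^sup>2" by linarith
    then show ?thesis by (simp add: abs_mult power_mult_distrib mult.assoc)
  qed
  let ?f = "\<lambda>(i, j). H i j * x j * y i"
  have "(\<lambda>p. norm (?f p)) summable_on I \<times> J"
  proof (rule nonneg_bdd_above_summable_on)
    have "sum (\<lambda>p. norm (?f p)) F \<le> S\<^sup>2 + (ell2_norm x)\<^sup>2 * (ell2_norm y)\<^sup>2" if F: "finite F" "F \<subseteq> I \<times> J" for F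
    proof -
      define A B where "A = fst ` F" and "B = snd ` F"
      have AB: "finite A" "finite B" "A \<subseteq> I" "B \<subseteq> J" "F \<subseteq> A \<times> B"
        using F by (auto simp: A_def B_def intro: rev_image_eqI)
      have "sum (\<lambda>p. norm (?f p)) F \<le> sum (\<lambda>p. norm (?f p)) (A \<times> B)"
        using AB by (intro sum_mono2) auto
      also have "\<dots> = (\<Sum>i\<in>A. \<Sum>j\<in>B. \<bar>H i j * x j * y i\<bar>)" by (simp add: sum.cartesian_product case_prod_beta')
      also have "\<dots> \<le> (\<Sum>i\<in>A. \<Sum>j\<in>B. (H i j)\<^sup>2 + (x j)\<^sup>2 * (y i)\<^sup>2)" by (intro sum_mono bd)
      also have "\<dots> = (\<Sum>i\<in>A. \<Sum>j\<in>B. (H i j)\<^sup>2) + (\<Sum>j\<in>B. (x j)\<^sup>2) * (\<Sum>i\<in>A. (y i)\<^sup>2)"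
        by (simp add: sum.distrib sum_distrib_left[symmetric] sum_distrib_right[symmetric])
      also have "\<dots> \<le> S\<^sup>2 + (ell2_norm x)\<^sup>2 * (ell2_norm y)\<^sup>2"
        using AB by (intro add_mono mult_mono hs_leD[OF H] ell2_finite_sum_le[OF x] ell2_finite_sum_le[OF y]) (auto intro: sum_nonneg)
      finally show ?thesis .
    qed
    then show "bdd_above (sum (\<lambda>p. norm (?f p)) ` {F. F \<subseteq> I \<times> J \<and> finite F})"
      by (intro bdd_aboveI[of _ "S\<^sup>2 + (ell2_norm x)\<^sup>2 * (ell2_norm y)\<^sup>2"]) auto
  qed auto
  then show ?thesis by (rule abs_summable_summable)
qed

lemma ell2_inner_block_op:
  assumes "y \<in> ell2 I"
  shows "ell2_inner (block_op H I J x) y = (\<Sum>\<^sub>\<infinity>i\<in>I. \<Sum>\<^sub>\<infinity>j\<in>J. H i j * x j * y i)"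
proof -
  have "ell2_inner (block_op H I J x) y = (\<Sum>\<^sub>\<infinity>i\<in>I. (\<Sum>\<^sub>\<infinity>j\<in>J. H i j * x j) * y i)"
    unfolding ell2_inner_def by (rule infsum_cong_neutral) (auto simp: block_op_def)
  then show ?thesis by (simp add: infsum_cmult_left')
qed

lemma hs_block_op_symmetric:
  assumes H: "hs_le H I I S" and sym: "\<And>i j. H i j = H j i"
  shows "ell2_symmetric I (block_op H I I) S"
proof
  fix x assume x: "x \<in> ell2 I"
  show "block_op H I I x \<in> ell2 I" "ell2_norm (block_op H I I x) \<le> S * ell2_norm x"
    by (rule hs_block_op[OF H x])+
  show "block_op H I I (\<lambda>i. c * x i) = (\<lambda>i. c * block_op H I I x i)" for c by (rule block_op_scale)
  fix y assume y: "y \<in> ell2 I"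
  show "block_op H I I (\<lambda>i. x i - y i) = (\<lambda>i. block_op H I I x i - block_op H I I y i)"
  proof
    fix i
    show "block_op H I I (\<lambda>i. x i - y i) i = block_op H I I x i - block_op H I I y i"
    proof (cases "i \<in> I")
      case True
      have "(\<Sum>\<^sub>\<infinity>j\<in>I. H i j * x j + (-1) * (H i j * y j)) = (\<Sum>\<^sub>\<infinity>j\<in>I. H i j * x j) + (\<Sum>\<^sub>\<infinity>j\<in>I. (-1) * (H i j * y j))"
        by (intro infsum_add summable_on_cmult_right hs_summable[OF H True] x y)
      then show ?thesis using True by (simp add: block_op_def right_diff_distrib infsum_uminus)
    qed (simp add: block_op_def)
  qed
  have "ell2_inner (block_op H I I x) y = (\<Sum>\<^sub>\<infinity>j\<in>I. \<Sum>\<^sub>\<infinity>i\<in>I. H i j * x j * y i)"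
    unfolding ell2_inner_block_op[OF y] by (rule infsum_swap_banach[OF hs_double_sum_summable[OF H x y]])
  also have "\<dots> = ell2_inner (block_op H I I y) x"
    unfolding ell2_inner_block_op[OF x] by (simp add: sym[of _ "_::nat"] mult.assoc mult.commute mult.left_commute)
  finally show "ell2_inner (block_op H I I x) y = ell2_inner x (block_op H I I y)"
    by (simp add: ell2_inner_commute)
qed (rule hs_le_nonneg[OF H])

text \<open>The matrix of the reduced form has this shape, with $b = \beta^*$ and $H = 2pp^T + C$.\<close>

definition plus_diag :: "real \<Rightarrow> (nat \<Rightarrow> nat \<Rightarrow> real) \<Rightarrow> nat \<Rightarrow> nat \<Rightarrow> real" where
  "plus_diag b H i j = (if i = j then b else 0) + H i j"

lemma block_op_plus_diag:
  assumes H: "hs_le H I I S" and x: "x \<in> ell2 I"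
  shows "block_op (plus_diag b H) I I x = (\<lambda>i. b * x i + block_op H I I x i)"
proof
  fix i
  show "block_op (plus_diag b H) I I x i = b * x i + block_op H I I x i"
  proof (cases "i \<in> I")
    case True
    have single: "(\<lambda>j. if i = j then b * x j else 0) summable_on I" "(\<Sum>\<^sub>\<infinity>j\<in>I. if i = j then b * x j else 0) = b * x i"
    proof -
      have "((\<lambda>j. if i = j then b * x j else 0) has_sum b * x i) {i}" by (simp add: has_sum_finiteI)
      then have "((\<lambda>j. if i = j then b * x j else 0) has_sum b * x i) I"
        by (rule has_sum_cong_neutral[THEN iffD1, rotated -1]) (use True in auto)
      then show "(\<lambda>j. if i = j then b * x j else 0) summable_on I" "(\<Sum>\<^sub>\<infinity>j\<in>I. if i = j then b * x j else 0) = b * x i"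
        by (auto simp: summable_on_def infsumI)
    qed
    have "plus_diag b H i j * x j = (if i = j then b * x j else 0) + H i j * x j" for j
      by (simp add: plus_diag_def algebra_simps)
    then have "block_op (plus_diag b H) I I x i = (\<Sum>\<^sub>\<infinity>j\<in>I. (if i = j then b * x j else 0) + H i j * x j)"
      using True by (simp add: block_op_def)
    also have "\<dots> = b * x i + (\<Sum>\<^sub>\<infinity>j\<in>I. H i j * x j)"
      using infsum_add[OF single(1) hs_summable[OF H True x]] single(2) by simp
    finally show ?thesis using True by (simp add: block_op_def)
  qed (use x in \<open>simp add: block_op_def ell2_def\<close>)
qed

lemma plus_diag_symmetric:
  assumes H: "hs_le H I I S" and sym: "\<And>i j. H i j = H j i"
  shows "ell2_symmetric I (block_op (plus_diag b H) I I) (S + \<bar>b\<bar>)"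
proof -
  let ?A = "\<lambda>x i. block_op H I I x i - (- b) * x i"
  interpret ell2_symmetric I ?A "S + \<bar>- b\<bar>"
    by (rule ell2_symmetric.shifted[OF hs_block_op_symmetric[OF H sym]])
  have eq: "block_op (plus_diag b H) I I x = ?A x" if "x \<in> ell2 I" for x
    unfolding block_op_plus_diag[OF H that] by (simp add: add.commute)
  show ?thesis
  proof
    fix x assume x: "x \<in> ell2 I"
    note eqs = eq[OF x] eq[OF ell2_scale[OF x]]
    show "block_op (plus_diag b H) I I x \<in> ell2 I" unfolding eqs by (rule closed[OF x])
    show "block_op (plus_diag b H) I I (\<lambda>i. c * x i) = (\<lambda>i. c * block_op (plus_diag b H) I I x i)" for c
      by (rule block_op_scale)
    show "ell2_norm (block_op (plus_diag b H) I I x) \<le> (S + \<bar>b\<bar>) * ell2_norm x"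
      unfolding eqs using bounded[OF x] by simp
    fix y assume y: "y \<in> ell2 I"
    show "block_op (plus_diag b H) I I (\<lambda>i. x i - y i)
        = (\<lambda>i. block_op (plus_diag b H) I I x i - block_op (plus_diag b H) I I y i)"
      unfolding eq[OF ell2_diff[OF x y]] eqs eq[OF y] by (rule diff[OF x y])
    show "ell2_inner (block_op (plus_diag b H) I I x) y = ell2_inner x (block_op (plus_diag b H) I I y)"
      unfolding eqs eq[OF y] by (rule sym[OF x y])
  qed (use Lam_nonneg in simp)
qed

text \<open>The infimum of the spectrum is the best constant in a lower bound for the form.\<close>

lemma block_spec_plus_diag:
  assumes H: "hs_le H I I S" and sym: "\<And>i j. H i j = H j i" and I: "I \<noteq> {}"
  shows "x \<in> ell2 I \<Longrightarrow> Inf (block_spec (plus_diag b H) I) * (ell2_norm x)\<^sup>2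
           \<le> ell2_inner x (block_op (plus_diag b H) I I x)"
    and "(\<And>x. x \<in> ell2 I \<Longrightarrow> l * (ell2_norm x)\<^sup>2 \<le> ell2_inner x (block_op (plus_diag b H) I I x))
           \<Longrightarrow> l \<le> Inf (block_spec (plus_diag b H) I)"
proof -
  interpret ell2_symmetric I "block_op (plus_diag b H) I I" "S + \<bar>b\<bar>"
    by (rule plus_diag_symmetric[OF H sym])
  have "block_spec (plus_diag b H) I = {\<mu>. \<not> invertible_at \<mu>}"
    unfolding block_spec_def invertible_at_def ..
  then have eq: "Inf (block_spec (plus_diag b H) I) = lower_bound"
    using Inf_not_invertible_eq_lower_bound[OF I] by simp
  show "x \<in> ell2 I \<Longrightarrow> Inf (block_spec (plus_diag b H) I) * (ell2_norm x)\<^sup>2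
           \<le> ell2_inner x (block_op (plus_diag b H) I I x)"
    unfolding eq by (rule form_ge_lower_bound)
  show "(\<And>x. x \<in> ell2 I \<Longrightarrow> l * (ell2_norm x)\<^sup>2 \<le> ell2_inner x (block_op (plus_diag b H) I I x))
           \<Longrightarrow> l \<le> Inf (block_spec (plus_diag b H) I)"
    unfolding eq by (rule lower_bound_ge[OF I])
qed

lemma hs_le_finite:
  assumes "finite I" "finite J"
  shows "hs_le H I J (sqrt (\<Sum>i\<in>I. \<Sum>j\<in>J. (H i j)\<^sup>2))"
  unfolding hs_le_def
proof (intro conjI allI impI)
  fix A B assume "finite (A :: nat set)" "finite (B :: nat set)" "A \<subseteq> I" "B \<subseteq> J"
  then have "(\<Sum>(i, j)\<in>A \<times> B. (H i j)\<^sup>2) \<le> (\<Sum>(i, j)\<in>I \<times> J. (H i j)\<^sup>2)"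
    using assms by (intro sum_mono2) auto
  then show "(\<Sum>i\<in>A. \<Sum>j\<in>B. (H i j)\<^sup>2) \<le> (sqrt (\<Sum>i\<in>I. \<Sum>j\<in>J. (H i j)\<^sup>2))\<^sup>2"
    by (simp add: sum.cartesian_product sum_nonneg case_prod_beta')
qed (simp add: sum_nonneg)

text \<open>For a finite leading block the spectrum consists of the eigenvalues of the matrix, so the least
  eigenvalue bounds the quadratic form from below.\<close>

lemma least_eigenvalue_le_form:
  assumes N: "0 < N" and sym: "\<And>i j. M i j = M j i" and x: "x \<in> ell2 {..<N}"
  shows "least_eigenvalue (Matrix.mat N N (\<lambda>(i, j). M i j)) * (ell2_norm x)\<^sup>2
    \<le> ell2_inner x (block_op M {..<N} {..<N} x)"
proof -
  define A where "A = Matrix.mat N N (\<lambda>(i, j). M i j)"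
  have A: "A \<in> carrier_mat N N" by (simp add: A_def)
  interpret ell2_symmetric "{..<N}" "block_op M {..<N} {..<N}" "sqrt (\<Sum>i<N. \<Sum>j<N. (M i j)\<^sup>2)"
    by (rule hs_block_op_symmetric[OF hs_le_finite sym]) auto
  have "eigenvalue A lower_bound"
  proof (rule ccontr)
    assume "\<not> eigenvalue A lower_bound"
    then have "det (char_matrix A lower_bound) \<noteq> 0" by (simp add: eigenvalue_det[OF A])
    define G where "G = char_matrix A lower_bound"
    have G: "G \<in> carrier_mat N N" using A by (simp add: G_def)
    obtain B where B: "B \<in> carrier_mat N N" "B * G = 1\<^sub>m N" "G * B = 1\<^sub>m N"
      using det_non_zero_imp_unit[OF G, of "()"] \<open>det (char_matrix A lower_bound) \<noteq> 0\<close>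
      by (auto simp: G_def Units_def ring_mat_def)
    have Gij: "G $$ (i, j) = M i j - (if i = j then lower_bound else 0)" if "i < N" "j < N" for i j
      using that by (simp add: G_def char_matrix_def A_def)
    have BG: "(\<Sum>j<N. B $$ (i, j) * G $$ (j, k)) = (if i = k then 1 else 0)" if "i < N" "k < N" for i k
    proof -
      have "(B * G) $$ (i, k) = (\<Sum>j<N. B $$ (i, j) * G $$ (j, k))"
        using that B(1) G by (auto simp: scalar_prod_def lessThan_atLeast0 intro!: sum.cong)
      then show ?thesis using that by (simp add: B(2))
    qed
    have GB: "(\<Sum>j<N. G $$ (i, j) * B $$ (j, k)) = (if i = k then 1 else 0)" if "i < N" "k < N" for i k
    proof -
      have "(G * B) $$ (i, k) = (\<Sum>j<N. G $$ (i, j) * B $$ (j, k))"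
        using that B(1) G by (auto simp: scalar_prod_def lessThan_atLeast0 intro!: sum.cong)
      then show ?thesis using that by (simp add: B(3))
    qed
    define S where "S = block_op (\<lambda>i j. B $$ (i, j)) {..<N} {..<N}"
    have S: "S y i = (if i < N then (\<Sum>j<N. B $$ (i, j) * y j) else 0)" for y i
      by (simp add: S_def block_op_def)
    have Gop: "(\<lambda>i. block_op M {..<N} {..<N} x i - lower_bound * x i)
        = (\<lambda>i. if i < N then (\<Sum>j<N. G $$ (i, j) * x j) else 0)" if "x \<in> ell2 {..<N}" for x
    proof
      fix i
      show "block_op M {..<N} {..<N} x i - lower_bound * x i = (if i < N then (\<Sum>j<N. G $$ (i, j) * x j) else 0)"
      proof (cases "i < N")
        case True
        have "(\<Sum>j<N. G $$ (i, j) * x j) = (\<Sum>j<N. M i j * x j - (if i = j then lower_bound * x j else 0))"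
          using True by (intro sum.cong) (auto simp: Gij algebra_simps)
        then show ?thesis using True by (simp add: block_op_def sum_subtractf)
      qed (use that in \<open>simp add: block_op_def ell2_def\<close>)
    qed
    have comp: "(\<Sum>j<N. P i j * (\<Sum>k<N. Q j k * y k)) = y i"
      if "i < N" "\<And>k. k < N \<Longrightarrow> (\<Sum>j<N. P i j * Q j k) = (if i = k then 1 else 0)" for P Q :: "nat \<Rightarrow> nat \<Rightarrow> real" and y i
    proof -
      have "(\<Sum>j<N. P i j * (\<Sum>k<N. Q j k * y k)) = (\<Sum>k<N. (\<Sum>j<N. P i j * Q j k) * y k)"
        unfolding sum_distrib_left sum_distrib_right by (subst sum.swap) (simp add: mult.assoc)
      also have "\<dots> = (\<Sum>k<N. if i = k then y k else 0)" using that(2) by (intro sum.cong) auto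
      finally show ?thesis using that(1) by simp
    qed
    have "invertible_at lower_bound"
      unfolding invertible_at_def
    proof (intro exI[of _ S] conjI ballI)
      fix y assume y: "y \<in> ell2 {..<N}"
      show "S y \<in> ell2 {..<N}" unfolding S_def by (rule hs_block_op(1)[OF hs_le_finite y]) auto
      show "S (\<lambda>i. block_op M {..<N} {..<N} y i - lower_bound * y i) = y"
        unfolding Gop[OF y] using comp[of _ "\<lambda>i j. B $$ (i, j)" "\<lambda>i j. G $$ (i, j)" y] BG y
        by (auto simp: S fun_eq_iff ell2_def)
      show "(\<lambda>i. block_op M {..<N} {..<N} (S y) i - lower_bound * S y i) = y"
        unfolding Gop[OF \<open>S y \<in> ell2 {..<N}\<close>] using comp[of _ "\<lambda>i j. G $$ (i, j)" "\<lambda>i j. B $$ (i, j)" y] GB y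
        by (auto simp: S fun_eq_iff ell2_def)
    next
      show "\<exists>c. \<forall>y\<in>ell2 {..<N}. ell2_norm (S y) \<le> c * ell2_norm y"
        unfolding S_def using hs_block_op(2)[OF hs_le_finite[of "{..<N}" "{..<N}"]] by blast
    qed
    then show False using not_invertible_at_lower_bound N by (auto simp: lessThan_empty_iff)
  qed
  moreover have "finite {k. eigenvalue A k}"
  proof -
    have "char_poly A \<noteq> 0" using degree_monic_char_poly[OF A] by auto
    then show ?thesis by (simp add: eigenvalue_root_char_poly[OF A] poly_roots_finite)
  qed
  ultimately have "least_eigenvalue A \<le> lower_bound"
    unfolding least_eigenvalue_def by (intro Min_le) auto
  then have "least_eigenvalue A * (ell2_norm x)\<^sup>2 \<le> lower_bound * (ell2_norm x)\<^sup>2" by (intro mult_right_mono) auto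
  also have "\<dots> \<le> ell2_inner x (block_op M {..<N} {..<N} x)" by (rule form_ge_lower_bound[OF x])
  finally show ?thesis by (simp add: A_def)
qed

lemma block_op_off_diag:
  assumes "I \<inter> J = {}"
  shows "block_op (plus_diag b H) I J x = block_op H I J x"
proof
  fix i
  have "(\<Sum>\<^sub>\<infinity>j\<in>J. plus_diag b H i j * x j) = (\<Sum>\<^sub>\<infinity>j\<in>J. H i j * x j)" if "i \<in> I"
    using assms that by (intro infsum_cong) (auto simp: plus_diag_def)
  then show "block_op (plus_diag b H) I J x i = block_op H I J x i" by (simp add: block_op_def)
qed

lemma block_norm_bounds:
  assumes H: "hs_le H I J S" and disj: "I \<inter> J = {}"
  shows "block_norm (plus_diag b H) I J \<le> S" "0 \<le> block_norm (plus_diag b H) I J"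
    and "x \<in> ell2 J \<Longrightarrow> ell2_norm (block_op (plus_diag b H) I J x) \<le> block_norm (plus_diag b H) I J * ell2_norm x"
proof -
  let ?M = "plus_diag b H"
  note eq = block_op_off_diag[OF disj, of b H]
  let ?X = "{x \<in> ell2 J. ell2_norm x \<le> 1}"
  have le: "ell2_norm (block_op ?M I J x) \<le> S" if "x \<in> ?X" for x
  proof -
    have "ell2_norm (block_op ?M I J x) \<le> S * ell2_norm x"
      unfolding eq using that by (intro hs_block_op(2)[OF H]) auto
    also have "\<dots> \<le> S * 1" using that hs_le_nonneg[OF H] by (intro mult_left_mono) auto
    finally show ?thesis by simp
  qed
  have zero: "(\<lambda>i. 0) \<in> ?X" by (simp add: ell2_zero ell2_norm_def)
  have bdd: "bdd_above ((\<lambda>x. ell2_norm (block_op ?M I J x)) ` ?X)"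
    using le by (intro bdd_aboveI[of _ S]) auto
  show "block_norm ?M I J \<le> S"
    unfolding block_norm_def using zero le by (intro cSUP_least) blast+
  have upper: "ell2_norm (block_op ?M I J x) \<le> block_norm ?M I J" if "x \<in> ?X" for x
    unfolding block_norm_def by (rule cSUP_upper[OF that bdd])
  then show nn: "0 \<le> block_norm ?M I J" using order_trans[OF ell2_norm_nonneg upper[OF zero]] by simp
  assume x: "x \<in> ell2 J"
  show "ell2_norm (block_op ?M I J x) \<le> block_norm ?M I J * ell2_norm x"
  proof (cases "ell2_norm x = 0")
    case True
    then show ?thesis using hs_block_op(2)[OF H x] by (simp add: eq)
  next
    case False
    define c where "c = 1 / ell2_norm x"
    have c: "0 < c" using False ell2_norm_nonneg[of x] unfolding c_def by (simp add: less_le)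
    have "ell2_norm (\<lambda>i. c * x i) = 1" unfolding ell2_norm_scale using False c by (simp add: c_def)
    then have "(\<lambda>i. c * x i) \<in> ?X" using ell2_scale[OF x] by simp
    from upper[OF this] have "c * ell2_norm (block_op ?M I J x) \<le> block_norm ?M I J"
      unfolding block_op_scale ell2_norm_scale using c by simp
    then show ?thesis using False c by (simp add: c_def field_simps)
  qed
qed

lemma finite_form_block_op:
  assumes "finite A" "finite B" "A \<subseteq> I" "B \<subseteq> J" "\<And>i. i \<notin> A \<Longrightarrow> y i = 0" "\<And>j. j \<notin> B \<Longrightarrow> x j = 0"
  shows "ell2_inner y (block_op M I J x) = (\<Sum>i\<in>A. \<Sum>j\<in>B. M i j * y i * x j)"
proof -
  have "block_op M I J x i = (\<Sum>j\<in>B. M i j * x j)" if "i \<in> A" for i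
  proof -
    have "(\<Sum>\<^sub>\<infinity>j\<in>J. M i j * x j) = (\<Sum>\<^sub>\<infinity>j\<in>B. M i j * x j)"
      using assms by (intro infsum_cong_neutral) auto
    then show ?thesis using that assms by (auto simp: block_op_def)
  qed
  then have "ell2_inner y (block_op M I J x) = (\<Sum>i\<in>A. y i * (\<Sum>j\<in>B. M i j * x j))"
    using ell2_finite_support(2)[OF assms(1) subset_UNIV assms(5)] by simp
  then show ?thesis by (simp add: sum_distrib_left ac_simps)
qed

lemma two_by_two_bound:
  fixes u v :: real
  assumes "0 \<le> e"
  shows "(min a d - e) * (u\<^sup>2 + v\<^sup>2) \<le> a * u\<^sup>2 + d * v\<^sup>2 - 2 * (e * (u * v))"
proof -
  have "min a d * u\<^sup>2 \<le> a * u\<^sup>2" "min a d * v\<^sup>2 \<le> d * v\<^sup>2" by (auto intro: mult_right_mono)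
  moreover have "e * (2 * u * v) \<le> e * (u\<^sup>2 + v\<^sup>2)"
    using sum_squares_bound[of u v] assms by (intro mult_left_mono) auto
  ultimately show ?thesis by (simp add: algebra_simps)
qed

text \<open>For vectors with finitely many entries the double sum splits into the four blocks by finite
  additivity; general vectors are reached by a limit in \<open>n\<close>.\<close>

lemma block_form_ge:
  assumes H: "hs_le H UNIV UNIV S" and sym: "\<And>i j. H i j = H j i" and N: "0 < N" "N \<le> n"
    and l0: "l0 \<le> least_eigenvalue (Matrix.mat N N (\<lambda>(i, j). plus_diag b H i j))"
    and d: "d \<le> Inf (block_spec (plus_diag b H) {N..})"
  shows "(min l0 d - block_norm (plus_diag b H) {..<N} {N..}) * (\<Sum>i<n. (x i)\<^sup>2)
    \<le> (\<Sum>i<n. \<Sum>j<n. plus_diag b H i j * x i * x j)"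
proof -
  let ?M = "plus_diag b H"
  define u where "u i = (if i < N then x i else 0)" for i
  define v where "v i = (if N \<le> i \<and> i < n then x i else 0)" for i
  define e where "e = block_norm ?M {..<N} {N..}"
  have hD: "hs_le H {N..} {N..} S" and hB: "hs_le H {..<N} {N..} S" by (auto intro: hs_le_subset[OF H])
  have Msym: "?M i j = ?M j i" for i j using sym by (simp add: plus_diag_def)
  have u: "u \<in> ell2 {..<N}" by (rule ell2_finite_support(1)[of "{..<N}"]) (auto simp: u_def)
  have v: "v \<in> ell2 {N..}" by (rule ell2_finite_support(1)[of "{N..<n}"]) (auto simp: v_def)
  have nu: "(ell2_norm u)\<^sup>2 = (\<Sum>i<N. (x i)\<^sup>2)"
    unfolding ell2_norm_sq by (subst ell2_finite_support(2)[of "{..<N}" "{..<N}"]) (auto simp: u_def power2_eq_square)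
  have nv: "(ell2_norm v)\<^sup>2 = (\<Sum>i=N..<n. (x i)\<^sup>2)"
    unfolding ell2_norm_sq by (subst ell2_finite_support(2)[of "{N..<n}" "{N..}"]) (auto simp: v_def power2_eq_square)
  have e: "0 \<le> e" unfolding e_def by (rule block_norm_bounds(2)[OF hB]) auto
  have a_part: "l0 * (ell2_norm u)\<^sup>2 \<le> (\<Sum>i<N. \<Sum>j<N. ?M i j * x i * x j)"
  proof -
    have "l0 * (ell2_norm u)\<^sup>2 \<le> ell2_inner u (block_op ?M {..<N} {..<N} u)"
      using least_eigenvalue_le_form[of N ?M u, OF N(1) Msym u] mult_right_mono[OF l0, of "(ell2_norm u)\<^sup>2"] by simp
    also have "\<dots> = (\<Sum>i<N. \<Sum>j<N. ?M i j * u i * u j)"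
      by (rule finite_form_block_op) (auto simp: u_def)
    finally show ?thesis by (simp add: u_def)
  qed
  have d_part: "d * (ell2_norm v)\<^sup>2 \<le> (\<Sum>i=N..<n. \<Sum>j=N..<n. ?M i j * x i * x j)"
  proof -
    have "{N..} \<noteq> ({} :: nat set)" by auto
    from block_spec_plus_diag(1)[OF hD sym this v, of b]
    have "d * (ell2_norm v)\<^sup>2 \<le> ell2_inner v (block_op ?M {N..} {N..} v)"
      using mult_right_mono[OF d, of "(ell2_norm v)\<^sup>2"] by simp
    also have "\<dots> = (\<Sum>i=N..<n. \<Sum>j=N..<n. ?M i j * v i * v j)"
      by (rule finite_form_block_op) (auto simp: v_def)
    finally show ?thesis by (simp add: v_def)
  qed
  have b_part: "- (e * (ell2_norm u * ell2_norm v)) \<le> (\<Sum>i<N. \<Sum>j=N..<n. ?M i j * x i * x j)"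
  proof -
    have "(\<Sum>i<N. \<Sum>j=N..<n. ?M i j * x i * x j) = (\<Sum>i<N. \<Sum>j=N..<n. ?M i j * u i * v j)"
      by (simp add: u_def v_def)
    also have "\<dots> = ell2_inner u (block_op ?M {..<N} {N..} v)"
      by (rule finite_form_block_op[symmetric]) (auto simp: u_def v_def)
    finally have eq: "(\<Sum>i<N. \<Sum>j=N..<n. ?M i j * x i * x j) = ell2_inner u (block_op ?M {..<N} {N..} v)" .
    have "block_op ?M {..<N} {N..} v = block_op H {..<N} {N..} v"
      by (rule block_op_off_diag) auto
    then have mem: "block_op ?M {..<N} {N..} v \<in> ell2 {..<N}" using hs_block_op(1)[OF hB v] by simp
    have "\<bar>ell2_inner u (block_op ?M {..<N} {N..} v)\<bar> \<le> ell2_norm u * ell2_norm (block_op ?M {..<N} {N..} v)"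
      by (rule ell2_cauchy_schwarz[OF u mem])
    also have "\<dots> \<le> ell2_norm u * (e * ell2_norm v)"
      unfolding e_def by (intro mult_left_mono block_norm_bounds(3)[OF hB _ v]) auto
    finally show ?thesis unfolding eq by (simp add: algebra_simps)
  qed
  have split: "{..<n} = {..<N} \<union> {N..<n}" "{..<N} \<inter> {N..<n} = {}" using N by auto
  have sum_split: "(\<Sum>i<n. f i) = (\<Sum>i<N. f i) + (\<Sum>i=N..<n. f i)" for f :: "nat \<Rightarrow> real"
    unfolding split(1) by (rule sum.union_disjoint) (use split(2) in auto)
  have swap: "(\<Sum>i=N..<n. \<Sum>j<N. ?M i j * x i * x j) = (\<Sum>i<N. \<Sum>j=N..<n. ?M i j * x i * x j)"
    by (subst sum.swap) (simp add: Msym[of _ "_::nat"] ac_simps)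
  have "(\<Sum>i<n. \<Sum>j<n. ?M i j * x i * x j) = (\<Sum>i<N. \<Sum>j<N. ?M i j * x i * x j)
      + 2 * (\<Sum>i<N. \<Sum>j=N..<n. ?M i j * x i * x j) + (\<Sum>i=N..<n. \<Sum>j=N..<n. ?M i j * x i * x j)"
    unfolding sum_split sum.distrib swap by simp
  moreover have "(min l0 d - e) * ((ell2_norm u)\<^sup>2 + (ell2_norm v)\<^sup>2)
      \<le> l0 * (ell2_norm u)\<^sup>2 + d * (ell2_norm v)\<^sup>2 - 2 * (e * (ell2_norm u * ell2_norm v))"
    by (rule two_by_two_bound[OF e])
  ultimately have "(min l0 d - e) * ((ell2_norm u)\<^sup>2 + (ell2_norm v)\<^sup>2) \<le> (\<Sum>i<n. \<Sum>j<n. ?M i j * x i * x j)"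
    using a_part b_part d_part by linarith
  then show ?thesis unfolding e_def nu nv sum_split .
qed

section \<open>Decay of the matrix entries\<close>

text \<open>The derivatives of $\cos(s\,\cdot)$ are shifts of it by multiples of $\pi/2$.\<close>

lemma legendre_cos_bound:
  assumes "0 \<le> s"
  shows "\<bar>LBINT y:{-1..1}. poly (legendre_poly n) y * cos (s * y)\<bar> \<le> 2 * s ^ n / odd_dfact n"
proof -
  define G where "G k y = s ^ k * cos (s * y + real k * (pi / 2))" for k y
  have "DERIV (G k) y :> G (Suc k) y" for k y
  proof -
    have *: "s * y + real (Suc k) * (pi / 2) = (s * y + real k * (pi / 2)) + pi / 2" by (simp add: algebra_simps)
    have "cos (z + pi / 2) = - sin z" for z :: real by (simp add: cos_add)
    then have "G (Suc k) y = s ^ k * (- sin (s * y + real k * (pi / 2)) * s)"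
      unfolding G_def * by simp
    then show ?thesis unfolding G_def by (auto intro!: derivative_eq_intros)
  qed
  moreover have "\<bar>G n y\<bar> \<le> s ^ n" for y
    using assms by (simp add: G_def abs_mult mult_left_le)
  ultimately have "\<bar>LBINT y:{-1..1}. poly (legendre_poly n) y * G 0 y\<bar> \<le> 2 * s ^ n / odd_dfact n"
    by (intro legendre_transform_bound[of G]) auto
  then show ?thesis by (simp add: G_def)
qed

lemma legendre_cosh_bound:
  assumes "0 \<le> a" "even n"
  shows "\<bar>LBINT y:{-1..1}. poly (legendre_poly n) y * cosh (a * y)\<bar> \<le> 2 * (a ^ n * cosh a) / odd_dfact n"
proof -
  define G where "G k y = a ^ k * ((if even k then cosh else sinh) (a * y))" for k y
  have "DERIV (G k) y :> G (Suc k) y" for k y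
    unfolding G_def by (cases "even k") (auto intro!: derivative_eq_intros)
  moreover have "\<bar>G n y\<bar> \<le> a ^ n * cosh a" if "y \<in> {-1..1}" for y
  proof -
    have "\<bar>a * y\<bar> \<le> a" using that assms mult_left_le[of "\<bar>y\<bar>" a] by (simp add: abs_mult abs_le_iff)
    then have "cosh \<bar>a * y\<bar> \<le> cosh a" by (intro cosh_real_nonneg_le_iff[THEN iffD2]) (auto simp: assms)
    then have "cosh (a * y) \<le> cosh a" by (simp only: cosh_real_abs)
    then show ?thesis using assms by (simp add: G_def abs_mult mult_left_mono)
  qed
  ultimately have "\<bar>LBINT y:{-1..1}. poly (legendre_poly n) y * G 0 y\<bar> \<le> 2 * (a ^ n * cosh a) / odd_dfact n"
    by (intro legendre_transform_bound[of G]) auto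
  then show ?thesis by (simp add: G_def)
qed

lemma Re_fhat_legendre_decay:
  assumes L: "0 < L" and t: "0 \<le> t"
  shows "\<bar>Re (fhat (legendre_fun L n) (complex_of_real t))\<bar>
    \<le> 2 * sqrt (L * (real n + 1/2)) * ((t * L) ^ n / odd_dfact n)"
proof -
  have "\<bar>Re (fhat (legendre_fun L n) (complex_of_real t))\<bar>
      = sqrt (L * (real n + 1/2)) * \<bar>LBINT y:{-1..1}. poly (legendre_poly n) y * cos ((t * L) * y)\<bar>"
    unfolding Re_fhat_legendre[OF L] legendre_pairing[OF L] using L by (simp add: abs_mult mult.assoc)
  also have "\<dots> \<le> sqrt (L * (real n + 1/2)) * (2 * (t * L) ^ n / odd_dfact n)"
    using L t by (intro mult_left_mono legendre_cos_bound) auto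
  finally show ?thesis by (simp add: ac_simps)
qed

text \<open>The bound $|j_n| \le 1$: Bessel's inequality for $\cos(t\,\cdot)$ on $[-L,L]$ gives $2L$ for the
  square, which is at most $4L(n+\frac12)$.\<close>

lemma Re_fhat_legendre_le:
  assumes L: "0 < L" and n: "even n"
  shows "\<bar>Re (fhat (legendre_fun L n) (complex_of_real t))\<bar> \<le> 2 * sqrt (L * (real n + 1/2))"
proof -
  obtain i where i: "n = 2 * i" using n by (auto elim: evenE)
  let ?a = "Re (fhat (legendre_fun L n) (complex_of_real t))"
  have "?a = L2_inner (cutoff L (\<lambda>u. cos (t * u))) (legendre_fun L (2 * i))"
    unfolding Re_fhat_legendre[OF L] i by (subst L2_inner_commute[of "cutoff _ _"]) (simp add: L2_inner_legendre_cutoff)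
  then have "?a\<^sup>2 \<le> L2_normsq (cutoff L (\<lambda>u. cos (t * u)))"
    using bessel[OF L cutoff_cos_even_L2, of "{i}" t] by simp
  also have "\<dots> \<le> 2 * L" by (rule L2_normsq_cutoff_cos_le[OF L])
  also have "\<dots> \<le> (2 * sqrt (L * (real n + 1/2)))\<^sup>2"
    using L by (simp add: power_mult_distrib algebra_simps)
  finally have "\<bar>?a\<bar>\<^sup>2 \<le> (2 * sqrt (L * (real n + 1/2)))\<^sup>2" by simp
  then show ?thesis by (rule power2_le_imp_le) (use L in simp)
qed

lemma C_mat_commute: "C_mat L T n m = C_mat L T m n"
  unfolding C_mat_def by (simp add: mult.assoc mult.left_commute mult.commute)

lemma K_const_nonneg: "0 < L \<Longrightarrow> 0 \<le> K_const L T"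
  unfolding K_const_def set_lebesgue_integral_def by (intro mult_nonneg_nonneg integral_nonneg) auto

text \<open>One of the two transforms, that of order \<open>k\<close>, is estimated by its decay, the other one by Bessel.\<close>

lemma C_mat_bound:
  assumes L: "0 < L" and T: "0 < T" and nm: "even n" "even m" and k: "k = n \<or> k = m"
  shows "\<bar>C_mat L T n m\<bar> \<le> K_const L T * sqrt ((real n + 1/2) * (real m + 1/2)) * (T * L) ^ k / odd_dfact k"
proof -
  let ?a = "\<lambda>n t. Re (fhat (legendre_fun L n) (complex_of_real t))"
  define w where "w t = indicator {0..T} t * (weil_symbol L t - beta_star L T)" for t
  define c where "c = 4 * L * sqrt ((real n + 1/2) * (real m + 1/2)) * ((T * L) ^ k / odd_dfact k)"
  have wi: "integrable lborel w"
    using integrable_on_interval[of 0 T "\<lambda>t. weil_symbol L t - beta_star L T"]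
    by (simp add: w_def[abs_def] set_integrable_def continuous_intros continuous_weil_symbol)
  have am: "(\<lambda>t. ?a j t) \<in> borel_measurable borel" for j
    using cos_transform_measurable[OF sqint_measurable[OF sqint_legendre_fun[OF L]], of j]
    by (simp add: Re_fhat_legendre[OF L] L2_inner_def cos_transform_def[abs_def])
  have prod: "\<bar>?a n t * ?a m t\<bar> \<le> c" if t: "t \<in> {0..T}" for t
  proof -
    have mono: "(t * L) ^ k / odd_dfact k \<le> (T * L) ^ k / odd_dfact k"
      using t L odd_dfact_pos[of k] by (intro divide_right_mono power_mono mult_right_mono) auto
    have dec: "\<bar>?a k t\<bar> \<le> 2 * sqrt (L * (real k + 1/2)) * ((T * L) ^ k / odd_dfact k)"
      using order_trans[OF Re_fhat_legendre_decay[OF L, of t k] mult_left_mono[OF mono]] t L by simp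
    have one: "\<bar>?a j t\<bar> \<le> 2 * sqrt (L * (real j + 1/2))" if "even j" for j
      using Re_fhat_legendre_le[OF L that] .
    have pos: "0 \<le> (T * L) ^ k / odd_dfact k" using T L odd_dfact_pos[of k] by simp
    have s: "sqrt (L * (real n + 1/2)) * sqrt (L * (real m + 1/2)) = L * sqrt ((real n + 1/2) * (real m + 1/2))"
      using L by (simp add: real_sqrt_mult)
    from k show ?thesis
    proof
      assume "k = n"
      then have "\<bar>?a n t\<bar> * \<bar>?a m t\<bar>
          \<le> (2 * sqrt (L * (real n + 1/2)) * ((T * L) ^ k / odd_dfact k)) * (2 * sqrt (L * (real m + 1/2)))"
        using dec one[OF nm(2)] pos L by (intro mult_mono) auto
      also have "\<dots> = 4 * (sqrt (L * (real n + 1/2)) * sqrt (L * (real m + 1/2))) * ((T * L) ^ k / odd_dfact k)"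
        by (simp add: ac_simps)
      finally show ?thesis unfolding s by (simp add: c_def abs_mult mult.assoc)
    next
      assume "k = m"
      then have "\<bar>?a n t\<bar> * \<bar>?a m t\<bar>
          \<le> (2 * sqrt (L * (real n + 1/2))) * (2 * sqrt (L * (real m + 1/2)) * ((T * L) ^ k / odd_dfact k))"
        using dec one[OF nm(1)] pos L by (intro mult_mono) auto
      also have "\<dots> = 4 * (sqrt (L * (real n + 1/2)) * sqrt (L * (real m + 1/2))) * ((T * L) ^ k / odd_dfact k)"
        by (simp add: ac_simps)
      finally show ?thesis unfolding s by (simp add: c_def abs_mult mult.assoc)
    qed
  qed
  have pt: "\<bar>w t * (?a n t * ?a m t)\<bar> \<le> \<bar>w t\<bar> * c" for t
    using prod[of t] by (auto simp: w_def abs_mult indicator_def intro: mult_left_mono)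
  have cint: "integrable lborel (\<lambda>t. \<bar>w t\<bar> * c)" using wi by auto
  have "\<bar>C_mat L T n m\<bar> = 1 / pi * \<bar>LBINT t. w t * (?a n t * ?a m t)\<bar>"
    unfolding C_mat_def set_lebesgue_integral_def w_def by (simp add: abs_mult mult.assoc)
  also have "\<dots> \<le> 1 / pi * (LBINT t. \<bar>w t * (?a n t * ?a m t)\<bar>)"
    by (intro mult_left_mono integral_abs_bound) auto
  also have "\<dots> \<le> 1 / pi * (LBINT t. \<bar>w t\<bar> * c)"
  proof (intro mult_left_mono integral_mono cint pt)
    show "integrable lborel (\<lambda>t. \<bar>w t * (?a n t * ?a m t)\<bar>)"
    proof (rule Bochner_Integration.integrable_bound[OF cint])
      show "AE t in lborel. norm \<bar>w t * (?a n t * ?a m t)\<bar> \<le> norm (\<bar>w t\<bar> * c)"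
        using pt by (intro AE_I2) (force intro: order_trans[OF _ abs_ge_self])
    qed (use wi am in auto)
  qed simp
  also have "\<dots> = 1 / pi * (LBINT t. \<bar>w t\<bar>) * c" by simp
  also have "(LBINT t. \<bar>w t\<bar>) = (LBINT t:{0..T}. \<bar>weil_symbol L t - beta_star L T\<bar>)"
    unfolding set_lebesgue_integral_def w_def by (simp add: abs_mult)
  finally show ?thesis by (simp add: K_const_def c_def ac_simps)
qed

lemma p_vec_bound:
  assumes L: "0 < L" and n: "even n"
  shows "\<bar>p_vec L n\<bar> \<le> 2 * sqrt (L * (real n + 1/2)) * cosh (L / 2) * ((L / 2) ^ n / odd_dfact n)"
proof -
  have "\<bar>p_vec L n\<bar> = sqrt (L * (real n + 1/2)) * \<bar>LBINT y:{-1..1}. poly (legendre_poly n) y * cosh ((L / 2) * y)\<bar>"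
    unfolding p_vec_eq legendre_pairing[OF L] using L by (simp add: abs_mult)
  also have "\<dots> \<le> sqrt (L * (real n + 1/2)) * (2 * ((L / 2) ^ n * cosh (L / 2)) / odd_dfact n)"
    using L n by (intro mult_left_mono legendre_cosh_bound) auto
  finally show ?thesis by (simp add: ac_simps)
qed

lemma L2_normsq_cutoff_cosh:
  assumes "0 < L"
  shows "L2_normsq (cutoff L (\<lambda>u. cosh (u / 2))) = L + sinh L"
proof -
  have d: "((\<lambda>u. (u + sinh u) / 2) has_real_derivative (1 + cosh u) / 2) (at u)" for u :: real
    by (auto intro!: derivative_eq_intros)
  have "(cosh (u / 2))\<^sup>2 = (1 + cosh u) / 2" for u :: real
    using cosh_double_cosh[of "u / 2"] by simp
  then have "L2_normsq (cutoff L (\<lambda>u. cosh (u / 2))) = (LBINT u. ((1 + cosh u) / 2) * indicator {-L..L} u)"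
    unfolding L2_normsq_def by (intro Bochner_Integration.integral_cong) (auto simp: cutoff_def)
  also have "\<dots> = (L + sinh L) / 2 - (- L + sinh (- L)) / 2"
    using assms d
    by (intro integral_FTC_Icc_real) (auto intro!: continuous_intros simp: has_real_derivative_iff_has_vector_derivative)
  also have "\<dots> = L + sinh L" by (simp add: field_simps)
  finally show ?thesis .
qed

section \<open>Tails of the matrix\<close>

text \<open>The quotient of consecutive terms is $x^2/((4j+3)(4j+5))$.\<close>

lemma power_odd_dfact_step:
  assumes "0 \<le> x" "x \<le> 2 * real j"
  shows "x ^ (2 * Suc j) / odd_dfact (2 * Suc j) \<le> 1/4 * (x ^ (2 * j) / odd_dfact (2 * j))"
proof -
  have "odd_dfact (2 * Suc j) = (4 * real j + 5) * ((4 * real j + 3) * odd_dfact (2 * j))"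
    using odd_dfact_Suc[of "Suc (2 * j)"] odd_dfact_Suc[of "2 * j"] by simp
  then have "x ^ (2 * Suc j) / odd_dfact (2 * Suc j)
      = (x\<^sup>2 / ((4 * real j + 5) * (4 * real j + 3))) * (x ^ (2 * j) / odd_dfact (2 * j))"
    by (simp add: power2_eq_square ac_simps)
  also have "\<dots> \<le> 1/4 * (x ^ (2 * j) / odd_dfact (2 * j))"
  proof (rule mult_right_mono)
    have "x\<^sup>2 \<le> (2 * real j)\<^sup>2" using assms by (intro power_mono) auto
    then have "4 * x\<^sup>2 \<le> (4 * real j + 5) * (4 * real j + 3)" by (simp add: power2_eq_square algebra_simps)
    then show "x\<^sup>2 / ((4 * real j + 5) * (4 * real j + 3)) \<le> 1/4"
      by (simp add: divide_le_eq add_pos_nonneg)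
    show "0 \<le> x ^ (2 * j) / odd_dfact (2 * j)" using odd_dfact_pos[of "2 * j"] assms by simp
  qed
  finally show ?thesis .
qed

lemma geometric_tail:
  fixes q :: "nat \<Rightarrow> real"
  assumes nn: "\<And>j. 0 \<le> q j" and step: "\<And>j. N \<le> j \<Longrightarrow> q (Suc j) \<le> 1/2 * q j"
    and A: "finite A" "A \<subseteq> {N..}"
  shows "sum q A \<le> 2 * q N"
proof -
  have *: "(\<Sum>j=N..<N + m. q j) + 2 * q (N + m) \<le> 2 * q N" for m
  proof (induction m)
    case (Suc m)
    then show ?case using step[of "N + m"] by simp
  qed simp
  obtain n where n: "\<forall>x\<in>A. x < n" using A(1) unfolding finite_nat_set_iff_bounded ..
  have "sum q A \<le> (\<Sum>j=N..<N + n. q j)"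
    using A n nn by (intro sum_mono2) force+
  also have "\<dots> \<le> 2 * q N" using *[of n] nn[of "N + n"] by linarith
  finally show ?thesis .
qed

text \<open>For $p \le 3$ the polynomial factor at most doubles $p$ times from one term to the next, that is, it
  grows by at most 8, while the square of the other factor shrinks by 16.\<close>

lemma power_odd_dfact_tail:
  assumes x: "0 \<le> x" "x \<le> 2 * real N" and N: "0 < N" and p: "p \<le> 3"
    and A: "finite A" "A \<subseteq> {N..}"
  shows "(\<Sum>j\<in>A. (2 * real j + 1) ^ p * (x ^ (2 * j) / odd_dfact (2 * j))\<^sup>2)
    \<le> 2 * ((2 * real N + 1) ^ p * (x ^ (2 * N) / odd_dfact (2 * N))\<^sup>2)"
proof (rule geometric_tail[OF _ _ A])
  fix j
  let ?r = "\<lambda>j. x ^ (2 * j) / odd_dfact (2 * j)"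
  assume j: "N \<le> j"
  have "(?r (Suc j))\<^sup>2 \<le> (1/4 * ?r j)\<^sup>2"
    using power_odd_dfact_step[of x j] x j odd_dfact_pos[of "2 * Suc j"]
    by (intro power_mono) (auto intro: divide_nonneg_pos)
  moreover have "(2 * real (Suc j) + 1) ^ p \<le> 8 * (2 * real j + 1) ^ p"
  proof -
    have "(2 * real (Suc j) + 1) ^ p \<le> (2 * (2 * real j + 1)) ^ p" using j N by (intro power_mono) auto
    also have "\<dots> \<le> 2 ^ 3 * (2 * real j + 1) ^ p"
      unfolding power_mult_distrib using p by (intro mult_right_mono power_increasing) auto
    finally show ?thesis by simp
  qed
  ultimately have "(2 * real (Suc j) + 1) ^ p * (?r (Suc j))\<^sup>2 \<le> (8 * (2 * real j + 1) ^ p) * (1/4 * ?r j)\<^sup>2"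
    by (intro mult_mono) auto
  also have "\<dots> = 1/2 * ((2 * real j + 1) ^ p * (?r j)\<^sup>2)" by (simp only: power_mult_distrib) (simp add: power2_eq_square)
  finally show "(2 * real (Suc j) + 1) ^ p * (?r (Suc j))\<^sup>2 \<le> 1/2 * ((2 * real j + 1) ^ p * (?r j)\<^sup>2)" .
qed simp

text \<open>The part of \<open>C\<close> with some order at least \<open>2 * N\<close>.  It agrees with \<open>C\<close> on the blocks \<open>B\<close> and
  \<open>D\<close>.\<close>

definition C_tail :: "real \<Rightarrow> real \<Rightarrow> nat \<Rightarrow> nat \<Rightarrow> nat \<Rightarrow> real" where
  "C_tail L T N i j = (if N \<le> max i j then C_mat L T (2 * i) (2 * j) else 0)"

lemma sum_half_le: "(\<Sum>i | i < n \<and> i \<le> j. 2 * real i + 1/2) \<le> (real j + 1) * (2 * real j + 1/2)"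
proof -
  have "(\<Sum>i | i < n \<and> i \<le> j. 2 * real i + 1/2) \<le> (\<Sum>i\<le>j. 2 * real i + 1/2)"
    by (intro sum_mono2) auto
  also have "\<dots> \<le> (\<Sum>i\<le>j. 2 * real j + 1/2)" by (intro sum_mono) auto
  finally show ?thesis by (simp add: algebra_simps)
qed

text \<open>In the square of an entry only the larger index \<open>j\<close> enters the decay, and the sum of $2i+\frac12$
  over the smaller one is at most $(j+1)(2j+\frac12)$.  Up to $K^2$, each of the two orders of the
  indices therefore contributes at most $\frac12(2j+1)^3$ times the square of
  $(TL)^{2j}/(4j+1)!!$, and the tail of this series is at most twice its first term.\<close>

lemma hs_le_C_tail:
  assumes L: "0 < L" and T: "0 < T" and N: "0 < N" "T * L \<le> 2 * real N"
  shows "hs_le (C_tail L T N) UNIV UNIV (eps_D_bound L T N)"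
  unfolding hs_le_def
proof (intro conjI allI impI)
  define K where "K = K_const L T"
  define r where "r j = (T * L) ^ (2 * j) / odd_dfact (2 * j)" for j
  define h where "h i j = (if i \<le> j \<and> N \<le> j then K\<^sup>2 * ((2 * real i + 1/2) * (2 * real j + 1/2)) * (r j)\<^sup>2 else 0)" for i j
  have K: "0 \<le> K" using K_const_nonneg[OF L] by (simp add: K_def)
  have r: "0 \<le> r j" for j using L T odd_dfact_pos[of "2 * j"] by (simp add: r_def)
  have hnn: "0 \<le> h i j" for i j by (simp add: h_def)
  have bound: "eps_D_bound L T N = 2 * K * (2 * real N + 1) powr (3/2) * r N"
    by (simp add: eps_D_bound_def K_def r_def)
  show "0 \<le> eps_D_bound L T N" unfolding bound using K r[of N] by simp
  have pw: "((2 * real N + 1) powr (3/2))\<^sup>2 = (2 * real N + 1) ^ 3"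
    by (simp add: powr_powr flip: powr_numeral)
  have entry: "(C_tail L T N i j)\<^sup>2 \<le> h i j + h j i" for i j
  proof -
    have sq: "(C_mat L T (2 * i) (2 * j))\<^sup>2 \<le> K\<^sup>2 * ((2 * real i + 1/2) * (2 * real j + 1/2)) * (r k)\<^sup>2"
      if "k = i \<or> k = j" for k
    proof -
      have "\<bar>C_mat L T (2 * i) (2 * j)\<bar> \<le> K * sqrt ((2 * real i + 1/2) * (2 * real j + 1/2)) * r k"
        using C_mat_bound[OF L T, of "2 * i" "2 * j" "2 * k"] that by (auto simp: K_def r_def)
      then have "\<bar>C_mat L T (2 * i) (2 * j)\<bar>\<^sup>2 \<le> (K * sqrt ((2 * real i + 1/2) * (2 * real j + 1/2)) * r k)\<^sup>2"
        by (intro power_mono) auto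
      then show ?thesis by (simp add: power_mult_distrib)
    qed
    show ?thesis
    proof (cases "N \<le> max i j")
      case True
      show ?thesis
      proof (cases "i \<le> j")
        case le: True
        then have "(C_tail L T N i j)\<^sup>2 \<le> h i j" using True sq[of j] by (simp add: C_tail_def h_def)
        then show ?thesis using hnn[of j i] by linarith
      next
        case False
        then have "(C_tail L T N i j)\<^sup>2 \<le> h j i" using True sq[of i] by (simp add: C_tail_def h_def mult.commute)
        then show ?thesis using hnn[of i j] by linarith
      qed
    qed (use hnn in \<open>simp add: C_tail_def add_nonneg_nonneg\<close>)
  qed
  fix A B assume AB: "finite (A :: nat set)" "finite (B :: nat set)"
  obtain n where n: "\<forall>x\<in>A \<union> B. x < n" using AB finite_nat_set_iff_bounded[of "A \<union> B"] by auto
  have "(\<Sum>i\<in>A. \<Sum>j\<in>B. (C_tail L T N i j)\<^sup>2) \<le> (\<Sum>i\<in>A. \<Sum>j<n. (C_tail L T N i j)\<^sup>2)"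
    using n by (intro sum_mono sum_mono2) auto
  also have "\<dots> \<le> (\<Sum>i<n. \<Sum>j<n. (C_tail L T N i j)\<^sup>2)"
    using n by (intro sum_mono2) (auto intro: sum_nonneg)
  also have "\<dots> \<le> (\<Sum>i<n. \<Sum>j<n. h i j + h j i)" by (intro sum_mono entry)
  also have "\<dots> = 2 * (\<Sum>j<n. \<Sum>i<n. h i j)"
    using sum.swap[of h "{..<n}" "{..<n}"] by (simp add: sum.distrib)
  also have "(\<Sum>j<n. \<Sum>i<n. h i j) \<le> (\<Sum>j<n. if N \<le> j then K\<^sup>2 * ((2 * real j + 1) ^ 3 * (r j)\<^sup>2) / 2 else 0)"
  proof (rule sum_mono)
    fix j
    show "(\<Sum>i<n. h i j) \<le> (if N \<le> j then K\<^sup>2 * ((2 * real j + 1) ^ 3 * (r j)\<^sup>2) / 2 else 0)"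
    proof (cases "N \<le> j")
      case True
      have "(\<Sum>i<n. h i j) = (\<Sum>i | i < n \<and> i \<le> j. K\<^sup>2 * ((2 * real i + 1/2) * (2 * real j + 1/2)) * (r j)\<^sup>2)"
        using True by (intro sum.mono_neutral_cong_right) (auto simp: h_def)
      also have "\<dots> = K\<^sup>2 * (r j)\<^sup>2 * ((\<Sum>i | i < n \<and> i \<le> j. 2 * real i + 1/2) * (2 * real j + 1/2))"
        by (simp add: sum_distrib_left sum_distrib_right ac_simps)
      also have "\<dots> \<le> K\<^sup>2 * (r j)\<^sup>2 * (((real j + 1) * (2 * real j + 1/2)) * (2 * real j + 1/2))"
        by (intro mult_left_mono mult_right_mono sum_half_le) auto
      also have "\<dots> \<le> K\<^sup>2 * (r j)\<^sup>2 * ((2 * real j + 1) ^ 3 / 2)"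
        by (intro mult_left_mono) (auto simp: power3_eq_cube algebra_simps add_divide_distrib)
      finally show ?thesis using True by (simp add: ac_simps)
    qed (simp add: h_def)
  qed
  also have "2 * (\<Sum>j<n. if N \<le> j then K\<^sup>2 * ((2 * real j + 1) ^ 3 * (r j)\<^sup>2) / 2 else 0)
      = K\<^sup>2 * (\<Sum>j | j < n \<and> N \<le> j. (2 * real j + 1) ^ 3 * (r j)\<^sup>2)"
  proof -
    have "(\<Sum>j<n. if N \<le> j then K\<^sup>2 * ((2 * real j + 1) ^ 3 * (r j)\<^sup>2) / 2 else 0)
        = (\<Sum>j | j < n \<and> N \<le> j. K\<^sup>2 * ((2 * real j + 1) ^ 3 * (r j)\<^sup>2) / 2)"
      by (intro sum.mono_neutral_cong_right) auto
    then show ?thesis by (simp add: sum_distrib_left sum_divide_distrib)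
  qed
  also have "\<dots> \<le> K\<^sup>2 * (2 * ((2 * real N + 1) ^ 3 * (r N)\<^sup>2))"
    unfolding r_def using L T N by (intro mult_left_mono power_odd_dfact_tail) auto
  also have "\<dots> \<le> (eps_D_bound L T N)\<^sup>2"
    unfolding bound power_mult_distrib pw using mult_nonneg_nonneg[of "K\<^sup>2" "(2 * real N + 1) ^ 3 * (r N)\<^sup>2"]
    by (simp add: algebra_simps)
  finally show "(\<Sum>i\<in>A. \<Sum>j\<in>B. (C_tail L T N i j)\<^sup>2) \<le> (eps_D_bound L T N)\<^sup>2" by simp
qed

lemma p_vec_sum_le:
  assumes L: "0 < L" and A: "finite A"
  shows "(\<Sum>i\<in>A. (p_vec L (2 * i))\<^sup>2) \<le> L + sinh L"
proof -
  have "p_vec L (2 * i) = L2_inner (cutoff L (\<lambda>u. cosh (u / 2))) (legendre_fun L (2 * i))" for i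
    unfolding p_vec_eq by (subst L2_inner_commute[of "cutoff _ _"]) (simp add: L2_inner_legendre_cutoff)
  then show ?thesis
    using bessel[OF L cutoff_cosh_even_L2 A] by (simp add: L2_normsq_cutoff_cosh[OF L])
qed

lemma p_vec_tail_le:
  assumes L: "0 < L" and N: "0 < N" "L / 2 \<le> 2 * real N" and A: "finite A" "A \<subseteq> {N..}"
  shows "(\<Sum>i\<in>A. (p_vec L (2 * i))\<^sup>2)
    \<le> (4 * cosh (L / 2) * sqrt (L * (2 * real N + 1)) * ((L / 2) ^ (2 * N) / odd_dfact (2 * N)))\<^sup>2"
proof -
  define s where "s j = (L / 2) ^ (2 * j) / odd_dfact (2 * j)" for j
  have "(p_vec L (2 * i))\<^sup>2 \<le> 4 * L * (cosh (L / 2))\<^sup>2 * ((2 * real i + 1) ^ 1 * (s i)\<^sup>2)" for i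
  proof -
    have "\<bar>p_vec L (2 * i)\<bar>\<^sup>2 \<le> (2 * sqrt (L * (2 * real i + 1/2)) * cosh (L / 2) * s i)\<^sup>2"
      using p_vec_bound[OF L, of "2 * i"] by (intro power_mono) (auto simp: s_def)
    also have "\<dots> = 4 * L * (cosh (L / 2))\<^sup>2 * ((2 * real i + 1/2) * (s i)\<^sup>2)"
      using L by (simp add: power_mult_distrib)
    also have "\<dots> \<le> 4 * L * (cosh (L / 2))\<^sup>2 * ((2 * real i + 1) ^ 1 * (s i)\<^sup>2)"
      using L by (intro mult_left_mono mult_right_mono) auto
    finally show ?thesis by simp
  qed
  then have "(\<Sum>i\<in>A. (p_vec L (2 * i))\<^sup>2) \<le> (\<Sum>i\<in>A. 4 * L * (cosh (L / 2))\<^sup>2 * ((2 * real i + 1) ^ 1 * (s i)\<^sup>2))"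
    by (intro sum_mono)
  also have "\<dots> = 4 * L * (cosh (L / 2))\<^sup>2 * (\<Sum>i\<in>A. (2 * real i + 1) ^ 1 * (s i)\<^sup>2)"
    by (rule sum_distrib_left[symmetric])
  also have "\<dots> \<le> 4 * L * (cosh (L / 2))\<^sup>2 * (2 * ((2 * real N + 1) ^ 1 * (s N)\<^sup>2))"
    unfolding s_def using L N by (intro mult_left_mono power_odd_dfact_tail A) auto
  also have "\<dots> \<le> 16 * (cosh (L / 2))\<^sup>2 * (L * (2 * real N + 1)) * (s N)\<^sup>2"
  proof -
    define Y where "Y = (cosh (L / 2))\<^sup>2 * (L * (2 * real N + 1)) * (s N)\<^sup>2"
    have "0 \<le> Y" using L by (simp add: Y_def)
    then have "8 * Y \<le> 16 * Y" by simp
    then show ?thesis unfolding Y_def by (simp add: ac_simps)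
  qed
  also have "\<dots> = (4 * cosh (L / 2) * sqrt (L * (2 * real N + 1)) * s N)\<^sup>2"
    using L by (simp add: power_mult_distrib)
  finally show ?thesis unfolding s_def .
qed

section \<open>The blocks of the reduced form\<close>

definition H_R :: "real \<Rightarrow> real \<Rightarrow> nat \<Rightarrow> nat \<Rightarrow> real" where
  "H_R L T i j = 2 * p_vec L (2 * i) * p_vec L (2 * j) + C_mat L T (2 * i) (2 * j)"

lemma M_R_plus_diag: "M_R L T = plus_diag (beta_star L T) (H_R L T)"
  by (intro ext) (simp add: M_R_def plus_diag_def H_R_def)

lemma H_R_sym: "H_R L T i j = H_R L T j i"
  unfolding H_R_def using C_mat_commute[of L T "2 * i" "2 * j"] by simp

lemma hs_le_rank_one:
  assumes "0 \<le> a" "0 \<le> b" "\<And>A. finite A \<Longrightarrow> A \<subseteq> I \<Longrightarrow> (\<Sum>i\<in>A. (p i)\<^sup>2) \<le> a\<^sup>2"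
    "\<And>B. finite B \<Longrightarrow> B \<subseteq> J \<Longrightarrow> (\<Sum>j\<in>B. (q j)\<^sup>2) \<le> b\<^sup>2"
  shows "hs_le (\<lambda>i j. 2 * p i * q j) I J (2 * a * b)"
  unfolding hs_le_def
proof (intro conjI allI impI)
  fix A B assume AB: "finite (A :: nat set)" "finite (B :: nat set)" "A \<subseteq> I" "B \<subseteq> J"
  have sq: "(2 * p i * q j)\<^sup>2 = 4 * ((p i)\<^sup>2 * (q j)\<^sup>2)" for i j by (simp add: power_mult_distrib)
  have "(\<Sum>i\<in>A. \<Sum>j\<in>B. (2 * p i * q j)\<^sup>2) = 4 * ((\<Sum>i\<in>A. (p i)\<^sup>2) * (\<Sum>j\<in>B. (q j)\<^sup>2))"
    unfolding sq by (simp only: sum_distrib_left[symmetric] sum_distrib_right[symmetric])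
  also have "\<dots> \<le> 4 * (a\<^sup>2 * b\<^sup>2)"
    using assms AB by (intro mult_left_mono mult_mono) (auto intro: sum_nonneg)
  finally show "(\<Sum>i\<in>A. \<Sum>j\<in>B. (2 * p i * q j)\<^sup>2) \<le> (2 * a * b)\<^sup>2" by (simp add: power_mult_distrib)
qed (use assms in simp)

lemma hs_le_cong:
  assumes "hs_le G I J S" "\<And>i j. i \<in> I \<Longrightarrow> j \<in> J \<Longrightarrow> G i j = H i j"
  shows "hs_le H I J S"
  unfolding hs_le_def
proof (intro conjI allI impI hs_le_nonneg[OF assms(1)])
  fix A B assume AB: "finite (A :: nat set)" "finite (B :: nat set)" "A \<subseteq> I" "B \<subseteq> J"
  have "(\<Sum>i\<in>A. \<Sum>j\<in>B. (H i j)\<^sup>2) = (\<Sum>i\<in>A. \<Sum>j\<in>B. (G i j)\<^sup>2)"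
    using AB assms(2) by (intro sum.cong refl) (auto simp: subset_iff)
  also have "\<dots> \<le> S\<^sup>2" by (rule hs_leD[OF assms(1) AB])
  finally show "(\<Sum>i\<in>A. \<Sum>j\<in>B. (H i j)\<^sup>2) \<le> S\<^sup>2" .
qed

lemma hs_le_finite_support:
  assumes "finite F" "\<And>i j. i \<notin> F \<or> j \<notin> F \<Longrightarrow> H i j = 0"
  shows "hs_le H UNIV UNIV (sqrt (\<Sum>i\<in>F. \<Sum>j\<in>F. (H i j)\<^sup>2))"
  unfolding hs_le_def
proof (intro conjI allI impI)
  fix A B assume AB: "finite (A :: nat set)" "finite (B :: nat set)"
  have "(\<Sum>i\<in>A. \<Sum>j\<in>B. (H i j)\<^sup>2) = (\<Sum>i\<in>A \<inter> F. \<Sum>j\<in>B. (H i j)\<^sup>2)"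
    using AB assms(2) by (intro sum.mono_neutral_right) auto
  also have "\<dots> = (\<Sum>i\<in>A \<inter> F. \<Sum>j\<in>B \<inter> F. (H i j)\<^sup>2)"
    using AB assms(2) by (intro sum.cong refl sum.mono_neutral_right) auto
  also have "\<dots> \<le> (sqrt (\<Sum>i\<in>F. \<Sum>j\<in>F. (H i j)\<^sup>2))\<^sup>2"
    using hs_leD[OF hs_le_finite[OF assms(1,1), of H], of "A \<inter> F" "B \<inter> F"] AB by simp
  finally show "(\<Sum>i\<in>A. \<Sum>j\<in>B. (H i j)\<^sup>2) \<le> (sqrt (\<Sum>i\<in>F. \<Sum>j\<in>F. (H i j)\<^sup>2))\<^sup>2" .
qed (simp add: sum_nonneg)

lemma hs_le_C_block:
  assumes "0 < L" "0 < T" "0 < N" "T * L \<le> 2 * real N" "\<And>i j. i \<in> I \<Longrightarrow> j \<in> J \<Longrightarrow> N \<le> max i j"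
  shows "hs_le (\<lambda>i j. C_mat L T (2 * i) (2 * j)) I J (eps_D_bound L T N)"
proof (rule hs_le_cong)
  show "hs_le (C_tail L T N) I J (eps_D_bound L T N)"
    by (rule hs_le_subset[OF hs_le_C_tail]) (use assms in auto)
  show "C_tail L T N i j = C_mat L T (2 * i) (2 * j)" if "i \<in> I" "j \<in> J" for i j
    using assms(5)[OF that] by (simp add: C_tail_def)
qed

definition p_norm_bound :: "real \<Rightarrow> real" where
  "p_norm_bound L = sqrt (L + sinh L)"

definition p_tail_bound :: "real \<Rightarrow> nat \<Rightarrow> real" where
  "p_tail_bound L N = 4 * cosh (L / 2) * sqrt (L * (2 * real N + 1)) * ((L / 2) ^ (2 * N) / odd_dfact (2 * N))"

lemma p_bounds:
  assumes "0 < L"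
  shows "0 \<le> p_norm_bound L" "finite A \<Longrightarrow> (\<Sum>i\<in>A. (p_vec L (2 * i))\<^sup>2) \<le> (p_norm_bound L)\<^sup>2"
    "0 \<le> p_tail_bound L N"
    "0 < N \<Longrightarrow> L / 2 \<le> 2 * real N \<Longrightarrow> finite A \<Longrightarrow> A \<subseteq> {N..} \<Longrightarrow> (\<Sum>i\<in>A. (p_vec L (2 * i))\<^sup>2) \<le> (p_tail_bound L N)\<^sup>2"
  using assms p_vec_sum_le[OF assms] p_vec_tail_le[OF assms] odd_dfact_pos[of "2 * N"]
  by (simp_all add: p_norm_bound_def p_tail_bound_def)

text \<open>Outside the finite leading block the entries are those of the tail matrix.\<close>

lemma hs_le_H_R_UNIV:
  assumes "0 < L" "0 < T" "0 < N" "T * L \<le> 2 * real N"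
  shows "\<exists>S. hs_le (H_R L T) UNIV UNIV S"
proof -
  let ?Q = "\<lambda>i j. if i < N \<and> j < N then C_mat L T (2 * i) (2 * j) else 0"
  have C: "hs_le (\<lambda>i j. C_tail L T N i j + ?Q i j) UNIV UNIV
      (eps_D_bound L T N + sqrt (\<Sum>i<N. \<Sum>j<N. (?Q i j)\<^sup>2))"
    by (intro hs_le_add hs_le_C_tail assms hs_le_finite_support) auto
  have P: "hs_le (\<lambda>i j. 2 * p_vec L (2 * i) * p_vec L (2 * j)) UNIV UNIV (2 * p_norm_bound L * p_norm_bound L)"
    by (rule hs_le_rank_one) (use p_bounds[OF assms(1)] in auto)
  have "hs_le (H_R L T) UNIV UNIV (2 * p_norm_bound L * p_norm_bound L
      + (eps_D_bound L T N + sqrt (\<Sum>i<N. \<Sum>j<N. (?Q i j)\<^sup>2)))"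
    by (rule hs_le_cong[OF hs_le_add[OF P C]]) (auto simp: H_R_def C_tail_def)
  then show ?thesis by blast
qed

lemma block_op_add:
  assumes "hs_le G I J S" "hs_le H I J R" "x \<in> ell2 J"
  shows "block_op (\<lambda>i j. G i j + H i j) I J x = (\<lambda>i. block_op G I J x i + block_op H I J x i)"
proof
  fix i
  show "block_op (\<lambda>i j. G i j + H i j) I J x i = block_op G I J x i + block_op H I J x i"
    using infsum_add[OF hs_summable[OF assms(1) _ assms(3)] hs_summable[OF assms(2) _ assms(3)], of i]
    by (simp add: block_op_def distrib_right)
qed

lemma rank_one_form_nonneg:
  assumes "x \<in> ell2 I"
  shows "0 \<le> ell2_inner x (block_op (\<lambda>i j. 2 * p i * p j) I I x)"
proof -
  define s where "s = (\<Sum>\<^sub>\<infinity>j\<in>I. p j * x j)"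
  have "block_op (\<lambda>i j. 2 * p i * p j) I I x i = (if i \<in> I then 2 * p i * s else 0)" for i
    by (simp add: block_op_def s_def mult.assoc infsum_cmult_right')
  then have "ell2_inner x (block_op (\<lambda>i j. 2 * p i * p j) I I x) = (\<Sum>\<^sub>\<infinity>i\<in>I. (2 * s) * (p i * x i))"
    unfolding ell2_inner_def by (intro infsum_cong_neutral) auto
  also have "\<dots> = 2 * s * s" by (simp only: infsum_cmult_right' s_def)
  finally show ?thesis by simp
qed

text \<open>The rank-one part of the form is nonnegative, so only the tail of \<open>C\<close> can push the
  spectrum of \<open>D\<close> below $\beta^*$.\<close>

lemma tail_spec_ge:
  assumes L: "0 < L" and T: "0 < T" and N: "0 < N" "T * L \<le> 2 * real N"
  shows "beta_star L T - eps_D_bound L T N \<le> Inf (block_spec (M_R L T) {N..})"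
proof -
  obtain S where S: "hs_le (H_R L T) UNIV UNIV S" using hs_le_H_R_UNIV[OF assms] by blast
  let ?I = "{N..}" and ?b = "beta_star L T" and ?E = "eps_D_bound L T N"
  let ?P = "\<lambda>i j. 2 * p_vec L (2 * i) * p_vec L (2 * j)" and ?C = "\<lambda>i j. C_mat L T (2 * i) (2 * j)"
  have H: "hs_le (H_R L T) ?I ?I S" by (rule hs_le_subset[OF S]) auto
  have C: "hs_le ?C ?I ?I ?E" by (rule hs_le_C_block[OF assms]) auto
  have P: "hs_le ?P ?I ?I (2 * p_norm_bound L * p_norm_bound L)"
    by (rule hs_le_rank_one) (use p_bounds[OF L] in auto)
  have "?I \<noteq> {}" by auto
  show ?thesis
    unfolding M_R_plus_diag
  proof (rule block_spec_plus_diag(2)[OF H H_R_sym \<open>?I \<noteq> {}\<close>])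
    fix x assume x: "x \<in> ell2 ?I"
    have "H_R L T = (\<lambda>i j. ?P i j + ?C i j)" by (intro ext) (simp add: H_R_def)
    then have op: "block_op (H_R L T) ?I ?I x = (\<lambda>i. block_op ?P ?I ?I x i + block_op ?C ?I ?I x i)"
      using block_op_add[OF P C x] by simp
    have "ell2_inner x (block_op (plus_diag ?b (H_R L T)) ?I ?I x)
        = ?b * (ell2_norm x)\<^sup>2 + (ell2_inner x (block_op ?P ?I ?I x) + ell2_inner x (block_op ?C ?I ?I x))"
      unfolding block_op_plus_diag[OF H x] op ell2_norm_sq
      using ell2_inner_add_right[OF x ell2_scale[OF x] ell2_add[OF hs_block_op(1)[OF P x] hs_block_op(1)[OF C x]], of ?b]
        ell2_inner_add_right[OF x hs_block_op(1)[OF P x] hs_block_op(1)[OF C x]]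
      by (simp add: ell2_inner_scale_right)
    moreover have "\<bar>ell2_inner x (block_op ?C ?I ?I x)\<bar> \<le> ?E * (ell2_norm x)\<^sup>2"
      using order_trans[OF ell2_cauchy_schwarz[OF x hs_block_op(1)[OF C x]]
          mult_left_mono[OF hs_block_op(2)[OF C x] ell2_norm_nonneg[of x]]]
      by (simp add: power2_eq_square ac_simps)
    ultimately show "(?b - ?E) * (ell2_norm x)\<^sup>2 \<le> ell2_inner x (block_op (plus_diag ?b (H_R L T)) ?I ?I x)"
      using rank_one_form_nonneg[OF x, of "\<lambda>i. p_vec L (2 * i)"] by (simp add: algebra_simps)
  qed
qed

lemma eps_D_bound_nonneg:
  assumes "0 < L" "0 < T"
  shows "0 \<le> eps_D_bound L T N"
  unfolding eps_D_bound_def using assms K_const_nonneg[of L T] odd_dfact_pos[of "2 * N"] by simp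

lemma eps_D_le:
  assumes "0 < L" "0 < T" "0 < N" "T * L \<le> 2 * real N"
  shows "eps_D L T N \<le> eps_D_bound L T N"
  unfolding eps_D_def using tail_spec_ge[OF assms] eps_D_bound_nonneg[OF assms(1,2)] by simp

lemma eps_B_bounds:
  assumes L: "0 < L" and T: "1/2 \<le> T" and N: "0 < N" "T * L \<le> 2 * real N"
  shows "eps_B L T N \<le> eps_B_bound L T N" "0 \<le> eps_B L T N"
proof -
  have T0: "0 < T" using T by linarith
  have "L / 2 \<le> T * L" using mult_right_mono[OF T, of L] L by simp
  then have "L / 2 \<le> 2 * real N" using N by linarith
  note pt = p_bounds(4)[OF L N(1) this]
  have C: "hs_le (\<lambda>i j. C_mat L T (2 * i) (2 * j)) {..<N} {N..} (eps_D_bound L T N)"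
    by (rule hs_le_C_block[OF L T0 N]) auto
  have P: "hs_le (\<lambda>i j. 2 * p_vec L (2 * i) * p_vec L (2 * j)) {..<N} {N..} (2 * p_norm_bound L * p_tail_bound L N)"
    by (rule hs_le_rank_one) (use p_bounds(1-3)[OF L] pt in auto)
  have H: "hs_le (H_R L T) {..<N} {N..} (2 * p_norm_bound L * p_tail_bound L N + eps_D_bound L T N)"
    by (rule hs_le_cong[OF hs_le_add[OF P C]]) (simp add: H_R_def)
  have "2 * p_norm_bound L * p_tail_bound L N + eps_D_bound L T N = eps_B_bound L T N"
    unfolding eps_B_bound_def p_norm_bound_def p_tail_bound_def by (simp add: real_sqrt_mult)
  moreover have "{..<N} \<inter> {N..} = {}" by auto
  ultimately show "eps_B L T N \<le> eps_B_bound L T N"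
    using block_norm_bounds(1)[OF H, of "beta_star L T"] by (simp add: eps_B_def M_R_plus_diag)
  show "0 \<le> eps_B L T N"
    unfolding eps_B_def M_R_plus_diag by (rule block_norm_bounds(2)[OF H]) auto
qed

lemma weil_Q_ge_blocks:
  assumes L: "0 < L" and T: "0 < T" "0 < beta_star L T" and N: "0 < N" "T * L \<le> 2 * real N"
    and l0: "l0 \<le> least_eigenvalue (A_block L T N)" and f: "f \<in> even_L2 L"
  shows "ereal ((min l0 (beta_star L T - eps_D L T N) - eps_B L T N) * L2_normsq f) \<le> weil_Q L f"
proof -
  obtain S where S: "hs_le (H_R L T) UNIV UNIV S" using hs_le_H_R_UNIV[OF L T(1) N] by blast
  define x where "x i = L2_inner f (legendre_fun L (2 * i))" for i
  let ?m = "min l0 (beta_star L T - eps_D L T N) - eps_B L T N"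
  have "?m * (\<Sum>i<n. (x i)\<^sup>2) \<le> (\<Sum>i<n. \<Sum>j<n. M_R L T i j * x i * x j)" if "N \<le> n" for n
    unfolding eps_B_def M_R_plus_diag
  proof (rule block_form_ge[OF S H_R_sym N(1) that])
    show "l0 \<le> least_eigenvalue (Matrix.mat N N (\<lambda>(i, j). plus_diag (beta_star L T) (H_R L T) i j))"
      using l0 by (simp add: A_block_def M_R_plus_diag)
    show "beta_star L T - eps_D L T N \<le> Inf (block_spec (plus_diag (beta_star L T) (H_R L T)) {N..})"
      by (simp add: eps_D_def M_R_plus_diag)
  qed
  moreover have "(\<lambda>n. ?m * (\<Sum>i<n. (x i)\<^sup>2)) \<longlonglongrightarrow> ?m * L2_normsq f"
    using has_sum_imp_sums[OF legendre_parseval[OF L f]] by (intro tendsto_intros) (simp add: sums_def x_def)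
  moreover have "(\<lambda>n. \<Sum>i<n. \<Sum>j<n. M_R L T i j * x i * x j) \<longlonglongrightarrow> form_R L T f"
    using has_sum_imp_square_sums[OF form_R_has_sum[OF L T(1) f]] by (simp add: x_def)
  ultimately have "?m * L2_normsq f \<le> form_R L T f" by (intro LIMSEQ_le) auto
  then have "ereal (?m * L2_normsq f) \<le> ereal (form_R L T f)" by simp
  also have "\<dots> \<le> weil_Q L f" by (rule weil_Q_ge_form_R[OF L T f])
  finally show ?thesis .
qed

section \<open>Super-exponential decay\<close>

lemma power_over_fact_le_exp:
  fixes x :: real
  assumes "0 \<le> x"
  shows "x ^ n / fact n \<le> exp x"
proof -
  have "(\<Sum>k\<in>{n}. x ^ k / fact k) \<le> (\<Sum>k. x ^ k / fact k)"
    using assms summable_exp[of x] by (intro sum_le_suminf) (auto simp: field_simps)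
  then show ?thesis by (simp add: exp_def field_simps)
qed

lemma fact_le_odd_dfact: "fact n \<le> odd_dfact n"
proof (induction n)
  case (Suc n)
  have "fact (Suc n) = (real n + 1) * fact n" by simp
  also have "\<dots> \<le> (2 * real n + 3) * odd_dfact n" using Suc by (intro mult_mono) auto
  finally show ?case by (simp add: odd_dfact_Suc)
qed (simp add: odd_dfact_def)

text \<open>The double factorial is at least $(2N)!$, the polynomial is at most $e^{4N}$, and
  $x^{2N}e^{(a+4)N}$ is the power $y^{2N}$ of a constant \<open>y\<close> with $y^{2N}/(2N)! \le e^y$.\<close>

lemma power_odd_dfact_superexponential:
  assumes x: "0 \<le> x" and a: "0 \<le> a"
  shows "(2 * real N + 1)\<^sup>2 * (x ^ (2 * N) / odd_dfact (2 * N)) \<le> exp (x * exp ((a + 4) / 2)) * exp (- a * real N)"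
proof -
  let ?y = "x * exp ((a + 4) / 2)"
  have "2 * real N + 1 \<le> exp (2 * real N)" using exp_ge_add_one_self[of "2 * real N"] by linarith
  then have "(2 * real N + 1)\<^sup>2 \<le> (exp (2 * real N))\<^sup>2" by (intro power_mono) auto
  also have "\<dots> = exp ((a + 4) * real N) * exp (- a * real N)"
    by (simp add: power2_eq_square algebra_simps flip: exp_add)
  finally have "(2 * real N + 1)\<^sup>2 * (x ^ (2 * N) / odd_dfact (2 * N))
      \<le> (exp ((a + 4) * real N) * exp (- a * real N)) * (x ^ (2 * N) / fact (2 * N))"
    using x fact_le_odd_dfact[of "2 * N"] by (intro mult_mono divide_left_mono) (auto simp: odd_dfact_pos less_imp_le)
  also have "\<dots> = ?y ^ (2 * N) / fact (2 * N) * exp (- a * real N)"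
  proof -
    have "exp ((a + 4) / 2) ^ (2 * N) = exp ((a + 4) * real N)"
      by (simp add: field_simps flip: exp_of_nat_mult)
    then show ?thesis by (simp add: power_mult_distrib)
  qed
  also have "\<dots> \<le> exp ?y * exp (- a * real N)"
    using x by (intro mult_right_mono power_over_fact_le_exp) auto
  finally show ?thesis .
qed

lemma eps_bounds_superexponential:
  assumes L: "0 < L" and T: "0 < T" and a: "0 \<le> a"
  shows "\<exists>c. \<forall>N. eps_D_bound L T N \<le> c * exp (- a * real N)"
    and "\<exists>c. \<forall>N. eps_B_bound L T N \<le> c * exp (- a * real N)"
proof -
  have pw: "(2 * real N + 1) powr (3/2) \<le> (2 * real N + 1)\<^sup>2" for N
    using powr_mono[of "3/2" 2 "2 * real N + 1"] by (simp add: powr_numeral)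
  have D: "eps_D_bound L T N \<le> (2 * K_const L T * exp ((T * L) * exp ((a + 4) / 2))) * exp (- a * real N)" for N
  proof -
    let ?r = "(T * L) ^ (2 * N) / odd_dfact (2 * N)"
    have r: "0 \<le> ?r" using L T odd_dfact_pos[of "2 * N"] by simp
    have "eps_D_bound L T N = 2 * K_const L T * ((2 * real N + 1) powr (3/2) * ?r)"
      by (simp add: eps_D_bound_def)
    also have "\<dots> \<le> 2 * K_const L T * ((2 * real N + 1)\<^sup>2 * ?r)"
      using K_const_nonneg[OF L, of T] r pw by (intro mult_left_mono mult_right_mono) auto
    also have "\<dots> \<le> 2 * K_const L T * (exp ((T * L) * exp ((a + 4) / 2)) * exp (- a * real N))"
      using K_const_nonneg[OF L, of T] L T a by (intro mult_left_mono power_odd_dfact_superexponential) auto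
    finally show ?thesis by (simp add: mult.assoc)
  qed
  then show "\<exists>c. \<forall>N. eps_D_bound L T N \<le> c * exp (- a * real N)" by blast
  let ?c = "8 * cosh (L / 2) * sqrt (L * (L + sinh L))"
  have c: "0 \<le> ?c" using L by simp
  have B: "eps_B_bound L T N \<le> (2 * K_const L T * exp ((T * L) * exp ((a + 4) / 2))
      + ?c * exp ((L / 2) * exp ((a + 4) / 2))) * exp (- a * real N)" for N
  proof -
    let ?s = "(L / 2) ^ (2 * N) / odd_dfact (2 * N)"
    have s: "0 \<le> ?s" using L odd_dfact_pos[of "2 * N"] by simp
    have "sqrt (2 * real N + 1) \<le> (2 * real N + 1)\<^sup>2"
      using power_increasing[of 1 4 "2 * real N + 1"] by (intro real_le_lsqrt) (auto simp flip: power_mult)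
    then have "?c * (sqrt (2 * real N + 1) * ?s) \<le> ?c * ((2 * real N + 1)\<^sup>2 * ?s)"
      using c s by (intro mult_left_mono mult_right_mono) auto
    also have "\<dots> \<le> ?c * (exp ((L / 2) * exp ((a + 4) / 2)) * exp (- a * real N))"
      using c L a by (intro mult_left_mono power_odd_dfact_superexponential) auto
    finally have "?c * (sqrt (2 * real N + 1) * ?s) \<le> ?c * exp ((L / 2) * exp ((a + 4) / 2)) * exp (- a * real N)"
      by (simp add: mult.assoc)
    moreover have "eps_B_bound L T N = eps_D_bound L T N + ?c * (sqrt (2 * real N + 1) * ?s)"
      by (simp add: eps_B_bound_def real_sqrt_mult)
    ultimately show ?thesis using D[of N] by (simp add: distrib_right)
  qed
  then show "\<exists>c. \<forall>N. eps_B_bound L T N \<le> c * exp (- a * real N)" by blast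
qed

lemma eps_superexponential:
  assumes L: "0 < L" and T: "1/2 \<le> T" and a: "0 < a"
  shows "(\<lambda>N. eps_D L T N) \<in> O(\<lambda>N. exp (- a * real N))" "(\<lambda>N. eps_B L T N) \<in> O(\<lambda>N. exp (- a * real N))"
proof -
  have T0: "0 < T" using T by linarith
  have ev: "eventually (\<lambda>N. 0 < N \<and> T * L \<le> 2 * real N) sequentially"
    by (intro eventually_conj eventually_gt_at_top) real_asymp
  obtain c where c: "\<And>N. eps_D_bound L T N \<le> c * exp (- a * real N)"
    using eps_bounds_superexponential(1)[OF L T0, of a] a by auto
  obtain d where d: "\<And>N. eps_B_bound L T N \<le> d * exp (- a * real N)"
    using eps_bounds_superexponential(2)[OF L T0, of a] a by auto
  show "(\<lambda>N. eps_D L T N) \<in> O(\<lambda>N. exp (- a * real N))"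
  proof (rule bigoI)
    show "eventually (\<lambda>N. norm (eps_D L T N) \<le> c * norm (exp (- a * real N))) sequentially"
      using ev
    proof eventually_elim
      case (elim N)
      have "0 \<le> eps_D L T N" by (simp add: eps_D_def)
      then show ?case using eps_D_le[OF L T0, of N] elim c[of N] by simp
    qed
  qed
  show "(\<lambda>N. eps_B L T N) \<in> O(\<lambda>N. exp (- a * real N))"
  proof (rule bigoI)
    show "eventually (\<lambda>N. norm (eps_B L T N) \<le> d * norm (exp (- a * real N))) sequentially"
      using ev
    proof eventually_elim
      case (elim N)
      then show ?case using eps_B_bounds[OF L T, of N] d[of N] by simp
    qed
  qed
qed

section \<open>The numerical example\<close>

text \<open>The factor is $160 = TL$ for $L = 4/5$ and $T = 200$.\<close>

definition odd_ratio :: "nat \<Rightarrow> real" where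
  "odd_ratio k = odd_dfact k / 160 ^ k"

lemma odd_ratio_step:
  assumes "c \<le> odd_ratio k" "c' * 160 ^ 25 \<le> c * (\<Prod>i<25. 2 * real (k + i) + 3)"
  shows "c' \<le> odd_ratio (k + 25)"
proof -
  have "odd_ratio (k + m) = odd_ratio k * (\<Prod>i<m. (2 * real (k + i) + 3) / 160)" for m
  proof (induction m)
    case (Suc m)
    have "odd_ratio (Suc j) = odd_ratio j * ((2 * real j + 3) / 160)" for j
      by (simp add: odd_ratio_def odd_dfact_Suc mult.commute)
    with Suc show ?case by simp
  qed simp
  then have "odd_ratio (k + 25) = odd_ratio k * (\<Prod>i<25. (2 * real (k + i) + 3) / 160)" .
  moreover have "c * (\<Prod>i<25. (2 * real (k + i) + 3) / 160) \<le> odd_ratio k * (\<Prod>i<25. (2 * real (k + i) + 3) / 160)"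
    using assms(1) by (intro mult_right_mono prod_nonneg) auto
  moreover have "c' \<le> c * (\<Prod>i<25. (2 * real (k + i) + 3) / 160)"
    using assms(2) by (simp add: prod_dividef field_simps)
  ultimately show ?thesis by linarith
qed

text \<open>Rounding down after every 25 factors keeps the numbers short; the final bound exceeds
  $8 \cdot 10^{108}$.\<close>

lemma odd_ratio_400: "10 ^ 108 \<le> odd_ratio 400"
proof -
  have "1 \<le> odd_ratio 0" by (simp add: odd_ratio_def odd_dfact_def)
  from odd_ratio_step[OF this, of "2350 / 10 ^ 25"] have "2350 / 10 ^ 25 \<le> odd_ratio 25"
    by (simp add: lessThan_nat_numeral)
  from odd_ratio_step[OF this, of "1712 / 10 ^ 33"] have "1712 / 10 ^ 33 \<le> odd_ratio 50"
    by (simp add: lessThan_nat_numeral)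
  from odd_ratio_step[OF this, of "4516 / 10 ^ 36"] have "4516 / 10 ^ 36 \<le> odd_ratio 75"
    by (simp add: lessThan_nat_numeral)
  from odd_ratio_step[OF this, of "5185 / 10 ^ 35"] have "5185 / 10 ^ 35 \<le> odd_ratio 100"
    by (simp add: lessThan_nat_numeral)
  from odd_ratio_step[OF this, of "3093 / 10 ^ 31"] have "3093 / 10 ^ 31 \<le> odd_ratio 125"
    by (simp add: lessThan_nat_numeral)
  from odd_ratio_step[OF this, of "2720 / 10 ^ 25"] have "2720 / 10 ^ 25 \<le> odd_ratio 150"
    by (simp add: lessThan_nat_numeral)
  from odd_ratio_step[OF this, of "1529 / 10 ^ 17"] have "1529 / 10 ^ 17 \<le> odd_ratio 175"
    by (simp add: lessThan_nat_numeral)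
  from odd_ratio_step[OF this, of "3033 / 10 ^ 8"] have "3033 / 10 ^ 8 \<le> odd_ratio 200"
    by (simp add: lessThan_nat_numeral)
  from odd_ratio_step[OF this, of "1359 * 10 ^ 3"] have "1359 * 10 ^ 3 \<le> odd_ratio 225"
    by (simp add: lessThan_nat_numeral)
  from odd_ratio_step[OF this, of "9732 * 10 ^ 14"] have "9732 * 10 ^ 14 \<le> odd_ratio 250"
    by (simp add: lessThan_nat_numeral)
  from odd_ratio_step[OF this, of "8441 * 10 ^ 27"] have "8441 * 10 ^ 27 \<le> odd_ratio 275"
    by (simp add: lessThan_nat_numeral)
  from odd_ratio_step[OF this, of "7069 * 10 ^ 41"] have "7069 * 10 ^ 41 \<le> odd_ratio 300"
    by (simp add: lessThan_nat_numeral)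
  from odd_ratio_step[OF this, of "4733 * 10 ^ 56"] have "4733 * 10 ^ 56 \<le> odd_ratio 325"
    by (simp add: lessThan_nat_numeral)
  from odd_ratio_step[OF this, of "2159 * 10 ^ 72"] have "2159 * 10 ^ 72 \<le> odd_ratio 350"
    by (simp add: lessThan_nat_numeral)
  from odd_ratio_step[OF this, of "5854 * 10 ^ 88"] have "5854 * 10 ^ 88 \<le> odd_ratio 375"
    by (simp add: lessThan_nat_numeral)
  from odd_ratio_step[OF this, of "8377 * 10 ^ 105"] have "8377 * 10 ^ 105 \<le> odd_ratio 400"
    by (simp add: lessThan_nat_numeral)
  then show ?thesis by simp
qed

lemma ln_le_if_le_exp: "0 < x \<Longrightarrow> x \<le> exp y \<Longrightarrow> ln x \<le> (y :: real)"
  by (metis exp_gt_zero ln_exp ln_le_cancel_iff)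

lemma exp_1_ge: "271/100 \<le> exp (1::real)"
proof -
  have "5837465777 / 2147483648 - exp 1 \<le> inverse (2 ^ 32 :: real)" using e_approx_32 by linarith
  moreover have "inverse (2 ^ 32 :: real) \<le> 1 / 1000" by simp
  moreover have "271/100 \<le> 5837465777 / 2147483648 - 1 / (1000 :: real)" by simp
  ultimately show ?thesis by linarith
qed

text \<open>Since $e^{8/5} < 5$, only $n = 2, 3, 4$ contribute.\<close>

lemma comb_mass_4_5: "comb_mass (4/5) < 299/100"
proof -
  have e: "exp (8/5 :: real) \<le> 5"
  proof -
    have "exp (8/5 :: real) ^ 5 = exp 1 ^ 8" by (simp flip: exp_of_nat_mult)
    also have "\<dots> \<le> (272/100) ^ 8" using e_less_272 by (intro power_mono) auto
    also have "\<dots> \<le> (5 :: real) ^ 5" by (simp add: power_divide)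
    finally show ?thesis using power_mono_iff[of "exp (8/5)" "5 :: real" 5] by simp
  qed
  have "n \<in> {2, 3, 4}" if "2 \<le> n" "ln (real n) < 2 * (4/5)" for n :: nat
  proof -
    have "exp (ln (real n)) < exp (8/5)" unfolding exp_less_cancel_iff using that by simp
    moreover have "exp (ln (real n)) = real n" using that by simp
    ultimately have "real n < exp (8/5)" by linarith
    then have "real n < 5" using e by linarith
    then show ?thesis using that by auto
  qed
  then have "comb_mass (4/5) \<le> (\<Sum>n\<in>{2, 3, 4::nat}. 2 * mangoldt n / sqrt (real n))"
    unfolding comb_mass_def by (intro sum_mono2) (auto simp: mangoldt_nonneg)
  also have "\<dots> = 2 * ln 2 / sqrt 2 + 2 * ln 3 / sqrt 3 + ln 2"
  proof -
    have "mangoldt (2 ^ 2 :: nat) = ln (2 :: real)" using mangoldt_primepow'[of 2 2, where ?'a = real] by simp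
    then have "mangoldt (4 :: nat) = ln (2 :: real)" by simp
    moreover have "mangoldt (2 :: nat) = ln (2 :: real)" "mangoldt (3 :: nat) = ln (3 :: real)"
      using mangoldt_prime[of 2, where ?'a = real] mangoldt_prime[of 3, where ?'a = real] by simp_all
    ultimately show ?thesis by simp
  qed
  also have "\<dots> < 299/100"
  proof -
    have l2: "ln (2::real) \<le> 25/36" by (rule ln2_le_25_over_36)
    have l3: "ln (3::real) \<le> 9/8"
    proof -
      have "(3::real) ^ 8 \<le> exp (9/8) ^ 8"
      proof -
        have "(3::real) ^ 8 \<le> (271/100) ^ 9" by (simp add: power_divide)
        also have "\<dots> \<le> exp 1 ^ 9" using exp_1_ge by (intro power_mono) auto
        also have "\<dots> = exp (9/8) ^ 8" by (simp flip: exp_of_nat_mult)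
        finally show ?thesis .
      qed
      then have "3 \<le> exp (9/8 :: real)" using power_mono_iff[of "3 :: real" "exp (9/8)" 8] by simp
      then show ?thesis by (intro ln_le_if_le_exp) auto
    qed
    have s2: "1 / sqrt (2::real) \<le> 71/100"
      by (rule power2_le_imp_le) (auto simp: power_divide)
    have s3: "1 / sqrt (3::real) \<le> 58/100"
      by (rule power2_le_imp_le) (auto simp: power_divide)
    have "ln 2 * (1 / sqrt 2) \<le> 25/36 * (71/100 :: real)" using l2 s2 by (intro mult_mono) auto
    moreover have "ln 3 * (1 / sqrt 3) \<le> 9/8 * (58/100 :: real)" using l3 s3 by (intro mult_mono) auto
    ultimately show ?thesis using l2 by simp
  qed
  finally show ?thesis .
qed

lemma beta_star_4_5: "0 < beta_star (4/5) 200" "beta_star (4/5) 200 \<le> 4"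
proof -
  have "exp 3 * (2 * pi) \<le> (200 :: real)"
  proof -
    have "exp 3 = exp (1::real) ^ 3" by (simp flip: exp_of_nat_mult)
    also have "\<dots> \<le> (272/100) ^ 3" using e_less_272 by (intro power_mono) auto
    finally have "exp 3 * (2 * pi) \<le> (272/100) ^ 3 * (2 * (63/20))"
      using pi_approx by (intro mult_mono) auto
    then show ?thesis by (simp add: power_divide)
  qed
  then have "exp 3 \<le> 200 / (2 * pi)" by (simp add: field_simps)
  then have "3 \<le> ln (200 / (2 * pi))" by (simp add: ln_ge_iff)
  then show "0 < beta_star (4/5) 200" using comb_mass_4_5 by (simp add: beta_star_def)
  have "200 / (2 * pi) \<le> exp 4"
  proof -
    have "200 / (2 * pi) \<le> 200 / (2 * 3)" using pi_gt3 by (intro divide_left_mono) auto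
    also have "\<dots> \<le> 2 ^ 4 * 3" by simp
    also have "\<dots> \<le> exp (1::real) ^ 4"
    proof -
      have "(27/10) ^ 4 \<le> exp (1::real) ^ 4" using exp_1_ge by (intro power_mono) auto
      then show ?thesis by (simp add: power_divide)
    qed
    also have "\<dots> = exp 4" by (simp flip: exp_of_nat_mult)
    finally show ?thesis .
  qed
  then have "ln (200 / (2 * pi)) \<le> 4" by (intro ln_le_if_le_exp) auto
  then show "beta_star (4/5) 200 \<le> 4" using comb_mass_nonneg[of "4/5"] by (simp add: beta_star_def)
qed

text \<open>Near $y = 0$ the telescoping lower bound does not apply at $x = 1/4$, where $x^2-x+y^2$ is
  negative; the recursion of the digamma function moves the point to $x = 5/4$.\<close>

lemma weil_symbol_4_5:
  assumes t: "t \<in> {0..200}"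
  shows "\<bar>weil_symbol (4/5) t - beta_star (4/5) 200\<bar> \<le> 14"
proof -
  define y where "y = t / 2"
  have y: "y\<^sup>2 \<le> 100\<^sup>2" using t by (intro power_mono) (auto simp: y_def)
  have up: "Re (Digamma (Complex (1/4) y)) \<le> 5"
  proof -
    have "Re (Digamma (Complex (1/4) y)) \<le> 1/2 * ln ((1/4)\<^sup>2 - 1/4 + (1 + y\<^sup>2))" by (rule Re_Digamma_le) simp
    also have "\<dots> \<le> 1/2 * ln (exp 10)"
    proof -
      have "(2::real) ^ 10 * 10 \<le> (27/10) ^ 10" by (simp add: power_divide)
      also have "\<dots> \<le> exp (1::real) ^ 10" using exp_1_ge by (intro power_mono) auto
      also have "\<dots> = exp 10" by (simp flip: exp_of_nat_mult)
      finally have "(1/4)\<^sup>2 - 1/4 + (1 + y\<^sup>2) \<le> exp 10" using y by (simp add: power2_eq_square)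
      moreover have "0 < (1/4)\<^sup>2 - 1/4 + (1 + y\<^sup>2)" by (simp add: power2_eq_square add_pos_nonneg)
      ultimately have "ln ((1/4)\<^sup>2 - 1/4 + (1 + y\<^sup>2)) \<le> 10" by (intro ln_le_if_le_exp)
      then show ?thesis by simp
    qed
    finally show ?thesis by simp
  qed
  have low: "- 5 \<le> Re (Digamma (Complex (1/4) y))"
  proof -
    let ?z = "Complex (1/4) y"
    have "?z \<noteq> 0" by (simp add: complex_eq_iff)
    then have "Digamma (?z + 1) = Digamma ?z + 1 / ?z" by (rule Digamma_plus1)
    moreover have "?z + 1 = Complex (5/4) y" by (simp add: complex_eq_iff)
    ultimately have "Re (Digamma ?z) = Re (Digamma (Complex (5/4) y)) - Re (1 / ?z)" by (metis add_diff_cancel_right' minus_complex.sel(1))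
    moreover have "1/2 * ln ((5/4)\<^sup>2 - 5/4 + y\<^sup>2) \<le> Re (Digamma (Complex (5/4) y))"
      by (rule Re_Digamma_ge) (auto simp: power2_eq_square add_pos_nonneg)
    moreover have "- 1 \<le> 1/2 * ln ((5/4)\<^sup>2 - 5/4 + y\<^sup>2)"
    proof -
      have "1 / (16/5) \<le> (5/4)\<^sup>2 - 5/4 + y\<^sup>2" by (simp add: power2_eq_square)
      moreover have "exp (- 2) \<le> 1 / (16/5 :: real)"
      proof -
        have "(16/5 :: real) \<le> 2 ^ 2" by simp
        also have "\<dots> \<le> exp (1::real) ^ 2" using exp_ge_add_one_self[of "1::real"] by (intro power_mono) auto
        also have "\<dots> = exp 2" by (simp flip: exp_of_nat_mult)
        finally show ?thesis by (simp add: exp_minus field_simps)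
      qed
      ultimately have "exp (- 2) \<le> (5/4)\<^sup>2 - 5/4 + y\<^sup>2" by linarith
      then have "- 2 \<le> ln ((5/4)\<^sup>2 - 5/4 + y\<^sup>2)"
        by (subst ln_ge_iff) (auto intro: less_le_trans[OF exp_gt_zero])
      then show ?thesis by simp
    qed
    moreover have "Re (1 / ?z) \<le> 4"
    proof -
      have "Re (1 / ?z) = (1/4) / ((1/4)\<^sup>2 + y\<^sup>2)" by (simp add: Re_divide)
      also have "\<dots> \<le> (1/4) / ((1/4)\<^sup>2)" by (intro divide_left_mono) (auto simp: add_pos_nonneg power2_eq_square)
      finally show ?thesis by (simp add: power2_eq_square)
    qed
    ultimately show ?thesis by linarith
  qed
  have lnpi: "0 \<le> ln pi" "ln pi \<le> 2"
  proof -
    show "0 \<le> ln pi" using pi_gt3 by simp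
    have "pi \<le> exp 2"
    proof -
      have "pi < 2 ^ 2" using pi_less_4 by simp
      also have "\<dots> \<le> exp (1::real) ^ 2" using exp_ge_add_one_self[of "1::real"] by (intro power_mono) auto
      also have "\<dots> = exp 2" by (simp flip: exp_of_nat_mult)
      finally show ?thesis by simp
    qed
    then show "ln pi \<le> 2" by (intro ln_le_if_le_exp) auto
  qed
  show ?thesis
    using up low lnpi comb_sum_bound[where L = "4/5" and t = t] comb_mass_4_5 beta_star_4_5
    unfolding weil_symbol_eq y_def abs_le_iff by linarith
qed

lemma K_const_4_5: "K_const (4/5) 200 \<le> 3000"
proof -
  have "(LBINT t:{0..200}. \<bar>weil_symbol (4/5) t - beta_star (4/5) 200\<bar>) \<le> (LBINT t:{0..200::real}. 14)"
    by (intro set_integral_mono integrable_on_interval continuous_intros continuous_weil_symbol weil_symbol_4_5)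
  also have "\<dots> = 2800" by (simp add: set_lebesgue_integral_def)
  finally have "K_const (4/5) 200 \<le> 4 * (4/5) / pi * 2800"
    unfolding K_const_def by (intro mult_left_mono) auto
  also have "\<dots> \<le> 4 * (4/5) / 3 * 2800"
    using pi_gt3 by (intro mult_right_mono divide_left_mono) auto
  finally show ?thesis by simp
qed

text \<open>Keeping the quotient of the power and the double factorial as \<open>odd_ratio\<close> prevents the
  evaluation of numerals with hundreds of digits.\<close>

lemma eps_bounds_odd_ratio:
  assumes L: "0 < L" "L / 2 \<le> 160" and TL: "T * L = 160"
  shows "eps_D_bound L T N = 2 * K_const L T * (2 * real N + 1) powr (3/2) / odd_ratio (2 * N)"
    and "eps_B_bound L T N \<le> eps_D_bound L T N
           + 8 * cosh (L / 2) * sqrt (L * (L + sinh L) * (2 * real N + 1)) / odd_ratio (2 * N)"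
proof -
  show "eps_D_bound L T N = 2 * K_const L T * (2 * real N + 1) powr (3/2) / odd_ratio (2 * N)"
    by (simp add: eps_D_bound_def odd_ratio_def TL)
  have "(L / 2) ^ (2 * N) / odd_dfact (2 * N) \<le> 160 ^ (2 * N) / odd_dfact (2 * N)"
    using L by (intro divide_right_mono power_mono) (auto simp: less_imp_le odd_dfact_pos)
  also have "\<dots> = 1 / odd_ratio (2 * N)" by (simp add: odd_ratio_def)
  finally have "8 * cosh (L / 2) * sqrt (L * (L + sinh L) * (2 * real N + 1)) * ((L / 2) ^ (2 * N) / odd_dfact (2 * N))
      \<le> 8 * cosh (L / 2) * sqrt (L * (L + sinh L) * (2 * real N + 1)) * (1 / odd_ratio (2 * N))"
    using L by (intro mult_left_mono) auto
  then show "eps_B_bound L T N \<le> eps_D_bound L T N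
           + 8 * cosh (L / 2) * sqrt (L * (L + sinh L) * (2 * real N + 1)) / odd_ratio (2 * N)"
    by (simp add: eps_B_bound_def)
qed

lemma eps_bounds_4_5: "eps_D_bound (4/5) 200 200 < 1 / 10 ^ 100" "eps_B_bound (4/5) 200 200 < 1 / 10 ^ 100"
proof -
  define r where "r = 1 / odd_ratio 400"
  have r: "0 < r" "r \<le> 1 / 10 ^ 108"
  proof -
    have "(0::real) < 10 ^ 108" by simp
    then show "0 < r" "r \<le> 1 / 10 ^ 108"
      using odd_ratio_400 unfolding r_def by (auto intro!: divide_left_mono mult_pos_pos intro: less_le_trans)
  qed
  have pw: "(401 :: real) powr (3/2) \<le> 9000"
  proof (rule power2_le_imp_le)
    have "((401 :: real) powr (3/2))\<^sup>2 = 401 ^ 3" by (simp add: powr_powr flip: powr_numeral)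
    then show "((401 :: real) powr (3/2))\<^sup>2 \<le> 9000\<^sup>2" by simp
  qed simp
  have D: "eps_D_bound (4/5) 200 200 \<le> (54 * 10 ^ 6) * r"
  proof -
    have "eps_D_bound (4/5) 200 200 = (2 * K_const (4/5) 200) * 401 powr (3/2) * r"
      using eps_bounds_odd_ratio(1)[of "4/5" 200 200] by (simp add: r_def)
    also have "\<dots> \<le> (2 * 3000) * 9000 * r"
      using K_const_4_5 K_const_nonneg[of "4/5" 200] pw r by (intro mult_right_mono mult_mono) auto
    finally show ?thesis by simp
  qed
  have B: "eps_B_bound (4/5) 200 200 \<le> eps_D_bound (4/5) 200 200 + 10 ^ 6 * r"
  proof -
    have ch: "cosh (2/5 :: real) \<le> 3" "sinh (4/5 :: real) \<le> 3"
    proof -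
      have e3: "exp x \<le> 3" if "x \<le> 1" for x :: real
        using that exp_le exp_le_cancel_iff[of x 1] by linarith
      show "cosh (2/5 :: real) \<le> 3" unfolding cosh_field_def using e3[of "2/5"] e3[of "- (2/5)"] by simp
      have half: "(a - b) / 2 \<le> 3" if "a \<le> 3" "0 < b" for a b :: real using that by simp
      show "sinh (4/5 :: real) \<le> 3" unfolding sinh_field_def by (rule half) (use e3[of "4/5"] in auto)
    qed
    have sq: "sqrt (4/5 * (4/5 + sinh (4/5)) * 401) \<le> (100 :: real)"
    proof (rule real_le_lsqrt)
      have "4/5 * (4/5 + sinh (4/5 :: real)) * 401 \<le> 4/5 * (4/5 + 3) * 401" using ch by simp
      then show "4/5 * (4/5 + sinh (4/5 :: real)) * 401 \<le> 100\<^sup>2" by simp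
    qed simp
    have "eps_B_bound (4/5) 200 200 \<le> eps_D_bound (4/5) 200 200
        + 8 * cosh (2/5) * sqrt (4/5 * (4/5 + sinh (4/5)) * 401) * r"
      using eps_bounds_odd_ratio(2)[of "4/5" 200 200] by (simp add: r_def)
    moreover have "8 * cosh (2/5) * sqrt (4/5 * (4/5 + sinh (4/5)) * 401) * r \<le> 8 * 3 * 100 * r"
      using ch sq r by (intro mult_right_mono mult_mono) auto
    moreover have "8 * 3 * 100 * r \<le> 10 ^ 6 * r" using r by (intro mult_right_mono) auto
    ultimately show ?thesis by linarith
  qed
  have small: "(54 * 10 ^ 6) * r + 10 ^ 6 * r < 1 / 10 ^ 100"
  proof -
    have "(54 * 10 ^ 6) * r + 10 ^ 6 * r = (55 * 10 ^ 6) * r" by simp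
    also have "\<dots> \<le> (55 * 10 ^ 6) * (1 / 10 ^ 108)" using r(2) by (rule mult_left_mono) simp
    also have "\<dots> < 1 / 10 ^ 100" by simp
    finally show ?thesis .
  qed
  have "0 < 10 ^ 6 * r" using r by simp
  then show "eps_D_bound (4/5) 200 200 < 1 / 10 ^ 100" using D small by (meson add_less_same_cancel1 less_add_same_cancel1 le_less_trans less_trans)
  show "eps_B_bound (4/5) 200 200 < 1 / 10 ^ 100"
    using order_trans[OF B add_right_mono[OF D]] small by (rule le_less_trans)
qed

lemma eps_4_5: "eps_D (4/5) 200 200 < 1 / 10 ^ 100" "eps_B (4/5) 200 200 < 1 / 10 ^ 100"
  using eps_D_le[of "4/5" 200 200] eps_B_bounds(1)[of "4/5" 200 200] eps_bounds_4_5 by simp_all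

text \<open>By $e \ge 2$.\<close>

lemma truncation_condition:
  assumes "0 < L" "0 < T" "exp 1 * L * T / 2 \<le> real (2 * N)"
  shows "0 < N" "T * L \<le> 2 * real N"
proof -
  have "2 * (T * L) \<le> exp 1 * (T * L)"
    using assms exp_ge_add_one_self[of "1::real"] by (intro mult_right_mono) auto
  then have le: "2 * (T * L) \<le> 4 * real N" using assms(3) by (simp add: ac_simps)
  then show "T * L \<le> 2 * real N" by linarith
  have "0 < T * L" using assms by simp
  then show "0 < N" using le by (cases N) auto
qed

theorem theorem1p1:
  shows
    "(\<exists>c::real. \<forall>L::real. 0 < L \<longrightarrow>
        (\<exists>!T0. is_threshold L T0)
      \<and> (\<forall>T0. is_threshold L T0 \<longrightarrow> T1 L < T0 \<and> (T0 - T1 L) / T1 L \<le> c * inverse (T1 L))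
      \<and> (\<forall>T>0. 0 < beta_star L T \<longrightarrow> T1 L < T))
   \<and> (\<forall>(L::real) (T::real). 0 < L \<longrightarrow> 0 < T \<longrightarrow> 0 < beta_star L T \<longrightarrow>
        (\<forall>f \<in> even_L2 L. weil_Q L f \<ge> ereal (form_R L T f))
      \<and> (\<forall>f \<in> even_L2 L.
           ((\<lambda>(i, j). M_R L T i j * L2_inner f (legendre_fun L (2 * i))
                                 * L2_inner f (legendre_fun L (2 * j)))
             has_sum form_R L T f) UNIV)
      \<and> (\<forall>n m. even n \<longrightarrow> even m \<longrightarrow>
           \<bar>C_mat L T n m\<bar> \<le> K_const L T * sqrt ((real n + 1/2) * (real m + 1/2))
                               * (T * L) ^ max n m / odd_dfact (max n m))
      \<and> (\<forall>N::nat. real (2 * N) \<ge> exp 1 * L * T / 2 \<longrightarrow>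
           (\<forall>l0. 0 < l0 \<longrightarrow> least_eigenvalue (A_block L T N) \<ge> l0 \<longrightarrow>
              (\<forall>f \<in> even_L2 L.
                 weil_Q L f \<ge> ereal ((min l0 (beta_star L T - eps_D L T N) - eps_B L T N)
                                       * L2_normsq f)))
         \<and> eps_D L T N \<le> eps_D_bound L T N
         \<and> eps_B L T N \<le> eps_B_bound L T N)
      \<and> (\<forall>a>0. (\<lambda>N. eps_D L T N) \<in> O(\<lambda>N. exp (- a * real N))
             \<and> (\<lambda>N. eps_B L T N) \<in> O(\<lambda>N. exp (- a * real N))))
   \<and> eps_D (4/5) 200 200 < 1 / 10 ^ 100
   \<and> eps_B (4/5) 200 200 < 1 / 10 ^ 100"
proof (intro conjI exI[of _ 1] allI impI ballI)
  fix L T0 :: real assume "is_threshold L T0"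
  from threshold_unique_and_close(2)[OF this]
  show "T1 L < T0" "(T0 - T1 L) / T1 L \<le> 1 * inverse (T1 L)" by auto
next
  fix L T :: real assume L: "0 < L" and T: "0 < T" and beta: "0 < beta_star L T"
  have T': "1/2 \<le> T"
    using T1_less_if_beta_star_pos[OF T beta] T1_ge_two_pi[of L] pi_gt3 by linarith
  {
    fix f assume "f \<in> even_L2 L"
    then show "ereal (form_R L T f) \<le> weil_Q L f"
      and "((\<lambda>(i, j). M_R L T i j * L2_inner f (legendre_fun L (2 * i))
                                 * L2_inner f (legendre_fun L (2 * j)))
             has_sum form_R L T f) UNIV"
      by (rule weil_Q_ge_form_R[OF L T beta], rule form_R_has_sum[OF L T])
  }
  {
    fix n m :: nat assume "even n" "even m"
    then show "\<bar>C_mat L T n m\<bar> \<le> K_const L T * sqrt ((real n + 1/2) * (real m + 1/2))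
                               * (T * L) ^ max n m / odd_dfact (max n m)"
      by (intro C_mat_bound L T) (auto simp: max_def)
  }
  {
    fix N assume "exp 1 * L * T / 2 \<le> real (2 * N)"
    note N = truncation_condition[OF L T this]
    show "eps_D L T N \<le> eps_D_bound L T N" by (rule eps_D_le[OF L T N])
    show "eps_B L T N \<le> eps_B_bound L T N" by (rule eps_B_bounds(1)[OF L T' N])
    fix l0 f assume "l0 \<le> least_eigenvalue (A_block L T N)" "f \<in> even_L2 L"
    then show "ereal ((min l0 (beta_star L T - eps_D L T N) - eps_B L T N) * L2_normsq f) \<le> weil_Q L f"
      by (rule weil_Q_ge_blocks[OF L T beta N])
  }
  {
    fix a :: real assume "0 < a"
    from eps_superexponential[OF L T' this]
    show "(\<lambda>N. eps_D L T N) \<in> O(\<lambda>N. exp (- a * real N))"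
      and "(\<lambda>N. eps_B L T N) \<in> O(\<lambda>N. exp (- a * real N))" .
  }
qed (use threshold_unique_and_close(1) T1_less_if_beta_star_pos eps_4_5 in auto)

end
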